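(* Let $\mathcal T^*$ be a geometric (partially truncated) triangulation of a hyperbolic $3$-manifold $N$, with corresponding abstract triangulation $\mathcal T$. Take a universal cover $\mathbb H^3\supset\widetilde N\to N$, let $\mathcal O$ be a horospherical cross-section for $N$, and let $\mathcal T_{\mathbb M}(\mathcal O)$ be the associated lifting of $\mathcal T$ to Minkowski space $\mathbb M^{3+1}$. Then: 1. If $\widehat F$ is a $2$-face of $\mathcal T_{\mathbb M}(\mathcal O)$ and the two tetrahedra incident to $\widehat F$ have the same image in $\mathcal T$, then the angle at $\widehat F$ is strictly convex. 2. If $\widehat e$ is an edge of $\mathcal T_{\mathbb M}(\mathcal O)$ with three incident tetrahedra $\widehat\Delta_i$ and three incident $2$-faces $\widehat F_i$, for $i=1,2,3$, and the images of the $\widehat\Delta_i$'s in $\mathcal T$ are not pairwise distinct, then the angles at the $\widehat F_i$'s are strictly convex.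
   Context: "Hyperbolic $N$" means: $N$ is a complete finite-volume orientable hyperbolic $3$-manifold with geodesic boundary. Partially truncated tetrahedra and triangulations. A partially truncated tetrahedron is a tetrahedron $\Delta$ with a set $\mathcal I$ of vertices (ideal vertices) and a set $\mathcal Z$ of edges (length-$0$ edges) such that no endpoint of an edge in $\mathcal Z$ is in $\mathcal I$; $\Delta^*$ is $\Delta$ minus the ideal vertices, the length-$0$ edges, and small open stars of the non-ideal vertices; lateral hexagons (resp. truncation triangles) are the intersections of $\Delta^*$ with faces of $\Delta$ (resp. links of non-ideal vertices). A geometric realization is an embedding of $\Delta^*$ in $\mathbb H^3$ with truncation triangles geodesic triangles (ideal vertices corresponding to missing vertices), lateral hexagons geodesic polygons (ideal vertices corresponding to missing edges), and truncation triangles orthogonal to lateral hexagons. A geometric triangulation $\mathcal T^*$ of $N$ is a realization of the hyperbolic manifold $N$ as a gluing of finitely many geometric realizations $\Delta^*$ along isometries of their lateral hexagons (induced by a simplicial pairing of the faces of the $\Delta$'s); the truncation triangles tile $\partial N$ and ideal vertices correspond to toric cusps. $\mathcal T$ denotes the corresponding collection of untruncated tetrahedra with face pairings. Minkowski space. $\mathbb M^{3+1}$ is $\mathbb R^4$ with $\langle x,y\rangle=-x_0y_0+x_1y_1+x_2y_2+x_3y_3$. $\mathcal H^3_-=\{\langle x,x\rangle=-1,\ x_0>0\}$ is the hyperboloid model of $\mathbb H^3$, $\mathcal H^3_+=\{\langle x,x\rangle=1\}$, $L^3_+=\{\langle x,x\rangle=0,\ x_0>0\}$. $w\in\mathcal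 H^3_+$ is dual to the half-space $\{v\in\mathcal H^3_-:\langle v,w\rangle\le0\}$, and $u\in L^3_+$ is dual to the horosphere $\{v\in\mathcal H^3_-:\langle v,u\rangle=-1\}$. $\pi$ is the projection of $\mathbb M^{3+1}\setminus\{0\}$ to projective space $\mathbb P(\mathbb M^{3+1})$, which identifies $\mathcal H^3_-$ with the projective model of $\mathbb H^3$ and maps $L^3_+$ onto its boundary at infinity. Lifting. The universal cover $\widetilde N$ is realized as a closed convex region of $\mathbb H^3$ bounded by a family of disjoint planes. $\mathcal B\subset\mathcal H^3_+$ is the set of vectors dual to the half-spaces that contain $\widetilde N$ and are bounded by a component of $\partial\widetilde N$. $Q$ is the set of points at infinity of $\widetilde N$ generating toric cusps, i.e. fixed by a $\mathbb Z\oplus\mathbb Z$ group of parabolic deck transformations. A horospherical cross-section $\mathcal O$ of $N$ is a family of disjoint tori, one at each toric cusp, that lift to horospheres in $\widetilde N$ and bound disjoint cusps. $\widetilde Q(\mathcal O)\subset L^3_+$ contains for each $q\in Q$ the only $\tilde q$ with $\pi(\tilde q)=q$ whose dual horosphere projects to a component of $\mathcal O$. Lift $\mathcal T^*$ to $\widetilde N$; each lifted tetrahedron has truncation triangles lying on components of $\partial\widetilde N$ and ideal vertices in $Q$. The corresponding tetrahedron of $\mathcal T_{\mathbb M}(\mathcal O)$ is the convex hull of the four vectors obtained by lifting each non-ideal vertex to the vector of $\mathcal B$ dual to its truncation plane and each ideal vertex $q$ to $\widetilde Q(\mathcal O)\cap\pi^{-1}(q)$. Angles. Let $P_1,P_2$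 be finite $3$-dimensional convex polyhedra in $\mathbb M^{3+1}\setminus\{0\}$ that project injectively to $\mathbb P(\mathbb M^{3+1})$ and share a $2$-face $F$. Let $H_i$ be the (affine) half-hyperplane with $H_i\supset P_i$ and $\partial H_i\supset F$. $P_1,P_2$ form a convex angle at $F$ if the connected component of $\mathbb M^{3+1}\setminus(H_1\cup H_2)$ not containing $0$ is convex; the angle is strictly convex if it is convex and $H_1\cup H_2$ is not a hyperplane. *)

theory Defs
  imports "HOL-Analysis.Analysis" "HOL-Algebra.Elementary_Groups"
begin

section \<open>Minkowski space and the hyperboloid model\<close>

text \<open>Minkowski space is the type \<open>real^4\<close>; coordinates are indexed by \<open>0, 1, 2, 3 :: 4\<close>,
  the time coordinate being \<open>0\<close> (which equals \<open>4\<close> in this index type).\<close>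

definition mink :: "real^4 \<Rightarrow> real^4 \<Rightarrow> real" where
  "mink x y = - (x $ 0 * y $ 0) + x $ 1 * y $ 1 + x $ 2 * y $ 2 + x $ 3 * y $ 3"

definition hyp3 :: "(real^4) set" where
  "hyp3 = {x. mink x x = -1 \<and> x $ 0 > 0}"

definition de_sitter :: "(real^4) set" where
  "de_sitter = {x. mink x x = 1}"

definition light_cone :: "(real^4) set" where
  "light_cone = {x. mink x x = 0 \<and> x $ 0 > 0}"

definition half_space :: "real^4 \<Rightarrow> (real^4) set" where
  "half_space w = {v \<in> hyp3. mink v w \<le> 0}"

definition plane :: "real^4 \<Rightarrow> (real^4) set" where
  "plane w = {v \<in> hyp3. mink v w = 0}"

definition horosphere :: "real^4 \<Rightarrow> (real^4) set" where
  "horosphere u = {v \<in> hyp3. mink v u = -1}"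

definition horoball :: "real^4 \<Rightarrow> (real^4) set" where
  "horoball u = {v \<in> hyp3. mink v u \<ge> -1}"

text \<open>The projection to projective space, in the affine chart where the time coordinate is 1.
  It is used only on vectors with positive time coordinate; it maps \<open>hyp3\<close> onto the open unit
  ball and \<open>light_cone\<close> onto the unit sphere, and geodesics to straight segments.\<close>

definition klein :: "real^4 \<Rightarrow> real^4" where
  "klein x = x /\<^sub>R (x $ 0)"

definition hdist :: "real^4 \<Rightarrow> real^4 \<Rightarrow> real" where
  "hdist x y = arcosh (- mink x y)"

definition hyp_isometry :: "real^4^4 \<Rightarrow> bool" where
  "hyp_isometry A \<longleftrightarrow>
     (\<forall>x y. mink (A *v x) (A *v y) = mink x y) \<and> (*v) A ` hyp3 = hyp3"

definition hyp_convex :: "(real^4) set \<Rightarrow> bool" where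
  "hyp_convex S \<longleftrightarrow> S \<subseteq> hyp3 \<and> convex (klein ` S)"

text \<open>In the coordinates \<open>(x\<^sub>1, x\<^sub>2, x\<^sub>3)\<close> on the hyperboloid the hyperbolic volume element is
  \<open>dx\<^sub>1 dx\<^sub>2 dx\<^sub>3 / x\<^sub>0\<close>, where \<open>x\<^sub>0 = sqrt (1 + x\<^sub>1\<^sup>2 + x\<^sub>2\<^sup>2 + x\<^sub>3\<^sup>2)\<close>.\<close>

definition spatial :: "real^4 \<Rightarrow> real^3" where
  "spatial x = vector [x $ 1, x $ 2, x $ 3]"

definition hyp_volume :: "(real^4) set \<Rightarrow> ennreal" where
  "hyp_volume S =
     (\<integral>\<^sup>+ y. indicator (spatial ` S) y * ennreal (1 / sqrt (1 + (norm y)\<^sup>2)) \<partial>lborel)"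

section \<open>Hyperbolic 3-manifolds with geodesic boundary\<close>

text \<open>Charts take values in a half-space, hence cover both interior and boundary points.\<close>

definition hyp_chart :: "'n::metric_space set \<Rightarrow> 'n set \<Rightarrow> ('n \<Rightarrow> real^4) \<Rightarrow> bool" where
  "hyp_chart N U \<phi> \<longleftrightarrow>
     openin (top_of_set N) U \<and>
     (\<exists>w \<in> de_sitter. openin (top_of_set (half_space w)) (\<phi> ` U)) \<and>
     (\<forall>x \<in> U. \<forall>y \<in> U. hdist (\<phi> x) (\<phi> y) = dist x y)"

definition orientable_hyp :: "'n::metric_space set \<Rightarrow> bool" where
  "orientable_hyp N \<longleftrightarrow> (\<exists>\<A>.
     (\<forall>(U, \<phi>) \<in> \<A>. hyp_chart N U \<phi>) \<and> N \<subseteq> (\<Union>(U, \<phi>) \<in> \<A>. U) \<and>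
     (\<forall>(U, \<phi>) \<in> \<A>. \<forall>(V, \<psi>) \<in> \<A>. \<forall>x \<in> U \<inter> V.
        \<exists>A W. hyp_isometry A \<and> det A = 1 \<and> openin (top_of_set N) W \<and> x \<in> W \<and>
              W \<subseteq> U \<inter> V \<and> (\<forall>y \<in> W. \<phi> y = A *v \<psi> y)))"

definition finite_hyp_volume :: "'n::metric_space set \<Rightarrow> bool" where
  "finite_hyp_volume N \<longleftrightarrow> (\<exists>(U :: nat \<Rightarrow> 'n set) \<phi> A.
     (\<forall>n. hyp_chart N (U n) (\<phi> n) \<and> A n \<subseteq> U n \<and> \<phi> n ` A n \<in> sets borel) \<and>
     N \<subseteq> (\<Union>n. A n) \<and> (\<Sum>n. hyp_volume (\<phi> n ` A n)) < \<infinity>)"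

text \<open>The manifold is a metric space locally isometric to half-spaces. The distance is not required
  to be the path metric: two metrics that agree locally induce the same hyperbolic structure,
  and completeness for the given one implies completeness for the path metric.\<close>

definition hyperbolic_manifold :: "'n::metric_space set \<Rightarrow> bool" where
  "hyperbolic_manifold N \<longleftrightarrow>
     N \<noteq> {} \<and> connected N \<and> complete N \<and>
     (\<forall>x \<in> N. \<exists>U \<phi>. x \<in> U \<and> hyp_chart N U \<phi>) \<and>
     orientable_hyp N \<and> finite_hyp_volume N"

definition local_isometry_on :: "(real^4) set \<Rightarrow> (real^4 \<Rightarrow> 'n::metric_space) \<Rightarrow> bool" where
  "local_isometry_on P f \<longleftrightarrow>
     (\<forall>x \<in> P. \<exists>r>0. \<forall>y \<in> P. \<forall>z \<in> P.
        hdist x y < r \<longrightarrow> hdist x z < r \<longrightarrow> dist (f y) (f z) = hdist y z)"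

section \<open>The universal cover\<close>

definition boundary_components :: "(real^4) set \<Rightarrow> (real^4) set set" where
  "boundary_components Nt = components (top_of_set hyp3 frontier_of Nt)"

definition convex_region :: "(real^4) set \<Rightarrow> bool" where
  "convex_region Nt \<longleftrightarrow>
     hyp_convex Nt \<and> closedin (top_of_set hyp3) Nt \<and> top_of_set hyp3 interior_of Nt \<noteq> {} \<and>
     boundary_components Nt \<subseteq> plane ` de_sitter"

definition deck :: "(real^4) set \<Rightarrow> (real^4 \<Rightarrow> 'n) \<Rightarrow> (real^4^4) set" where
  "deck Nt p = {A. hyp_isometry A \<and> (*v) A ` Nt = Nt \<and> (\<forall>x \<in> Nt. p (A *v x) = p x)}"

definition deck_group :: "(real^4) set \<Rightarrow> (real^4 \<Rightarrow> 'n) \<Rightarrow> (real^4^4) monoid" where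
  "deck_group Nt p = \<lparr>carrier = deck Nt p, monoid.mult = (**), one = mat 1\<rparr>"

text \<open>The last clause says that \<open>N\<close> is the quotient of \<open>Nt\<close> by the deck group. It is recorded for
  convenience: it follows from the others, since the convex set \<open>Nt\<close> is simply connected and a
  local isometry of \<open>Nt\<close> onto itself extends to an isometry of hyperbolic space.\<close>

definition universal_cover ::
  "'n::metric_space set \<Rightarrow> (real^4) set \<Rightarrow> (real^4 \<Rightarrow> 'n) \<Rightarrow> bool" where
  "universal_cover N Nt p \<longleftrightarrow>
     convex_region Nt \<and> covering_space Nt p N \<and> local_isometry_on Nt p \<and>
     (\<forall>x \<in> Nt. \<forall>y \<in> Nt. p x = p y \<longrightarrow> (\<exists>A \<in> deck Nt p. y = A *v x))"

definition dual_vectors :: "(real^4) set \<Rightarrow> (real^4) set" where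
  "dual_vectors Nt = {w \<in> de_sitter. Nt \<subseteq> half_space w \<and> plane w \<in> boundary_components Nt}"

section \<open>Toric cusps and horospherical cross-sections\<close>

definition fixes_ray :: "real^4^4 \<Rightarrow> real^4 \<Rightarrow> bool" where
  "fixes_ray A u \<longleftrightarrow> (\<exists>c::real. A *v u = c *\<^sub>R u)"

definition parabolic :: "real^4^4 \<Rightarrow> bool" where
  "parabolic A \<longleftrightarrow>
     hyp_isometry A \<and> (\<forall>x \<in> hyp3. A *v x \<noteq> x) \<and> (\<exists>!u. u \<in> klein ` light_cone \<and> fixes_ray A u)"

text \<open>The set \<open>Q\<close> of points at infinity of \<open>Nt\<close> generating toric cusps, represented by the set of
  all light-like vectors that project to a point of \<open>Q\<close> (so it is closed under positive scaling).\<close>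

definition toric_rays :: "(real^4) set \<Rightarrow> (real^4 \<Rightarrow> 'n) \<Rightarrow> (real^4) set" where
  "toric_rays Nt p = {u \<in> light_cone. klein u \<in> closure (klein ` Nt) \<and>
     (\<exists>G. subgroup G (deck_group Nt p) \<and>
          (deck_group Nt p)\<lparr>carrier := G\<rparr> \<cong> integer_group \<times>\<times> integer_group \<and>
          (\<forall>A \<in> G. fixes_ray A u \<and> (A \<noteq> mat 1 \<longrightarrow> parabolic A)))}"

text \<open>\<open>\<O>\<close> is the set of the component tori.\<close>

definition lifted_cusps ::
  "(real^4) set \<Rightarrow> (real^4 \<Rightarrow> 'n) \<Rightarrow> 'n set set \<Rightarrow> (real^4) set" where
  "lifted_cusps Nt p \<O> = {u \<in> toric_rays Nt p. p ` horosphere u \<in> \<O>}"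

text \<open>The fourth clause says that there is a torus at each toric cusp and only one. The last one
  says that the tori bound disjoint (embedded) cusps: these lift to the horoballs
  dual to the vectors in \<open>lifted_cusps\<close>.\<close>

definition horospherical_cross_section ::
  "(real^4) set \<Rightarrow> (real^4 \<Rightarrow> 'n::metric_space) \<Rightarrow> 'n set set \<Rightarrow> bool" where
  "horospherical_cross_section Nt p \<O> \<longleftrightarrow>
     (\<forall>X \<in> \<O>. X \<noteq> {} \<and> X \<subseteq> p ` Nt \<and>
        X homeomorphic (sphere (0::complex) 1 \<times> sphere (0::complex) 1)) \<and>
     pairwise disjnt \<O> \<and>
     (\<forall>X \<in> \<O>. components {x \<in> Nt. p x \<in> X} \<subseteq> horosphere ` toric_rays Nt p) \<and>
     (\<forall>u \<in> toric_rays Nt p. \<exists>!c. c > 0 \<and> c *\<^sub>R u \<in> lifted_cusps Nt p \<O>) \<and>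
     (\<forall>u \<in> lifted_cusps Nt p \<O>. horoball u \<subseteq> Nt) \<and>
     pairwise (\<lambda>u u'. disjnt (horoball u) (horoball u')) (lifted_cusps Nt p \<O>)"

section \<open>Partially truncated tetrahedra\<close>

text \<open>The model of \<open>\<Delta>\<close> is the standard simplex in barycentric coordinates. Its vertices and its faces
  are indexed by the type \<open>4\<close>, the face \<open>i\<close> being opposite to the vertex \<open>i\<close>; an edge is a set
  of two vertices. The open star removed at the non-ideal vertex \<open>k\<close> is \<open>x $ k > 3/4\<close>.\<close>

definition ptt_data :: "4 set \<Rightarrow> 4 set set \<Rightarrow> bool" where
  "ptt_data I Z \<longleftrightarrow> (\<forall>E \<in> Z. card E = 2 \<and> E \<inter> I = {})"

definition std_simplex :: "(real^4) set" where
  "std_simplex = {x. (\<forall>k. 0 \<le> x $ k) \<and> (\<Sum>k\<in>UNIV. x $ k) = 1}"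

text \<open>\<open>\<Delta>\<close> minus the stars of the non-ideal vertices; ideal vertices and length-0 edges still present.\<close>

definition closed_model :: "4 set \<Rightarrow> (real^4) set" where
  "closed_model I = {x \<in> std_simplex. \<forall>k. k \<notin> I \<longrightarrow> x $ k \<le> 3/4}"

definition model_edge :: "4 set \<Rightarrow> 4 set \<Rightarrow> (real^4) set" where
  "model_edge I E = {x \<in> closed_model I. \<forall>k. k \<notin> E \<longrightarrow> x $ k = 0}"

definition missing :: "4 set \<Rightarrow> 4 set set \<Rightarrow> (real^4) set" where
  "missing I Z = (\<lambda>k. axis k 1) ` I \<union> (\<Union>E \<in> Z. model_edge I E)"

definition ptt :: "4 set \<Rightarrow> 4 set set \<Rightarrow> (real^4) set" where
  "ptt I Z = closed_model I - missing I Z"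

definition lateral :: "4 \<Rightarrow> (real^4) set" where
  "lateral i = {x. x $ i = 0}"

definition truncation :: "4 \<Rightarrow> (real^4) set" where
  "truncation k = {x. x $ k = 3/4}"

definition corners :: "4 set \<Rightarrow> (real^4) set" where
  "corners I = (\<lambda>k. axis k 1) ` I \<union>
     {axis k (3/4) + axis j (1/4) | k j. k \<notin> I \<and> j \<noteq> k}"

text \<open>A geometric realization \<open>e\<close> embeds \<open>ptt I Z\<close> in hyperbolic space. Also its values on the missing
  points are part of the data: they are light-like vectors, determined up to scale, that
  represent the ideal points to which \<open>e\<close> extends continuously (in the projective model).
  The faces \<open>S\<close> of the model go to geodesic polygons, i.e., in the projective model, to
  the convex hulls of the images of their corners, and likewise the whole model goes to a
  geodesic polyhedron. The condition \<open>dim = 3\<close> on the linear span says that a polygon lies in a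
  unique plane, so that any two vectors Minkowski-orthogonal to two such spans are normal to the
  respective planes.\<close>

definition geodesic_image :: "(real^4 \<Rightarrow> real^4) \<Rightarrow> 4 set \<Rightarrow> (real^4) set \<Rightarrow> bool" where
  "geodesic_image e I S \<longleftrightarrow>
     klein ` e ` (closed_model I \<inter> S) = convex hull (klein ` e ` (corners I \<inter> S))"

definition geometric_realization :: "4 set \<Rightarrow> 4 set set \<Rightarrow> (real^4 \<Rightarrow> real^4) \<Rightarrow> bool" where
  "geometric_realization I Z e \<longleftrightarrow>
     e ` ptt I Z \<subseteq> hyp3 \<and> e ` missing I Z \<subseteq> light_cone \<and>
     inj_on e (ptt I Z) \<and> continuous_on (closed_model I) (klein \<circ> e) \<and>
     (\<forall>E \<in> Z. (klein \<circ> e) constant_on model_edge I E) \<and>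
     geodesic_image e I UNIV \<and>
     (\<forall>i. geodesic_image e I (lateral i) \<and> dim (e ` (closed_model I \<inter> lateral i)) = 3) \<and>
     (\<forall>k. k \<notin> I \<longrightarrow>
        geodesic_image e I (truncation k) \<and> dim (e ` (closed_model I \<inter> truncation k)) = 3) \<and>
     (\<forall>k i. k \<notin> I \<longrightarrow> i \<noteq> k \<longrightarrow>
        (\<forall>w n. (\<forall>x \<in> closed_model I \<inter> truncation k. mink (e x) w = 0) \<longrightarrow>
               (\<forall>x \<in> closed_model I \<inter> lateral i. mink (e x) n = 0) \<longrightarrow> mink w n = 0))"

section \<open>Geometric triangulations\<close>

text \<open>\<open>pairing \<sigma> i = (\<tau>, \<phi>)\<close> means that the face \<open>i\<close> of \<open>\<sigma>\<close> is glued to the face \<open>\<phi> i\<close> of \<open>\<tau>\<close>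
  by the simplicial map that sends the vertex \<open>k \<noteq> i\<close> to the vertex \<open>\<phi> k\<close>.\<close>

record 't triangulation =
  tetrahedra :: "'t set"
  ideals :: "'t \<Rightarrow> 4 set"
  zero_edges :: "'t \<Rightarrow> 4 set set"
  pairing :: "'t \<Rightarrow> 4 \<Rightarrow> 't \<times> (4 \<Rightarrow> 4)"

definition abstract_triangulation :: "'t triangulation \<Rightarrow> bool" where
  "abstract_triangulation T \<longleftrightarrow>
     finite (tetrahedra T) \<and>
     (\<forall>\<sigma> \<in> tetrahedra T. ptt_data (ideals T \<sigma>) (zero_edges T \<sigma>)) \<and>
     (\<forall>\<sigma> \<in> tetrahedra T. \<forall>i \<tau> \<phi>. pairing T \<sigma> i = (\<tau>, \<phi>) \<longrightarrow>
        \<tau> \<in> tetrahedra T \<and> bij \<phi> \<and>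
        pairing T \<tau> (\<phi> i) = (\<sigma>, inv_into UNIV \<phi>) \<and> (\<tau>, \<phi> i) \<noteq> (\<sigma>, i) \<and>
        (\<forall>k. k \<noteq> i \<longrightarrow> (k \<in> ideals T \<sigma> \<longleftrightarrow> \<phi> k \<in> ideals T \<tau>)) \<and>
        (\<forall>E. i \<notin> E \<longrightarrow> (E \<in> zero_edges T \<sigma> \<longleftrightarrow> \<phi> ` E \<in> zero_edges T \<tau>)))"

definition cell :: "'t triangulation \<Rightarrow> ('t \<Rightarrow> real^4 \<Rightarrow> real^4) \<Rightarrow> 't \<Rightarrow> (real^4) set \<Rightarrow> (real^4) set" where
  "cell T e \<sigma> S = e \<sigma> ` (ptt (ideals T \<sigma>) (zero_edges T \<sigma>) \<inter> S)"

text \<open>\<open>A\<close> restricts to an isometry from the lateral hexagon \<open>i\<close> of \<open>\<sigma>\<close> to the lateral hexagon \<open>\<phi> i\<close>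
  of \<open>\<tau>\<close> which respects the sides as prescribed by \<open>\<phi>\<close>.\<close>

definition hexagon_isometry ::
  "'t triangulation \<Rightarrow> ('t \<Rightarrow> real^4 \<Rightarrow> real^4) \<Rightarrow> 't \<Rightarrow> 4 \<Rightarrow> 't \<Rightarrow> (4 \<Rightarrow> 4) \<Rightarrow> real^4^4 \<Rightarrow> bool" where
  "hexagon_isometry T e \<sigma> i \<tau> \<phi> A \<longleftrightarrow>
     hyp_isometry A \<and>
     (*v) A ` cell T e \<sigma> (lateral i) = cell T e \<tau> (lateral (\<phi> i)) \<and>
     (\<forall>j. j \<noteq> i \<longrightarrow>
        (*v) A ` cell T e \<sigma> (lateral i \<inter> lateral j) =
          cell T e \<tau> (lateral (\<phi> i) \<inter> lateral (\<phi> j))) \<and>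
     (\<forall>k. k \<noteq> i \<longrightarrow> k \<notin> ideals T \<sigma> \<longrightarrow>
        (*v) A ` cell T e \<sigma> (lateral i \<inter> truncation k) =
          cell T e \<tau> (lateral (\<phi> i) \<inter> truncation (\<phi> k)))"

definition glued ::
  "'t triangulation \<Rightarrow> ('t \<Rightarrow> real^4 \<Rightarrow> real^4) \<Rightarrow> (('t \<times> (real^4)) \<times> ('t \<times> (real^4))) set" where
  "glued T e = {((\<sigma>, x), (\<tau>, y)). \<sigma> \<in> tetrahedra T \<and>
     (\<exists>i \<phi> A. pairing T \<sigma> i = (\<tau>, \<phi>) \<and> hexagon_isometry T e \<sigma> i \<tau> \<phi> A \<and>
        x \<in> cell T e \<sigma> (lateral i) \<and> y = A *v x)}"

text \<open>The maps \<open>f \<sigma>\<close> identify \<open>N\<close>, as a hyperbolic manifold, with the quotient of the disjoint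
  union of the geometric realizations by the equivalence relation generated by the gluings
  (which is \<open>(glued T e)\<^sup>*\<close>, because \<open>pairing\<close> is involutive).\<close>

definition geometric_triangulation ::
  "'n::metric_space set \<Rightarrow> 't triangulation \<Rightarrow> ('t \<Rightarrow> real^4 \<Rightarrow> real^4) \<Rightarrow> ('t \<Rightarrow> real^4 \<Rightarrow> 'n) \<Rightarrow> bool"
where
  "geometric_triangulation N T e f \<longleftrightarrow>
     abstract_triangulation T \<and>
     (\<forall>\<sigma> \<in> tetrahedra T. geometric_realization (ideals T \<sigma>) (zero_edges T \<sigma>) (e \<sigma>)) \<and>
     (\<forall>\<sigma> \<in> tetrahedra T. \<forall>i \<tau> \<phi>. pairing T \<sigma> i = (\<tau>, \<phi>) \<longrightarrow>
        (\<exists>A. hexagon_isometry T e \<sigma> i \<tau> \<phi> A)) \<and>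
     (\<Union>\<sigma> \<in> tetrahedra T. f \<sigma> ` cell T e \<sigma> UNIV) = N \<and>
     (\<forall>\<sigma> \<in> tetrahedra T. \<forall>\<tau> \<in> tetrahedra T. \<forall>x \<in> cell T e \<sigma> UNIV. \<forall>y \<in> cell T e \<tau> UNIV.
        f \<sigma> x = f \<tau> y \<longleftrightarrow> ((\<sigma>, x), (\<tau>, y)) \<in> (glued T e)\<^sup>*) \<and>
     (\<forall>U \<subseteq> N. openin (top_of_set N) U \<longleftrightarrow>
        (\<forall>\<sigma> \<in> tetrahedra T. openin (top_of_set (cell T e \<sigma> UNIV)) {x \<in> cell T e \<sigma> UNIV. f \<sigma> x \<in> U})) \<and>
     (\<forall>\<sigma> \<in> tetrahedra T. local_isometry_on (cell T e \<sigma> UNIV) (f \<sigma>))"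

section \<open>Lifting to Minkowski space\<close>

text \<open>A lift of the tetrahedron \<open>\<sigma>\<close> to \<open>Nt\<close> is the image of its realization under an isometry \<open>A\<close>
  such that \<open>p \<circ> A\<close> is \<open>f \<sigma>\<close>; \<open>v\<close> gives the vectors to which its vertices are lifted.\<close>

definition lifted_vertices ::
  "'t triangulation \<Rightarrow> ('t \<Rightarrow> real^4 \<Rightarrow> real^4) \<Rightarrow> ('t \<Rightarrow> real^4 \<Rightarrow> 'n) \<Rightarrow>
   (real^4) set \<Rightarrow> (real^4 \<Rightarrow> 'n) \<Rightarrow> 'n set set \<Rightarrow> 't \<Rightarrow> real^4^4 \<Rightarrow> (4 \<Rightarrow> real^4) \<Rightarrow> bool" where
  "lifted_vertices T e f Nt p \<O> \<sigma> A v \<longleftrightarrow>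
     hyp_isometry A \<and> (*v) A ` cell T e \<sigma> UNIV \<subseteq> Nt \<and>
     (\<forall>x \<in> cell T e \<sigma> UNIV. p (A *v x) = f \<sigma> x) \<and>
     (\<forall>k. k \<notin> ideals T \<sigma> \<longrightarrow>
        v k \<in> dual_vectors Nt \<and> (*v) A ` cell T e \<sigma> (truncation k) \<subseteq> plane (v k)) \<and>
     (\<forall>k \<in> ideals T \<sigma>.
        v k \<in> lifted_cusps Nt p \<O> \<and> klein (v k) = klein (A *v e \<sigma> (axis k 1)))"

text \<open>The tetrahedra of the lifted triangulation, each paired with its image in \<open>T\<close>.\<close>

definition mink_triangulation ::
  "'t triangulation \<Rightarrow> ('t \<Rightarrow> real^4 \<Rightarrow> real^4) \<Rightarrow> ('t \<Rightarrow> real^4 \<Rightarrow> 'n) \<Rightarrow>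
   (real^4) set \<Rightarrow> (real^4 \<Rightarrow> 'n) \<Rightarrow> 'n set set \<Rightarrow> ('t \<times> (real^4) set) set" where
  "mink_triangulation T e f Nt p \<O> =
     {(\<sigma>, convex hull (range v)) | \<sigma> A v. \<sigma> \<in> tetrahedra T \<and> lifted_vertices T e f Nt p \<O> \<sigma> A v}"

definition faces_of_dim :: "int \<Rightarrow> ('t \<times> (real^4) set) set \<Rightarrow> (real^4) set set" where
  "faces_of_dim d TM = {F. aff_dim F = d \<and> (\<exists>D \<in> TM. F face_of snd D)}"

definition incident_tetrahedra ::
  "('t \<times> (real^4) set) set \<Rightarrow> (real^4) set \<Rightarrow> ('t \<times> (real^4) set) set" where
  "incident_tetrahedra TM F = {D \<in> TM. F face_of snd D}"

section \<open>Convex angles\<close>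

definition hyperplane :: "(real^4) set \<Rightarrow> bool" where
  "hyperplane L \<longleftrightarrow> (\<exists>a b. a \<noteq> 0 \<and> L = {x. a \<bullet> x = b})"

text \<open>\<open>H\<close> is an affine half-hyperplane and \<open>L\<close> is its boundary.\<close>

definition half_hyperplane :: "(real^4) set \<Rightarrow> (real^4) set \<Rightarrow> bool" where
  "half_hyperplane H L \<longleftrightarrow> (\<exists>a c b d. a \<noteq> c \<and> independent {a, c} \<and>
     H = {x. a \<bullet> x = b \<and> c \<bullet> x \<ge> d} \<and> L = {x. a \<bullet> x = b \<and> c \<bullet> x = d})"

definition angle_half_hyperplane ::
  "(real^4) set \<Rightarrow> (real^4) set \<Rightarrow> (real^4) set \<Rightarrow> bool" where
  "angle_half_hyperplane P F H \<longleftrightarrow> P \<subseteq> H \<and> (\<exists>L. half_hyperplane H L \<and> F \<subseteq> L)"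

definition strictly_convex_angle ::
  "(real^4) set \<Rightarrow> (real^4) set \<Rightarrow> (real^4) set \<Rightarrow> bool" where
  "strictly_convex_angle P1 P2 F \<longleftrightarrow>
     (\<exists>H1 H2. angle_half_hyperplane P1 F H1 \<and> angle_half_hyperplane P2 F H2 \<and>
        (\<exists>C \<in> components (- (H1 \<union> H2)). 0 \<notin> C \<and> convex C) \<and>
        \<not> hyperplane (H1 \<union> H2))"

definition strictly_convex_at :: "('t \<times> (real^4) set) set \<Rightarrow> (real^4) set \<Rightarrow> bool" where
  "strictly_convex_at TM F \<longleftrightarrow>
     (\<exists>D1 D2. D1 \<noteq> D2 \<and> incident_tetrahedra TM F = {D1, D2} \<and>
        strictly_convex_angle (snd D1) (snd D2) F)"

end

theory Submission
  imports Defs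
begin

text \<open>
  Let \<open>D\<close> be a tetrahedron of the lifted triangulation with vertices \<open>v a\<close>, let \<open>\<nu> a\<close> be the basis dual
  to them for the Minkowski form, and let \<open>z\<close> be the vertex that a neighbour \<open>D'\<close> does not share with
  \<open>D\<close>, across the face opposite to \<open>v i\<close>. The two tetrahedra are on different sides of that face when
  \<open>mink (\<nu> i) z < 0\<close>, and the angle is strictly convex when moreover \<open>z\<close> lies beyond the affine
  hyperplane spanned by \<open>D\<close>, that is when the sum of all \<open>mink (\<nu> a) z\<close> exceeds 1
  (\<open>strictly_convex_angle_of_relation\<close>).

  First part. If \<open>D\<close> and \<open>D'\<close> have the same image, they differ by a deck transformation \<open>G\<close>
  (\<open>lifts_differ_by_deck\<close>, \<open>deck_moves_vertices\<close>). Say that \<open>G\<close> maps the face \<open>j\<close> of \<open>D\<close> to its face \<open>i\<close>,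
  and let \<open>k\<close>, \<open>l\<close> be the two other vertices. The sum above minus 1 is, up to a positive factor, minus the
  sum of the tilts of the faces \<open>i\<close> and \<open>j\<close>. This sum is computed in the plane orthogonal to the edge
  \<open>v k\<close>, \<open>v l\<close>: it is negative as soon as the orthogonal projections of \<open>v i\<close> and of \<open>v j\<close> to the span of
  the edge have coefficients with sum above 1 (\<open>tilt_inequality\<close>). If \<open>G\<close> does not preserve the edge, this
  holds because the number \<open>mink (v k) (v l)\<close> occurs again among the pairings of \<open>v i\<close>, and of \<open>v j\<close>, with
  the end points of the edge (\<open>projection_to_edge\<close>). If \<open>G\<close> preserves the edge, it fixes a vector on it,
  which is timelike unless the edge has length 0. But a deck transformation that fixes a
  timelike vector fixes the point of the convex region \<open>Nt\<close> that is nearest to it, hence is trivial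
  (\<open>deck_fixing_point_trivial\<close>). For an edge of length 0 the sum of the two normals is a multiple
  of the lightlike vector \<open>v k + v l\<close>, and the sign is evident. The case \<open>i = j\<close> is excluded
  in the same way: then \<open>G\<close> permutes three vertices and fixes a timelike vector in their span.

  Second part. Let \<open>k\<close>, \<open>l\<close> be the vertices of the edge and \<open>x\<close>, \<open>y\<close>, \<open>z\<close> those of its link. As adjacent
  tetrahedra are on different sides of their common face, there is a relation
  \<open>z + r y + r' x = b k + b' l\<close> with positive \<open>r\<close>, \<open>r'\<close>. For each of the three faces, strict convexity
  is the same inequality \<open>b + b' > 1 + r + r'\<close>. It holds at the face between the two
  tetrahedra with the same image, by the first part.

  Both parts need the geometry of a single lifted tetrahedron: its four vertices are linearly
  independent and their mutual products are negative (\<open>vertex_family_vertices\<close>), and the truncated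
  polyhedron is the cone over vectors that are determined by the vertices
  (\<open>conic_combination_in_cell\<close>). If two lifts were on the same side of a common face, they would
  therefore have a common interior point, and would coincide because the gluings identify boundary
  points only (\<open>overlapping_lifts_equal\<close>).
\<close>

section \<open>Linear algebra of Minkowski space\<close>

lemma four_eq_zero: "(4::4) = 0"
  by simp

lemma UNIV_four: "(UNIV :: 4 set) = {0, 1, 2, 3}"
proof -
  have "insert 0 {1, 2, 3} = {1, 2, 3, 4 :: 4}"
    unfolding four_eq_zero by blast
  then show ?thesis
    by (metis UNIV_4)
qed

lemma sum_four: "sum f (UNIV :: 4 set) = f 0 + f 1 + f 2 + f 3"
  unfolding sum_4 four_eq_zero by (simp add: add_ac)

lemma vec_eq_iff_four:
  "x = (y :: real^4) \<longleftrightarrow> x $ 0 = y $ 0 \<and> x $ 1 = y $ 1 \<and> x $ 2 = y $ 2 \<and> x $ 3 = y $ 3"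
proof -
  have "(\<forall>i. x $ i = y $ i) \<longleftrightarrow> (\<forall>i \<in> {0, 1, 2, 3}. x $ i = y $ i)"
    unfolding UNIV_four[symmetric] by simp
  then show ?thesis
    by (simp add: vec_eq_iff)
qed

lemma mink_commute: "mink x y = mink y x"
  by (simp add: mink_def algebra_simps)

lemma mink_add_left: "mink (x + y) z = mink x z + mink y z"
  and mink_add_right: "mink z (x + y) = mink z x + mink z y"
  and mink_diff_left: "mink (x - y) z = mink x z - mink y z"
  and mink_diff_right: "mink z (x - y) = mink z x - mink z y"
  and mink_minus_left: "mink (- x) z = - mink x z"
  and mink_minus_right: "mink z (- x) = - mink z x"
  and mink_scaleR_left: "mink (c *\<^sub>R x) z = c * mink x z"
  and mink_scaleR_right: "mink z (c *\<^sub>R x) = c * mink z x"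
  and mink_zero_left: "mink 0 z = 0"
  and mink_zero_right: "mink z 0 = 0"
  by (simp_all add: mink_def algebra_simps)

lemmas mink_linear = mink_add_left mink_add_right mink_diff_left mink_diff_right
  mink_minus_left mink_minus_right mink_scaleR_left mink_scaleR_right mink_zero_left mink_zero_right

lemma linear_mink_right: "linear (mink x)"
  by (rule linearI) (simp_all add: mink_linear)

lemma mink_sum_right: "mink x (sum f S) = (\<Sum>s\<in>S. mink x (f s))"
  by (rule linear_sum[OF linear_mink_right])

lemma mink_sum_left: "mink (sum f S) x = (\<Sum>s\<in>S. mink (f s) x)"
  by (simp add: mink_commute[of _ x] mink_sum_right)

lemma continuous_on_mink [continuous_intros]:
  "continuous_on S f \<Longrightarrow> continuous_on S g \<Longrightarrow> continuous_on S (\<lambda>x. mink (f x) (g x))"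
  unfolding mink_def by (intro continuous_intros)

text \<open>This map turns covectors for the Euclidean inner product into covectors for the
  Minkowski form, and conversely.\<close>

definition time_flip :: "real^4 \<Rightarrow> real^4" where
  "time_flip x = (\<chi> i. if i = 0 then - x $ 0 else x $ i)"

lemma mink_time_flip: "mink (time_flip x) y = x \<bullet> y"
  by (simp add: mink_def time_flip_def inner_vec_def sum_four)

lemma mink_eq_inner: "mink x y = time_flip x \<bullet> y"
  by (simp add: mink_def time_flip_def inner_vec_def sum_four)

lemma mink_nondegenerate:
  assumes "\<And>y. mink x y = 0"
  shows "x = 0"
proof -
  have "time_flip x \<bullet> y = 0" for y
    using assms[of y] by (simp add: mink_eq_inner)
  then have "time_flip x = 0"
    using inner_eq_zero_iff by blast
  then have "time_flip x $ i = 0" for i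
    by simp
  then have "(if i = 0 then - x $ 0 else x $ i) = 0" for i
    by (simp add: time_flip_def)
  then have "x $ i = 0" for i
    by (metis neg_equal_0_iff_equal)
  then show ?thesis
    by (simp add: vec_eq_iff)
qed

lemma mink_zero_on_span:
  assumes "\<And>y. y \<in> B \<Longrightarrow> mink x y = 0" "y \<in> span B"
  shows "mink x y = 0"
  using linear_eq_0_on_span[OF linear_mink_right assms(1) assms(2)] by simp

lemma mink_eq_zero_if_spanning:
  assumes "span B = UNIV" "\<And>y. y \<in> B \<Longrightarrow> mink x y = 0"
  shows "x = 0"
  using mink_nondegenerate mink_zero_on_span[of B x] assms by blast

lemma spanning_four_independent:
  fixes v :: "4 \<Rightarrow> real^4"
  assumes "span (range v) = UNIV"
  shows "inj v" "independent (range v)"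
proof -
  have d: "dim (UNIV :: (real^4) set) = 4"
    by simp
  have le: "card (range v) \<le> 4"
    using card_image_le[of UNIV v] by simp
  show ind: "independent (range v)"
    by (rule card_le_dim_spanning[of _ UNIV]) (use assms d le in auto)
  have "card (range v) = 4"
    using dim_span_eq_card_independent[OF ind] assms d by simp
  then show "inj v"
    by (intro eq_card_imp_inj_on) auto
qed

text \<open>The second property is the expansion of a vector in the basis \<open>v\<close>. The
  vectors \<open>\<nu> a\<close> are normals of the four faces of the simplicial cone over the
  \<open>v b\<close>, pointing inwards.\<close>

lemma mink_dual_basis:
  fixes v :: "4 \<Rightarrow> real^4"
  assumes "span (range v) = UNIV"
  obtains \<nu> where "\<And>a b. mink (\<nu> a) (v b) = (if a = b then 1 else 0)"
    and "\<And>y. y = (\<Sum>a\<in>UNIV. mink (\<nu> a) y *\<^sub>R v a)"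
proof -
  note ind = spanning_four_independent[OF assms]
  have "\<exists>n. \<forall>b. mink n (v b) = (if a = b then 1 else 0)" for a
  proof -
    obtain f :: "real^4 \<Rightarrow> real" where f: "linear f" "\<And>x. x \<in> range v \<Longrightarrow> f x = (if x = v a then 1 else 0)"
      using linear_independent_extend[OF ind(2), of "\<lambda>x. if x = v a then 1 else 0"] by blast
    have "mink (time_flip (adjoint f 1)) x = f x" for x
      using adjoint_works[OF f(1), of x 1] by (simp add: mink_time_flip inner_commute)
    then show ?thesis
      using f(2) inj_eq[OF ind(1)] by (intro exI[of _ "time_flip (adjoint f 1)"]) auto
  qed
  then obtain \<nu> where \<nu>: "\<And>a b. mink (\<nu> a) (v b) = (if a = b then 1 else 0)"
    by metis
  have "y = (\<Sum>a\<in>UNIV. mink (\<nu> a) y *\<^sub>R v a)" for y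
  proof (rule linear_eq_on_span[of "\<lambda>y. y" "\<lambda>y. \<Sum>a\<in>UNIV. mink (\<nu> a) y *\<^sub>R v a" "range v"])
    show "linear (\<lambda>y. \<Sum>a\<in>UNIV. mink (\<nu> a) y *\<^sub>R v a)"
      by (rule linearI) (simp_all add: mink_linear algebra_simps sum.distrib scaleR_sum_right)
    show "x = (\<Sum>a\<in>UNIV. mink (\<nu> a) x *\<^sub>R v a)" if "x \<in> range v" for x
      using that by (auto simp: \<nu> if_distrib[of "\<lambda>c. c *\<^sub>R _"] cong: if_cong)
  qed (use assms in \<open>auto simp: linear_iff\<close>)
  then show ?thesis
    using that \<nu> by blast
qed

section \<open>Future directed causal vectors\<close>

definition future :: "real^4 \<Rightarrow> bool" where
  "future x \<longleftrightarrow> mink x x \<le> 0 \<and> x $ 0 > 0"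

lemma future_hyp3: "x \<in> hyp3 \<Longrightarrow> future x"
  and future_light_cone: "x \<in> light_cone \<Longrightarrow> future x"
  by (auto simp: hyp3_def light_cone_def future_def)

text \<open>By Lagrange's identity.\<close>

lemma spatial_cauchy:
  fixes a b c x y z :: real
  shows "(a * x + b * y + c * z)\<^sup>2 \<le> (a\<^sup>2 + b\<^sup>2 + c\<^sup>2) * (x\<^sup>2 + y\<^sup>2 + z\<^sup>2)"
proof -
  have "(a\<^sup>2 + b\<^sup>2 + c\<^sup>2) * (x\<^sup>2 + y\<^sup>2 + z\<^sup>2) - (a * x + b * y + c * z)\<^sup>2 =
      (a * y - b * x)\<^sup>2 + (a * z - c * x)\<^sup>2 + (b * z - c * y)\<^sup>2"
    by (simp add: power2_eq_square algebra_simps)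
  then show ?thesis
    by (smt (verit) zero_le_power2)
qed

lemma mink_self: "mink x x = - (x $ 0)\<^sup>2 + ((x $ 1)\<^sup>2 + (x $ 2)\<^sup>2 + (x $ 3)\<^sup>2)"
  by (simp add: mink_def power2_eq_square)

lemma mink_future_le:
  assumes "future x" "future y"
  shows "mink x y \<le> 0"
    and "mink x x < 0 \<Longrightarrow> mink x y < 0"
proof -
  define s where "s = x $ 1 * y $ 1 + x $ 2 * y $ 2 + x $ 3 * y $ 3"
  define a where "a = (x $ 1)\<^sup>2 + (x $ 2)\<^sup>2 + (x $ 3)\<^sup>2"
  define b where "b = (y $ 1)\<^sup>2 + (y $ 2)\<^sup>2 + (y $ 3)\<^sup>2"
  have cs: "s\<^sup>2 \<le> a * b"
    unfolding s_def a_def b_def by (rule spatial_cauchy)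
  have pos: "x $ 0 > 0" "y $ 0 > 0" "0 \<le> a" "0 \<le> b"
    and ab: "a \<le> (x $ 0)\<^sup>2" "b \<le> (y $ 0)\<^sup>2"
    using assms by (auto simp: future_def mink_self a_def b_def)
  have m: "mink x y = s - x $ 0 * y $ 0"
    by (simp add: mink_def s_def)
  have "s\<^sup>2 \<le> (x $ 0 * y $ 0)\<^sup>2"
    using cs mult_mono[OF ab] pos by (simp add: power_mult_distrib)
  then have "s \<le> x $ 0 * y $ 0"
    by (rule power2_le_imp_le) (use pos in simp)
  then show "mink x y \<le> 0"
    by (simp add: m)
  assume "mink x x < 0"
  then have "a < (x $ 0)\<^sup>2"
    by (simp add: mink_self a_def)
  moreover have "0 < (y $ 0)\<^sup>2"
    using pos by simp
  ultimately have "a * b < (x $ 0)\<^sup>2 * (y $ 0)\<^sup>2"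
    using ab(2) pos(3) by (intro order.strict_trans1[OF mult_left_mono mult_strict_right_mono]) auto
  then have "s\<^sup>2 < (x $ 0 * y $ 0)\<^sup>2"
    using cs by (simp add: power_mult_distrib)
  then have "s < x $ 0 * y $ 0"
    by (rule power2_less_imp_less) (use pos in simp)
  then show "mink x y < 0"
    by (simp add: m)
qed

text \<open>The orthogonal complement of a timelike vector is positive definite. This is how all
  spacelike normals below are recognized.\<close>

lemma orthogonal_timelike_imp_spacelike:
  assumes "mink x x < 0" "mink x y = 0" "y \<noteq> 0"
  shows "mink y y > 0"
proof -
  define s where "s = x $ 1 * y $ 1 + x $ 2 * y $ 2 + x $ 3 * y $ 3"
  define a where "a = (x $ 1)\<^sup>2 + (x $ 2)\<^sup>2 + (x $ 3)\<^sup>2"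
  define b where "b = (y $ 1)\<^sup>2 + (y $ 2)\<^sup>2 + (y $ 3)\<^sup>2"
  have cs: "s\<^sup>2 \<le> a * b"
    unfolding s_def a_def b_def by (rule spatial_cauchy)
  have a: "a < (x $ 0)\<^sup>2" "0 \<le> a" "0 \<le> b"
    using assms(1) by (simp_all add: mink_self a_def b_def)
  have s: "s = x $ 0 * y $ 0"
    using assms(2) by (simp add: mink_def s_def)
  have "b > 0"
  proof (rule ccontr)
    assume "\<not> b > 0"
    then have b: "b = 0"
      using a by simp
    then have "y $ 1 = 0 \<and> y $ 2 = 0 \<and> y $ 3 = 0"
      unfolding b_def using zero_le_power2[of "y $ 1"] zero_le_power2[of "y $ 2"] zero_le_power2[of "y $ 3"]
      by (simp add: add_nonneg_eq_0_iff)
    moreover have "y $ 0 = 0"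
    proof -
      have "(x $ 0 * y $ 0)\<^sup>2 \<le> 0"
        using cs s b by simp
      then have "x $ 0 * y $ 0 = 0"
        by simp
      moreover have "x $ 0 \<noteq> 0"
        using a by auto
      ultimately show ?thesis
        by simp
    qed
    ultimately show False
      using assms(3) by (simp add: vec_eq_iff_four)
  qed
  then have "(x $ 0)\<^sup>2 * (y $ 0)\<^sup>2 < (x $ 0)\<^sup>2 * b"
    using cs mult_strict_right_mono[OF a(1) \<open>b > 0\<close>] unfolding s power_mult_distrib by linarith
  then have "(y $ 0)\<^sup>2 < b"
    by (simp add: mult_less_cancel_left split: if_splits)
  then show ?thesis
    by (simp add: mink_self b_def)
qed

text \<open>The position of a causal vector relative to a single point of hyperbolic space decides
  its time direction.\<close>

lemma causal_imp_future:
  assumes "x \<in> hyp3" "mink x y \<le> 0" "mink y y \<le> 0" "y \<noteq> 0"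
  shows "future y" "mink x y < 0"
proof -
  have x: "mink x x < 0" "future x"
    using assms(1) by (auto simp: hyp3_def future_def)
  show lt: "mink x y < 0"
    using orthogonal_timelike_imp_spacelike[OF x(1) _ assms(4)] assms by fastforce
  show "future y"
  proof (rule ccontr)
    assume "\<not> future y"
    then have "y $ 0 \<le> 0"
      using assms by (auto simp: future_def)
    moreover have "y $ 0 \<noteq> 0"
    proof
      assume "y $ 0 = 0"
      then have "mink (axis 0 1) y = 0"
        by (simp add: mink_def axis_def)
      moreover have "mink (axis 0 1) (axis 0 1) < (0::real)"
        by (simp add: mink_def axis_def)
      ultimately show False
        using orthogonal_timelike_imp_spacelike[of "axis 0 1" y] assms by auto
    qed
    ultimately have "future (- y)"
      using assms by (auto simp: future_def mink_linear)
    then show False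
      using mink_future_le(1)[OF x(2), of "- y"] lt by (simp add: mink_linear)
  qed
qed

lemma future_add:
  assumes "future x" "future y"
  shows "future (x + y)"
  using mink_future_le(1)[OF assms] assms
  by (auto simp: future_def mink_linear mink_commute[of y x])

lemma lightlike_orthogonal_imp_parallel:
  assumes "x \<in> light_cone" "y \<in> light_cone" "mink x y = 0"
  shows "y \<in> span {x}"
proof -
  have p: "x $ 0 > 0" "y $ 0 > 0" "mink x x = 0" "mink y y = 0"
    using assms by (auto simp: light_cone_def)
  define z where "z = y - (y $ 0 / x $ 0) *\<^sub>R x"
  have zz: "mink z z = 0"
    using assms(3) p by (simp add: z_def mink_linear mink_commute[of y x])
  have z0: "mink (axis 0 1) z = 0"
    using p by (simp add: z_def mink_def axis_def)
  have "mink (axis 0 1) (axis 0 1) < (0::real)"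
    by (simp add: mink_def axis_def)
  then have "z = 0"
    using orthogonal_timelike_imp_spacelike[of "axis 0 1" z] z0 zz by auto
  then have "y = (y $ 0 / x $ 0) *\<^sub>R x"
    by (simp add: z_def)
  then show ?thesis
    by (metis span_base span_mul insertI1)
qed

section \<open>Isometries\<close>

lemma hyp_isometry_mink: "hyp_isometry A \<Longrightarrow> mink (A *v x) (A *v y) = mink x y"
  by (simp add: hyp_isometry_def)

lemma hyp_isometry_hyp3: "hyp_isometry A \<Longrightarrow> x \<in> hyp3 \<Longrightarrow> A *v x \<in> hyp3"
  by (auto simp: hyp_isometry_def)

lemma hyp_isometry_inverse:
  assumes "hyp_isometry A"
  obtains B where "hyp_isometry B" "A ** B = mat 1" "B ** A = mat 1"
proof -
  have "x = 0" if "A *v x = 0" for x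
    by (rule mink_nondegenerate) (metis that hyp_isometry_mink[OF assms] mink_zero_left)
  then have "inj ((*v) A)"
    by (simp add: linear_injective_0 matrix_vector_mul_linear)
  then obtain B where B: "B ** A = mat 1"
    using matrix_left_invertible_injective by blast
  then have AB: "A ** B = mat 1"
    using matrix_left_right_inverse by blast
  have B2: "B *v (A *v x) = x" "A *v (B *v x) = x" for x
    using B AB by (simp_all add: matrix_vector_mul_assoc)
  have "(*v) B ` (*v) A ` hyp3 = hyp3"
    by (simp add: image_image B2)
  then have "(*v) B ` hyp3 = hyp3"
    using assms by (simp add: hyp_isometry_def)
  moreover have "mink (B *v x) (B *v y) = mink x y" for x y
    using hyp_isometry_mink[OF assms, of "B *v x" "B *v y"] by (simp add: B2)
  ultimately have "hyp_isometry B"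
    by (simp add: hyp_isometry_def)
  then show ?thesis
    using that AB B by blast
qed

lemma base_point_hyp3: "axis 0 1 \<in> hyp3"
  by (simp add: hyp3_def mink_def axis_def)

lemma hyp_isometry_light_cone:
  assumes "hyp_isometry A" "u \<in> light_cone"
  shows "A *v u \<in> light_cone"
proof -
  let ?x = "axis 0 1 :: real^4"
  have "mink ?x u < 0"
    using assms(2) by (simp add: mink_def axis_def light_cone_def)
  then have "mink (A *v ?x) (A *v u) < 0" "mink (A *v u) (A *v u) = 0"
    using assms by (simp_all add: hyp_isometry_mink light_cone_def)
  moreover from this have "A *v u \<noteq> 0"
    by (auto simp: mink_linear)
  ultimately have "future (A *v u)"
    by (intro causal_imp_future(1)[of "A *v ?x"] hyp_isometry_hyp3 assms base_point_hyp3) auto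
  then show ?thesis
    using \<open>mink (A *v u) (A *v u) = 0\<close> by (simp add: future_def light_cone_def)
qed

lemma timelike_normalize:
  assumes "future y" "mink y y < 0"
  shows "(1 / sqrt (- mink y y)) *\<^sub>R y \<in> hyp3"
  using assms by (simp add: hyp3_def future_def mink_linear field_simps)

section \<open>The tilt inequality\<close>

text \<open>A vector in the cone over \<open>x\<close> and \<open>y\<close> that depends on the
  pair symmetrically and through the Gram matrix only. So every isometry that preserves the pair
  fixes it. When \<open>x\<close> and \<open>y\<close> are lifted vertices it spans a point of the
  edge between them, or its ideal point if the edge has length 0.\<close>

definition edge_vector :: "real^4 \<Rightarrow> real^4 \<Rightarrow> real^4" where
  "edge_vector x y = (mink y y - mink x y) *\<^sub>R x + (mink x x - mink x y) *\<^sub>R y"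

lemma edge_vector_commute: "edge_vector x y = edge_vector y x"
  by (simp add: edge_vector_def mink_commute[of y x])

lemma edge_vector_isometry:
  assumes "\<And>x y. mink (G *v x) (G *v y) = mink x y"
  shows "G *v edge_vector x y = edge_vector (G *v x) (G *v y)"
  by (simp add: edge_vector_def assms matrix_vector_right_distrib matrix_vector_mult_scaleR)

text \<open>The products of two spacelike unit vectors dual to disjoint planes are at most
  \<open>-1\<close>, with equality for asymptotic planes. The edge vector is then lightlike, and
  it is timelike in all other cases.\<close>

lemma edge_vector_causal:
  assumes "mink x x = 0 \<or> mink x x = 1" "mink y y = 0 \<or> mink y y = 1" "mink x y < 0"
    and "mink x x = 1 \<Longrightarrow> mink y y = 1 \<Longrightarrow> mink x y \<le> -1"
  shows "mink (edge_vector x y) (edge_vector x y) \<le> 0"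
    and "mink (edge_vector x y) (edge_vector x y) = 0 \<Longrightarrow>
      mink x x = 1 \<and> mink y y = 1 \<and> mink x y = -1"
proof -
  define m where "m = mink x y"
  have m: "m < 0" "mink y x = m" "mink x y = m"
    using assms(3) by (simp_all add: m_def mink_commute)
  have *: "mink (edge_vector x y) (edge_vector x y) =
    (mink y y - m)\<^sup>2 * mink x x + (mink x x - m)\<^sup>2 * mink y y + 2 * m * (mink y y - m) * (mink x x - m)"
    by (simp add: edge_vector_def mink_linear m power2_eq_square algebra_simps)
  consider "mink x x = 0" "mink y y = 0" | "mink x x = 1" "mink y y = 0"
    | "mink x x = 0" "mink y y = 1" | "mink x x = 1" "mink y y = 1"
    using assms(1,2) by blast
  then have "mink (edge_vector x y) (edge_vector x y) \<le> 0 \<and>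
    (mink (edge_vector x y) (edge_vector x y) = 0 \<longrightarrow> mink x x = 1 \<and> mink y y = 1 \<and> m = -1)"
  proof cases
    case 1
    have "mink (edge_vector x y) (edge_vector x y) = 2 * m ^ 3"
      unfolding * 1 by (simp add: power2_eq_square power3_eq_cube)
    then show ?thesis
      using m(1) by (simp add: power_less_zero_eq less_imp_le)
  next
    case 2
    have "mink (edge_vector x y) (edge_vector x y) = 2 * m ^ 3 - m\<^sup>2"
      unfolding * 2 by (simp add: power2_eq_square power3_eq_cube algebra_simps)
    moreover have "m ^ 3 < 0" "m\<^sup>2 > 0"
      using m(1) by (simp_all add: power_less_zero_eq)
    ultimately show ?thesis
      by linarith
  next
    case 3
    have "mink (edge_vector x y) (edge_vector x y) = 2 * m ^ 3 - m\<^sup>2"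
      unfolding * 3 by (simp add: power2_eq_square power3_eq_cube algebra_simps)
    moreover have "m ^ 3 < 0" "m\<^sup>2 > 0"
      using m(1) by (simp_all add: power_less_zero_eq)
    ultimately show ?thesis
      by linarith
  next
    case 4
    then have "m \<le> -1"
      using assms(4) m by simp
    have e: "mink (edge_vector x y) (edge_vector x y) = 2 * ((1 - m)\<^sup>2 * (1 + m))"
      unfolding * 4 by (simp add: power2_eq_square algebra_simps)
    have "(1 - m)\<^sup>2 * (1 + m) \<le> 0"
      using \<open>m \<le> -1\<close> by (intro mult_nonneg_nonpos) auto
    moreover have "(1 - m)\<^sup>2 * (1 + m) = 0 \<longrightarrow> m = -1"
      using m by auto
    ultimately show ?thesis
      using 4 e by (simp add: mult.commute)
  qed
  then show "mink (edge_vector x y) (edge_vector x y) \<le> 0"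
    and "mink (edge_vector x y) (edge_vector x y) = 0 \<Longrightarrow>
      mink x x = 1 \<and> mink y y = 1 \<and> mink x y = -1"
    using m by simp_all
qed

text \<open>The Gram relations of the vertices of a lifted tetrahedron: ideal vertices are
  lightlike, the others are unit normals of truncation planes. A product at most \<open>-1\<close>
  says that two of these planes are disjoint or asymptotic.\<close>

definition vertex_family :: "(4 \<Rightarrow> real^4) \<Rightarrow> bool" where
  "vertex_family v \<longleftrightarrow> span (range v) = UNIV \<and>
     (\<forall>a. mink (v a) (v a) = 0 \<or> mink (v a) (v a) = 1) \<and>
     (\<forall>a b. a \<noteq> b \<longrightarrow> mink (v a) (v b) < 0) \<and>
     (\<forall>a b. a \<noteq> b \<longrightarrow> mink (v a) (v a) = 1 \<longrightarrow> mink (v b) (v b) = 1 \<longrightarrow> mink (v a) (v b) \<le> -1)"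

lemma vertex_family_edge:
  assumes "vertex_family v" "a \<noteq> b"
  shows "mink (edge_vector (v a) (v b)) (edge_vector (v a) (v b)) \<le> 0"
    and "mink (edge_vector (v a) (v b)) (edge_vector (v a) (v b)) = 0 \<Longrightarrow>
      mink (v a) (v a) = 1 \<and> mink (v b) (v b) = 1 \<and> mink (v a) (v b) = -1"
  using edge_vector_causal[of "v a" "v b"] assms unfolding vertex_family_def by blast+

text \<open>The edge vector is causal and has a negative product with the third vertex. Hence a
  small multiple of that vertex makes it timelike, also when the edge has length 0.\<close>

lemma vertex_family_face_timelike:
  assumes v: "vertex_family v" and "distinct [a, b, c]"
  obtains y where "y \<in> span {v a, v b, v c}" "mink y y < 0"
proof -
  let ?e = "edge_vector (v a) (v b)"
  define t where "t = - mink ?e (v c)"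
  have n: "mink (v a) (v a) \<ge> 0" "mink (v b) (v b) \<ge> 0" "mink (v c) (v c) \<le> 1"
      "mink (v a) (v b) < 0" "mink (v a) (v c) < 0" "mink (v b) (v c) < 0"
    using assms unfolding vertex_family_def by (auto dest: spec[of _ a] spec[of _ b] spec[of _ c])
  have "mink ?e (v c) = (mink (v b) (v b) - mink (v a) (v b)) * mink (v a) (v c)
      + (mink (v a) (v a) - mink (v a) (v b)) * mink (v b) (v c)"
    by (simp add: edge_vector_def mink_linear)
  also have "\<dots> < 0"
    using n by (intro add_neg_neg mult_pos_neg) auto
  finally have "t > 0"
    by (simp add: t_def)
  have "mink (?e + t *\<^sub>R v c) (?e + t *\<^sub>R v c) = mink ?e ?e + t\<^sup>2 * (mink (v c) (v c) - 2)"
    using mink_commute[of "v c" ?e] by (simp add: mink_linear t_def power2_eq_square algebra_simps)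
  also have "\<dots> < 0"
    using vertex_family_edge(1)[OF v, of a b] assms(2) n \<open>t > 0\<close>
    by (intro add_nonpos_neg mult_pos_neg) auto
  finally show ?thesis
    using that[of "?e + t *\<^sub>R v c"]
    by (simp add: edge_vector_def span_add span_mul span_base)
qed

lemma mink_dual_expansion:
  assumes "span (range v) = UNIV" and \<nu>: "\<And>a b. mink (\<nu> a) (v b) = (if a = b then 1 else (0::real))"
  shows "y = (\<Sum>a\<in>UNIV. mink y (v a) *\<^sub>R \<nu> (a :: 4))"
proof -
  have "y - (\<Sum>a\<in>UNIV. mink y (v a) *\<^sub>R \<nu> a) = 0"
  proof (rule mink_eq_zero_if_spanning[OF assms(1)])
    show "mink (y - (\<Sum>a\<in>UNIV. mink y (v a) *\<^sub>R \<nu> a)) x = 0" if "x \<in> range v" for x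
      using that by (auto simp: mink_linear mink_sum_left \<nu> if_distrib[of "\<lambda>c. _ * c"] cong: if_cong)
  qed
  then show ?thesis
    by simp
qed

lemma four_indices:
  assumes "distinct [i, j, k, l :: 4]"
  shows "UNIV = {i, j, k, l}"
proof -
  have "card {i, j, k, l} = CARD(4)"
    using assms by simp
  then show ?thesis
    by (metis card_subset_eq finite subset_UNIV)
qed

lemma sum_four_indices:
  assumes "distinct [i, j, k, l :: 4]"
  shows "sum f UNIV = f i + f j + f k + f l"
proof -
  have "sum f UNIV = sum f {i, j, k, l}"
    by (simp only: four_indices[OF assms])
  also have "\<dots> = f i + f j + f k + f l"
    using assms by (simp add: add_ac)
  finally show ?thesis .
qed

text \<open>The sum of the coefficients of the projection of \<open>w\<close> to the span of
  \<open>x\<close> and \<open>y\<close> compares \<open>w\<close> with the affine line through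
  \<open>x\<close> and \<open>y\<close>. It is large when the products of \<open>w\<close> with
  \<open>x\<close> and \<open>y\<close> are large in absolute value, and it suffices that one of
  them equals the product of \<open>x\<close> and \<open>y\<close>. The hypothesis on the edge
  vector makes the Gram determinant nonzero.\<close>

lemma projection_to_edge:
  assumes x: "mink x x = 0 \<or> mink x x = 1" and y: "mink y y = 0 \<or> mink y y = 1"
    and m: "mink x y < 0" "mink w x < 0" "mink w y < 0"
    and D: "mink (edge_vector x y) (edge_vector x y) \<noteq> 0"
    and le: "mink x x = 1 \<Longrightarrow> mink y y = 1 \<Longrightarrow> mink x y \<le> -1"
    and eq: "mink w x = mink x y \<or> mink w y = mink x y"
  obtains \<alpha> \<beta> where "mink (w - \<alpha> *\<^sub>R x - \<beta> *\<^sub>R y) x = 0" "mink (w - \<alpha> *\<^sub>R x - \<beta> *\<^sub>R y) y = 0" "\<alpha> + \<beta> > 1"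
proof -
  define h g g' p q where "h = - mink x y" and "g = mink x x" and "g' = mink y y"
    and "p = - mink w x" and "q = - mink w y"
  define D where "D = h\<^sup>2 - g * g'"
  have g: "g = 0 \<or> g = 1" "g' = 0 \<or> g' = 1" and pos: "h > 0" "p > 0" "q > 0"
    using assms by (auto simp: h_def g_def g'_def p_def q_def)
  have "D > 0"
  proof (cases "g = 1 \<and> g' = 1")
    case True
    have "mink x y \<noteq> -1"
    proof
      assume "mink x y = -1"
      then have "mink (edge_vector x y) (edge_vector x y) = 0"
        using True by (simp add: edge_vector_def mink_linear mink_commute[of y x] g_def g'_def)
      then show False
        using D by simp
    qed
    then have "h > 1"
      using le True by (simp add: h_def g_def g'_def)
    then show ?thesis
      using True by (simp add: D_def)
  qed (use g pos in \<open>auto simp: D_def\<close>)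
  define \<alpha> \<beta> where "\<alpha> = (p * g' + q * h) / D" and "\<beta> = (q * g + p * h) / D"
  have "mink (w - \<alpha> *\<^sub>R x - \<beta> *\<^sub>R y) x = - p - \<alpha> * g + \<beta> * h"
    by (simp add: mink_linear p_def g_def h_def mink_commute[of y x])
  also have "\<dots> = (- p * D - (p * g' + q * h) * g + (q * g + p * h) * h) / D"
    using \<open>D > 0\<close> by (simp add: \<alpha>_def \<beta>_def field_simps)
  also have "- p * D - (p * g' + q * h) * g + (q * g + p * h) * h = 0"
    by (simp add: D_def power2_eq_square algebra_simps)
  finally have 1: "mink (w - \<alpha> *\<^sub>R x - \<beta> *\<^sub>R y) x = 0"
    by simp
  have "mink (w - \<alpha> *\<^sub>R x - \<beta> *\<^sub>R y) y = - q + \<alpha> * h - \<beta> * g'"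
    by (simp add: mink_linear q_def g'_def h_def)
  also have "\<dots> = (- q * D + (p * g' + q * h) * h - (q * g + p * h) * g') / D"
    using \<open>D > 0\<close> by (simp add: \<alpha>_def \<beta>_def field_simps)
  also have "- q * D + (p * g' + q * h) * h - (q * g + p * h) * g' = 0"
    by (simp add: D_def power2_eq_square algebra_simps)
  finally have 2: "mink (w - \<alpha> *\<^sub>R x - \<beta> *\<^sub>R y) y = 0"
    by simp
  have s: "\<alpha> + \<beta> = (p * (g' + h) + q * (g + h)) / D"
    by (simp add: \<alpha>_def \<beta>_def add_divide_distrib[symmetric] algebra_simps)
  have "p = h \<or> q = h"
    using eq by (auto simp: p_def q_def h_def)
  moreover have "0 \<le> h * g" "0 \<le> h * g'" "0 \<le> g * g'" "0 \<le> q * g" "0 \<le> p * g'" "0 < p * h" "0 < q * h"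
    using g pos by auto
  ultimately have "p * (g' + h) + q * (g + h) > D"
    by (auto simp: D_def power2_eq_square algebra_simps)
  then have "\<alpha> + \<beta> > 1"
    using \<open>D > 0\<close> unfolding s by simp
  then show ?thesis
    using that 1 2 by blast
qed

text \<open>Here \<open>G\<close> is the gluing of the face opposite to \<open>v j\<close> to the
  face opposite to \<open>v i\<close>. Write \<open>\<mu>\<close> for the vector whose product
  with all four vertices is 1. As \<open>G \<mu> - \<mu>\<close> is orthogonal to the common face,
  it is a multiple \<open>c \<nu> i\<close>, and the claim is \<open>c > 0\<close>. Since
  \<open>G\<close> maps \<open>r \<nu> j\<close> to \<open>- \<nu> i\<close>, the number
  \<open>c\<close> has the sign of \<open>- mink \<mu> (\<nu> i + r \<nu> j)\<close>. The two
  normals in this expression have equal norms and are orthogonal to the edge \<open>v k\<close>,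
  \<open>v l\<close>. So their sum bisects the dihedral angle and is a positive combination of the
  components \<open>ui\<close>, \<open>uj\<close> of \<open>v i\<close>, \<open>v j\<close>
  orthogonal to the edge, whose products with \<open>\<mu>\<close> are negative by
  \<open>projection_to_edge\<close>. An edge of length 0 is treated separately.\<close>

lemma tilt_inequality:
  fixes G :: "real^4^4"
  assumes v: "vertex_family v" and ij: "distinct [i, j, k, l]"
    and \<nu>: "\<And>a b. mink (\<nu> a) (v b) = (if a = b then 1 else 0)"
    and G: "\<And>x y. mink (G *v x) (G *v y) = mink x y"
    and im: "(*v) G ` {v i, v k, v l} = {v j, v k, v l}"
    and opp: "mink (\<nu> i) (G *v v j) < 0"
    and nofix: "\<And>y. mink y y < 0 \<Longrightarrow> G *v y \<noteq> y"
  shows "(\<Sum>a\<in>UNIV. mink (\<nu> a) (G *v v j)) > 1"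
proof -
  have sp: "span (range v) = UNIV"
    and nrm: "\<And>a. mink (v a) (v a) = 0 \<or> mink (v a) (v a) = 1"
    and neg: "\<And>a b. a \<noteq> b \<Longrightarrow> mink (v a) (v b) < 0"
    and le: "\<And>a b. a \<noteq> b \<Longrightarrow> mink (v a) (v a) = 1 \<Longrightarrow> mink (v b) (v b) = 1 \<Longrightarrow> mink (v a) (v b) \<le> -1"
    using v by (simp_all add: vertex_family_def)
  have v\<nu>: "mink (v b) (\<nu> a) = (if a = b then 1 else 0)" for a b
    using \<nu>[of a b] by (simp add: mink_commute)
  note four = sum_four_indices[OF ij]
  have ne: "i \<noteq> j" "i \<noteq> k" "i \<noteq> l" "j \<noteq> k" "j \<noteq> l" "k \<noteq> l" "j \<noteq> i" "k \<noteq> i" "l \<noteq> i" "k \<noteq> j" "l \<noteq> j" "l \<noteq> k"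
    using ij by auto
  have exp\<nu>: "y = mink y (v i) *\<^sub>R \<nu> i + mink y (v j) *\<^sub>R \<nu> j + mink y (v k) *\<^sub>R \<nu> k + mink y (v l) *\<^sub>R \<nu> l" for y
    using mink_dual_expansion[OF sp \<nu>, of y] unfolding four .
  define r where "r = - mink (\<nu> i) (G *v v j)"
  define \<mu> where "\<mu> = (\<Sum>a\<in>UNIV. \<nu> a)"
  have "r > 0"
    using opp by (simp add: r_def)
  have \<mu>: "mink \<mu> (v a) = 1" "mink (v a) \<mu> = 1" for a
    unfolding mink_commute[of "v a"] by (simp_all add: \<mu>_def mink_sum_left \<nu>)
  define A B C where "A = mink (\<nu> i) (\<nu> i)" and "B = mink (\<nu> j) (\<nu> j)" and "C = mink (\<nu> i) (\<nu> j)"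
  have faceG: "\<exists>a \<in> {i, k, l}. x = G *v v a" if "x \<in> {v j, v k, v l}" for x
    using that im[symmetric] by auto
  have Gface: "mink (G *v y) x = 0" if "x \<in> {v j, v k, v l}" "\<And>a. a \<in> {i, k, l} \<Longrightarrow> mink y (v a) = 0" for x y
    using faceG[OF that(1)] that(2) by (auto simp: G)
  have A: "A > 0"
  proof -
    obtain y where y: "y \<in> span {v j, v k, v l}" "mink y y < 0"
      using vertex_family_face_timelike[OF v, of j k l] ij by auto
    have "mink (\<nu> i) y = 0"
      by (rule mink_zero_on_span[OF _ y(1)]) (use ne in \<open>auto simp: \<nu>\<close>)
    then show ?thesis
      unfolding A_def
      by (intro orthogonal_timelike_imp_spacelike[OF y(2)])
        (use \<nu>[of i i] in \<open>auto simp: mink_commute mink_zero_left\<close>)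
  qed
  have G\<nu>: "G *v \<nu> j = - (1 / r) *\<^sub>R \<nu> i"
  proof -
    define t where "t = mink (G *v \<nu> j) (v i)"
    have "mink (G *v \<nu> j) x = 0" if "x \<in> {v j, v k, v l}" for x
      by (rule Gface[OF that]) (use ne in \<open>auto simp: \<nu>\<close>)
    then have t: "G *v \<nu> j = t *\<^sub>R \<nu> i"
      using exp\<nu>[of "G *v \<nu> j"] by (simp add: t_def)
    have "1 = mink (G *v \<nu> j) (G *v v j)"
      by (simp add: G \<nu>)
    also have "\<dots> = - t * r"
      by (simp add: t mink_linear r_def)
    finally have "t = - (1 / r)"
      using \<open>r > 0\<close> by (simp add: field_simps)
    then show ?thesis
      using t by simp
  qed
  have B: "A = r\<^sup>2 * B"
    using G[of "\<nu> j" "\<nu> j"] \<open>r > 0\<close> unfolding G\<nu>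
    by (simp add: mink_linear A_def B_def power2_eq_square field_simps)
  \<comment> \<open>The affine functionals of the two tetrahedra agree on the common face.\<close>
  define c where "c = mink (G *v \<mu> - \<mu>) (v i)"
  have "mink (G *v \<mu> - \<mu>) x = 0" if x: "x \<in> {v j, v k, v l}" for x
  proof -
    obtain a where "x = G *v v a"
      using faceG[OF x] by blast
    then have "mink (G *v \<mu>) x = 1"
      by (simp only: G \<mu>)
    moreover have "mink \<mu> x = 1"
      using x \<mu>(1) by blast
    ultimately show ?thesis
      by (simp add: mink_linear)
  qed
  then have c: "G *v \<mu> - \<mu> = c *\<^sub>R \<nu> i"
    using exp\<nu>[of "G *v \<mu> - \<mu>"] by (simp add: c_def)
  have "mink (G *v \<mu>) (\<nu> i) = - r * mink (G *v \<mu>) (G *v \<nu> j)"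
    using \<open>r > 0\<close> by (simp add: G\<nu> mink_linear)
  then have "c * A = - (r * mink \<mu> (\<nu> j) + mink \<mu> (\<nu> i))"
    using arg_cong[OF c, of "\<lambda>x. mink x (\<nu> i)"] by (simp add: mink_linear G A_def)
  then have cA: "c * A = - mink \<mu> (\<nu> i + r *\<^sub>R \<nu> j)"
    by (simp add: mink_linear)
  have "mink (G *v \<mu>) (G *v v j) = mink \<mu> (G *v v j) - c * r"
    using arg_cong[OF c, of "\<lambda>x. mink x (G *v v j)"] by (simp add: mink_linear r_def)
  then have goal: "(\<Sum>a\<in>UNIV. mink (\<nu> a) (G *v v j)) = 1 + c * r"
    unfolding G \<mu> by (simp add: \<mu>_def mink_sum_left)
  have "mink \<mu> (\<nu> i + r *\<^sub>R \<nu> j) < 0"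
  proof (cases "mink (edge_vector (v k) (v l)) (edge_vector (v k) (v l)) = 0")
    case True
    then have kl: "mink (v k) (v k) = 1" "mink (v l) (v l) = 1" "mink (v k) (v l) = -1" "mink (v l) (v k) = -1"
      using vertex_family_edge(2)[OF v, of k l] ne by (auto simp: mink_commute)
    \<comment> \<open>An edge of length 0: \<open>q\<close> is lightlike and orthogonal to both
      normals, so that the plane orthogonal to the edge is degenerate.\<close>
    define q where "q = v k + v l"
    define x y where "x = mink q (v i)" and "y = mink q (v j)"
    have "x < 0" "y < 0"
      using neg ne by (auto simp: x_def y_def q_def mink_linear intro!: add_neg_neg)
    have q: "q = x *\<^sub>R \<nu> i + y *\<^sub>R \<nu> j"
    proof -
      have "mink q (v k) = 0" "mink q (v l) = 0"
        using kl by (simp_all add: q_def mink_linear)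
      then have "mink q (v i) *\<^sub>R \<nu> i + mink q (v j) *\<^sub>R \<nu> j + mink q (v k) *\<^sub>R \<nu> k
          + mink q (v l) *\<^sub>R \<nu> l = x *\<^sub>R \<nu> i + y *\<^sub>R \<nu> j"
        by (simp add: x_def y_def)
      then show ?thesis
        using exp\<nu>[of q] by (rule trans[rotated])
    qed
    have "mink q (\<nu> i) = 0" "mink q (\<nu> j) = 0"
      using ne by (simp_all add: q_def mink_linear v\<nu>)
    then have xy: "x * A + y * C = 0" "x * C + y * B = 0"
      unfolding q by (simp_all add: A_def B_def C_def mink_linear mink_commute[of "\<nu> j" "\<nu> i"])
    have "x\<^sup>2 * A = y\<^sup>2 * B"
    proof -
      have "x\<^sup>2 * A = x * (x * A + y * C) - y * (x * C + y * B) + y\<^sup>2 * B"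
        by (simp add: power2_eq_square algebra_simps)
      then show ?thesis
        using xy by simp
    qed
    then have "(x * r)\<^sup>2 * B = y\<^sup>2 * B"
      using B by (simp add: power_mult_distrib algebra_simps)
    moreover have "B \<noteq> 0"
      using A B by auto
    ultimately have "(r * x)\<^sup>2 = y\<^sup>2"
      by (simp add: mult.commute)
    moreover have "r * x < 0"
      using \<open>r > 0\<close> \<open>x < 0\<close> by (simp add: mult_pos_neg)
    ultimately have "y = r * x"
      using \<open>y < 0\<close> by (simp add: power2_eq_iff)
    then have "q = x *\<^sub>R (\<nu> i + r *\<^sub>R \<nu> j)"
      unfolding q by (simp add: algebra_simps)
    then have "mink \<mu> q = x * mink \<mu> (\<nu> i + r *\<^sub>R \<nu> j)"
      by (simp only: mink_linear)
    moreover have "mink \<mu> q = 2"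
      by (simp add: q_def mink_linear \<mu>)
    ultimately show ?thesis
      using \<open>x < 0\<close> zero_less_mult_iff[of x "mink \<mu> (\<nu> i + r *\<^sub>R \<nu> j)"] by simp
  next
    case False
    let ?e = "edge_vector (v k) (v l)"
    have e: "mink ?e ?e < 0"
      using vertex_family_edge(1)[OF v, of k l] False ne by auto
    then have "G *v ?e \<noteq> ?e"
      by (rule nofix)
    then have nkl: "\<not> (G *v v a = v k \<and> G *v v b = v l)" if "{a, b} = {k, l}" for a b
      using that edge_vector_isometry[of G, OF G, of "v k" "v l"] edge_vector_commute[of "v k" "v l"]
      by (auto simp: doubleton_eq_iff)
    have wi: "mink (v i) (v k) = mink (v k) (v l) \<or> mink (v i) (v l) = mink (v k) (v l)"
    proof -
      obtain a b where ab: "a \<in> {i, k, l}" "b \<in> {i, k, l}" "v k = G *v v a" "v l = G *v v b"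
        using faceG[of "v k"] faceG[of "v l"] by auto
      have "a \<noteq> b"
        using ab neg[of k l] nrm[of k] ne by auto
      moreover have "mink (v a) (v b) = mink (v k) (v l)"
        using ab by (simp add: G)
      moreover have "{a, b} \<noteq> {k, l}"
        using nkl[of a b] ab by auto
      ultimately show ?thesis
        using ab(1,2) by (auto simp: mink_commute)
    qed
    have wj: "mink (v j) (v k) = mink (v k) (v l) \<or> mink (v j) (v l) = mink (v k) (v l)"
    proof -
      have "G *v v k \<in> {v j, v k, v l}" "G *v v l \<in> {v j, v k, v l}"
        using im by auto
      then obtain a b where ab: "a \<in> {j, k, l}" "b \<in> {j, k, l}" "G *v v k = v a" "G *v v l = v b"
        by auto
      have m: "mink (v a) (v b) = mink (v k) (v l)"
        using G[of "v k" "v l"] ab(3,4) by simp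
      then have "a \<noteq> b"
        using neg[of k l] nrm[of a] ne by auto
      moreover have "{a, b} \<noteq> {k, l}"
        using nkl[of k l] nkl[of l k] ab by (auto simp: doubleton_eq_iff)
      ultimately show ?thesis
        using ab(1,2) m by (auto simp: mink_commute)
    qed
    obtain \<alpha> \<beta> where ui: "mink (v i - \<alpha> *\<^sub>R v k - \<beta> *\<^sub>R v l) (v k) = 0"
        "mink (v i - \<alpha> *\<^sub>R v k - \<beta> *\<^sub>R v l) (v l) = 0" "\<alpha> + \<beta> > 1"
      by (rule projection_to_edge[of "v k" "v l" "v i", OF nrm nrm neg neg neg False le wi]) (use ne in auto)
    obtain \<alpha>' \<beta>' where uj: "mink (v j - \<alpha>' *\<^sub>R v k - \<beta>' *\<^sub>R v l) (v k) = 0"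
        "mink (v j - \<alpha>' *\<^sub>R v k - \<beta>' *\<^sub>R v l) (v l) = 0" "\<alpha>' + \<beta>' > 1"
      by (rule projection_to_edge[of "v k" "v l" "v j", OF nrm nrm neg neg neg False le wj]) (use ne in auto)
    define ui where "ui = v i - \<alpha> *\<^sub>R v k - \<beta> *\<^sub>R v l"
    define uj where "uj = v j - \<alpha>' *\<^sub>R v k - \<beta>' *\<^sub>R v l"
    define N where "N = \<nu> i + r *\<^sub>R \<nu> j"
    define x where "x = A + r * C"
    have eorth: "mink ?e y = 0" if "mink y (v k) = 0" "mink y (v l) = 0" for y
      using that mink_commute[of y "v k"] mink_commute[of y "v l"] by (simp add: edge_vector_def mink_linear)
    have N: "mink N (v k) = 0" "mink N (v l) = 0" "mink N (v i) = 1"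
      using ne unfolding N_def mink_linear \<nu> by simp_all
    have "N \<noteq> 0"
      using N(3) mink_zero_left[of "v i"] by force
    then have "mink N N > 0"
      using orthogonal_timelike_imp_spacelike[OF e eorth[OF N(1) N(2)]] by blast
    moreover have "mink N N = 2 * x"
    proof -
      have "mink N N = A + 2 * (r * C) + r\<^sup>2 * B"
        unfolding N_def mink_linear A_def B_def C_def mink_commute[of "\<nu> j" "\<nu> i"]
        by (simp add: power2_eq_square algebra_simps)
      then show ?thesis
        using B unfolding x_def by argo
    qed
    ultimately have "x > 0"
      by simp
    \<comment> \<open>The coefficients are the products of \<open>N\<close> with \<open>\<nu>
      i\<close> and \<open>\<nu> j\<close>, to which \<open>ui\<close> and \<open>uj\<close> are
      dual. Then \<open>z\<close> is orthogonal to the edge, and expanding it in the dual basis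
      shows that it has norm 0.\<close>
    define z where "z = N - x *\<^sub>R ui - (x / r) *\<^sub>R uj"
    have z: "mink z (v k) = 0" "mink z (v l) = 0"
      using N ui uj by (simp_all add: z_def mink_linear ui_def uj_def)
    have "mink ui (\<nu> i) = 1" "mink uj (\<nu> i) = 0" "mink ui (\<nu> j) = 0" "mink uj (\<nu> j) = 1"
      using ne by (simp_all add: ui_def uj_def mink_linear v\<nu>)
    moreover have "mink N (\<nu> i) = x" "mink N (\<nu> j) = x / r"
    proof -
      show "mink N (\<nu> i) = x"
        using mink_commute[of "\<nu> j" "\<nu> i"] by (simp add: N_def x_def mink_linear A_def C_def)
      have "mink N (\<nu> j) = C + r * B"
        by (simp add: N_def mink_linear B_def C_def)
      then show "mink N (\<nu> j) = x / r"
        using \<open>r > 0\<close> unfolding x_def B by (simp add: power2_eq_square add_divide_distrib)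
    qed
    ultimately have z': "mink z (\<nu> i) = 0" "mink z (\<nu> j) = 0"
      by (simp_all add: z_def mink_linear)
    have "mink z z = mink z (mink z (v i) *\<^sub>R \<nu> i + mink z (v j) *\<^sub>R \<nu> j
        + mink z (v k) *\<^sub>R \<nu> k + mink z (v l) *\<^sub>R \<nu> l)"
      by (rule arg_cong[OF exp\<nu>])
    also have "\<dots> = 0"
      unfolding mink_linear z z' by simp
    finally have "mink z z = 0" .
    then have "z = 0"
      using orthogonal_timelike_imp_spacelike[OF e eorth[OF z]] by fastforce
    then have "mink \<mu> N = x * mink \<mu> ui + (x / r) * mink \<mu> uj"
    proof -
      from \<open>z = 0\<close> have "N = x *\<^sub>R ui + (x / r) *\<^sub>R uj"
        by (simp only: z_def diff_diff_eq right_minus_eq)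
      then show ?thesis
        by (simp only: mink_linear)
    qed
    also have "\<dots> = x * (1 - \<alpha> - \<beta>) + (x / r) * (1 - \<alpha>' - \<beta>')"
      by (simp add: ui_def uj_def mink_linear \<mu>)
    also have "\<dots> < 0"
      using \<open>x > 0\<close> \<open>r > 0\<close> ui(3) uj(3) by (intro add_neg_neg mult_pos_neg) auto
    finally show ?thesis
      by (simp add: N_def)
  qed
  then have "c > 0"
    using cA A by (metis neg_0_less_iff_less zero_less_mult_pos2)
  then show ?thesis
    using goal \<open>r > 0\<close> by simp
qed

section \<open>Strictly convex angles\<close>

lemma euclidean_dual_functional:
  fixes B :: "(real^4) set"
  assumes "independent B"
  obtains a where "\<And>x. x \<in> B \<Longrightarrow> a \<bullet> x = f x"
proof -
  obtain g :: "real^4 \<Rightarrow> real" where g: "linear g" "\<And>x. x \<in> B \<Longrightarrow> g x = f x"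
    using linear_independent_extend[OF assms, of f] by blast
  have "adjoint g 1 \<bullet> x = g x" for x
    using adjoint_works[OF g(1), of x 1] by (simp add: inner_commute)
  then show ?thesis
    using that g(2) by metis
qed

text \<open>The two open sets separate every larger subset of \<open>S\<close>.\<close>

lemma convex_is_component:
  fixes C B S :: "(real^4) set"
  assumes "C \<noteq> {}" "convex C" "open C" "open B" "C \<inter> B = {}" "C \<subseteq> S" "S \<subseteq> C \<union> B"
  shows "C \<in> components S"
  unfolding in_components_maximal
proof (intro conjI allI impI)
  fix D assume D: "D \<noteq> {} \<and> C \<subseteq> D \<and> D \<subseteq> S \<and> connected D"
  then have "B \<inter> D = {}"
    using connectedD[of D C B] assms by blast
  then show "D = C"
    using D assms by blast
qed (use assms convex_connected in auto)

text \<open>Let \<open>\<alpha>\<close> be the functional with value 1 on the first tetrahedron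
  and \<open>\<gamma>\<close> the one that vanishes on the common face and has value 1 at
  \<open>y\<close>. The relation says that \<open>\<gamma>\<close> is negative at
  \<open>z\<close>, and the inequality that \<open>\<alpha>\<close> exceeds 1 there. The
  functional \<open>\<alpha>'\<close> with value 1 on the second tetrahedron is then
  \<open>\<alpha> + t \<gamma>\<close> with positive \<open>t\<close>, and the two half-
  hyperplanes bound the set where \<open>\<alpha>\<close> and \<open>\<alpha>'\<close> both exceed
  1. It is convex and avoids the origin.\<close>

lemma strictly_convex_angle_of_relation:
  fixes k l x y z :: "real^4"
  assumes ind: "independent {k, l, x, y}" and dist: "distinct [k, l, x, y]"
    and rel: "z + r *\<^sub>R y = b1 *\<^sub>R k + b2 *\<^sub>R l + b3 *\<^sub>R x"
    and r: "r > 0" and gt: "b1 + b2 + b3 > 1 + r"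
  shows "strictly_convex_angle (convex hull {k, l, x, y}) (convex hull {k, l, x, z}) (convex hull {k, l, x})"
proof -
  obtain \<alpha> where \<alpha>: "\<And>u. u \<in> {k, l, x, y} \<Longrightarrow> \<alpha> \<bullet> u = 1"
    using euclidean_dual_functional[OF ind, of "\<lambda>_. 1"] by metis
  obtain \<gamma> where \<gamma>': "\<And>u. u \<in> {k, l, x, y} \<Longrightarrow> \<gamma> \<bullet> u = (if u = y then 1 else 0)"
    using euclidean_dual_functional[OF ind, of "\<lambda>u. if u = y then 1 else 0"] by metis
  have \<gamma>: "\<gamma> \<bullet> k = 0" "\<gamma> \<bullet> l = 0" "\<gamma> \<bullet> x = 0" "\<gamma> \<bullet> y = 1"
    using \<gamma>' dist by auto
  have z: "z = b1 *\<^sub>R k + b2 *\<^sub>R l + b3 *\<^sub>R x - r *\<^sub>R y"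
    using rel by (simp add: eq_diff_eq)
  have \<gamma>z: "\<gamma> \<bullet> z = - r" and \<alpha>z: "\<alpha> \<bullet> z = b1 + b2 + b3 - r"
    unfolding z by (simp_all add: inner_diff_right inner_add_right \<alpha> \<gamma>)
  define t where "t = (\<alpha> \<bullet> z - 1) / r"
  have "t > 0"
    using gt r by (simp add: t_def \<alpha>z)
  define \<alpha>' where "\<alpha>' = \<alpha> + t *\<^sub>R \<gamma>"
  have \<alpha>': "\<alpha>' \<bullet> u = \<alpha> \<bullet> u + t * (\<gamma> \<bullet> u)" for u
    by (simp add: \<alpha>'_def inner_add_left)
  have \<alpha>'z: "\<alpha>' \<bullet> z = 1"
    using r by (simp add: \<alpha>' \<gamma>z t_def)
  define H1 where "H1 = {u. \<alpha> \<bullet> u = 1 \<and> \<gamma> \<bullet> u \<ge> 0}"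
  define H2 where "H2 = {u. \<alpha>' \<bullet> u = 1 \<and> (- \<gamma>) \<bullet> u \<ge> 0}"
  define C where "C = {u. \<alpha> \<bullet> u > 1} \<inter> {u. \<alpha>' \<bullet> u > 1}"
  define B where "B = {u. \<alpha> \<bullet> u < 1} \<union> {u. \<alpha>' \<bullet> u < 1}"
  have nz: "\<gamma> \<noteq> 0"
    using \<gamma>(4) by auto
  have indep: "independent {a, c}" "a \<noteq> c" if "a \<bullet> k = 1" "c \<bullet> k = 0" "c \<noteq> 0" for a c
  proof -
    show "a \<noteq> c"
      using that by auto
    have "a \<notin> span {c}"
      using that by (auto simp: span_singleton)
    then show "independent {a, c}"
      using that by (simp add: independent_insert)
  qed
  have 1: "angle_half_hyperplane (convex hull {k, l, x, y}) (convex hull {k, l, x}) H1"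
    unfolding angle_half_hyperplane_def
  proof (intro conjI exI)
    have "convex H1"
      unfolding H1_def Collect_conj_eq by (intro convex_Int convex_hyperplane convex_halfspace_ge)
    then show "convex hull {k, l, x, y} \<subseteq> H1"
      by (rule hull_minimal[rotated]) (auto simp: H1_def \<alpha> \<gamma>)
    show "half_hyperplane H1 {u. \<alpha> \<bullet> u = 1 \<and> \<gamma> \<bullet> u = 0}"
      unfolding half_hyperplane_def H1_def using indep[of \<alpha> \<gamma>] \<alpha> \<gamma> nz by blast
    have "convex {u. \<alpha> \<bullet> u = 1 \<and> \<gamma> \<bullet> u = 0}"
      unfolding Collect_conj_eq by (intro convex_Int convex_hyperplane)
    then show "convex hull {k, l, x} \<subseteq> {u. \<alpha> \<bullet> u = 1 \<and> \<gamma> \<bullet> u = 0}"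
      by (rule hull_minimal[rotated]) (auto simp: \<alpha> \<gamma>)
  qed
  have 2: "angle_half_hyperplane (convex hull {k, l, x, z}) (convex hull {k, l, x}) H2"
    unfolding angle_half_hyperplane_def
  proof (intro conjI exI)
    have "convex H2"
      unfolding H2_def Collect_conj_eq by (intro convex_Int convex_hyperplane convex_halfspace_ge)
    then show "convex hull {k, l, x, z} \<subseteq> H2"
      by (rule hull_minimal[rotated]) (use r \<alpha>'z in \<open>auto simp: H2_def \<alpha>' \<alpha> \<gamma> \<gamma>z\<close>)
    show "half_hyperplane H2 {u. \<alpha>' \<bullet> u = 1 \<and> (- \<gamma>) \<bullet> u = 0}"
    proof -
      have "\<alpha>' \<bullet> k = 1" "(- \<gamma>) \<bullet> k = 0" "- \<gamma> \<noteq> 0"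
        using nz by (simp_all add: \<alpha>' \<alpha> \<gamma>)
      from indep[OF this] show ?thesis
        unfolding half_hyperplane_def H2_def by blast
    qed
    have "convex {u. \<alpha>' \<bullet> u = 1 \<and> (- \<gamma>) \<bullet> u = 0}"
      unfolding Collect_conj_eq by (intro convex_Int convex_hyperplane)
    then show "convex hull {k, l, x} \<subseteq> {u. \<alpha>' \<bullet> u = 1 \<and> (- \<gamma>) \<bullet> u = 0}"
      by (rule hull_minimal[rotated]) (auto simp: \<alpha>' \<alpha> \<gamma>)
  qed
  have C: "C \<in> components (- (H1 \<union> H2))"
  proof (rule convex_is_component[of _ B])
    have "2 *\<^sub>R k \<in> C"
      by (simp add: C_def \<alpha> \<gamma> \<alpha>')
    then show "C \<noteq> {}"
      by blast
    show "convex C"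
      unfolding C_def by (intro convex_Int convex_halfspace_gt)
    show "open C"
      unfolding C_def by (intro open_Int open_halfspace_gt)
    show "open B"
      unfolding B_def by (intro open_Un open_halfspace_lt)
    show "C \<inter> B = {}"
      by (auto simp: C_def B_def)
    show "C \<subseteq> - (H1 \<union> H2)"
      by (auto simp: C_def H1_def H2_def)
    show "- (H1 \<union> H2) \<subseteq> C \<union> B"
    proof
      fix u assume u: "u \<in> - (H1 \<union> H2)"
      show "u \<in> C \<union> B"
      proof (rule ccontr)
        assume n: "u \<notin> C \<union> B"
        then have ge: "\<alpha> \<bullet> u \<ge> 1" "\<alpha>' \<bullet> u \<ge> 1" "\<not> (\<alpha> \<bullet> u > 1 \<and> \<alpha>' \<bullet> u > 1)"
          by (auto simp: B_def C_def)
        show False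
        proof (cases "\<gamma> \<bullet> u \<ge> 0")
          case True
          then have "t * (\<gamma> \<bullet> u) \<ge> 0"
            using \<open>t > 0\<close> by simp
          then have "\<alpha> \<bullet> u = 1"
            using ge \<alpha>'[of u] by linarith
          then show False
            using u True by (simp add: H1_def)
        next
          case False
          then have "t * (\<gamma> \<bullet> u) < 0"
            using \<open>t > 0\<close> by (simp add: mult_pos_neg)
          then have "\<alpha>' \<bullet> u = 1"
            using ge \<alpha>'[of u] by linarith
          then show False
            using u False by (simp add: H2_def)
        qed
      qed
    qed
  qed
  have "\<not> hyperplane (H1 \<union> H2)"
  proof
    assume "hyperplane (H1 \<union> H2)"
    then obtain a b where ab: "a \<noteq> 0" "H1 \<union> H2 = {u. a \<bullet> u = b}"
      unfolding hyperplane_def by blast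
    have "{k, l, x, y} \<subseteq> H1"
      by (auto simp: H1_def \<alpha> \<gamma>)
    then have a: "a \<bullet> k = b" "a \<bullet> l = b" "a \<bullet> x = b" "a \<bullet> y = b"
      using ab(2) by auto
    have "z \<in> H2"
      using r by (simp add: H2_def \<alpha>'z \<gamma>z)
    then have "a \<bullet> z = b"
      using ab(2) by auto
    then have "(b1 + b2 + b3 - r) * b = b"
      unfolding z by (simp add: inner_diff_right inner_add_right a algebra_simps)
    then have "(b1 + b2 + b3 - r - 1) * b = 0"
      by (simp add: algebra_simps)
    then have "b = 0"
      using gt by simp
    then have "0 \<in> H1 \<union> H2"
      unfolding ab(2) by simp
    then show False
      by (simp add: H1_def H2_def)
  qed
  then show ?thesis
    unfolding strictly_convex_angle_def using 1 2 C
    by (intro exI[of _ H1] exI[of _ H2] conjI bexI[of _ C])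
      (auto simp: C_def intro!: convex_Int convex_halfspace_gt)
qed

section \<open>The projective model\<close>

lemma klein_scale: "c \<noteq> 0 \<Longrightarrow> klein (c *\<^sub>R x) = klein x"
  by (simp add: klein_def)

text \<open>A point of hyperbolic space is recovered from its projective image by normalization.
  This transfers continuity, connectedness and injectivity between the two models.\<close>

lemma klein_hyp3_inverse:
  assumes "x \<in> hyp3"
  shows "x = (1 / sqrt (- mink (klein x) (klein x))) *\<^sub>R klein x"
proof -
  have x: "mink x x = -1" "x $ 0 > 0"
    using assms by (auto simp: hyp3_def)
  have "mink (klein x) (klein x) = - (inverse (x $ 0))\<^sup>2"
    using x by (simp add: klein_def mink_linear power2_eq_square)
  then have "sqrt (- mink (klein x) (klein x)) = inverse (x $ 0)"
    using x by simp
  then show ?thesis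
    using x by (simp add: klein_def)
qed

lemma klein_inj_hyp3: "inj_on klein hyp3"
  by (rule inj_on_inverseI[of _ "\<lambda>y. (1 / sqrt (- mink y y)) *\<^sub>R y"]) (metis klein_hyp3_inverse)

lemma mink_klein_neg:
  assumes "x \<in> hyp3"
  shows "mink (klein x) (klein x) < 0"
  using assms by (simp add: klein_def mink_linear hyp3_def zero_less_mult_iff)

lemma klein_eq_iff_positive_multiple:
  assumes "x $ 0 > 0" "y $ 0 > 0"
  shows "klein x = klein y \<longleftrightarrow> (\<exists>c>0. x = c *\<^sub>R y)"
proof
  assume k: "klein x = klein y"
  have "x = (x $ 0) *\<^sub>R klein x"
    using assms by (simp add: klein_def)
  also have "\<dots> = (x $ 0 / y $ 0) *\<^sub>R y"
    unfolding k by (simp add: klein_def divide_inverse)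
  finally show "\<exists>c>0. x = c *\<^sub>R y"
    using assms by (intro exI[of _ "x $ 0 / y $ 0"]) auto
qed (use klein_scale in auto)

lemma continuous_on_hyp3_of_klein:
  assumes "continuous_on S (klein \<circ> e)" "e ` S \<subseteq> hyp3"
  shows "continuous_on S e"
proof -
  have "continuous_on S (\<lambda>x. (1 / sqrt (- mink ((klein \<circ> e) x) ((klein \<circ> e) x))) *\<^sub>R (klein \<circ> e) x)"
    by (intro continuous_intros assms(1)) (use assms(2) mink_klein_neg in force)
  then show ?thesis
    by (rule continuous_on_eq) (use assms(2) klein_hyp3_inverse in \<open>auto simp: image_subset_iff\<close>)
qed

text \<open>Conic combinations of vectors with positive time coordinate project to convex
  combinations.\<close>

lemma klein_conic_combination:
  assumes "finite T" "\<And>q. q \<in> T \<Longrightarrow> c q \<ge> 0" "\<And>q. q \<in> T \<Longrightarrow> klein (g q) \<in> K \<and> g q $ 0 > 0"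
    and "convex K" "(\<Sum>q\<in>T. c q *\<^sub>R g q) \<noteq> 0"
  shows "klein (\<Sum>q\<in>T. c q *\<^sub>R g q) \<in> K" "(\<Sum>q\<in>T. c q *\<^sub>R g q) $ 0 > 0"
proof -
  define y where "y = (\<Sum>q\<in>T. c q *\<^sub>R g q)"
  have y0: "y $ 0 = (\<Sum>q\<in>T. c q * g q $ 0)"
    by (simp add: y_def)
  obtain q where "q \<in> T" "c q \<noteq> 0"
    using assms(5) by (metis (no_types, lifting) scale_eq_0_iff sum.neutral)
  then have pos: "y $ 0 > 0"
    unfolding y0 using assms(1-3)
    by (intro sum_pos2[of _ q]) (auto simp: less_le intro!: mult_nonneg_nonneg)
  then show "(\<Sum>q\<in>T. c q *\<^sub>R g q) $ 0 > 0"
    by (simp add: y_def)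
  have "klein y = (\<Sum>q\<in>T. (1 / y $ 0) *\<^sub>R c q *\<^sub>R g q)"
    by (simp add: klein_def y_def scaleR_sum_right divide_inverse)
  also have "\<dots> = (\<Sum>q\<in>T. (c q * g q $ 0 / y $ 0) *\<^sub>R klein (g q))"
  proof (rule sum.cong)
    fix q assume "q \<in> T"
    then have "g q $ 0 \<noteq> 0"
      using assms(3) by force
    then show "(1 / y $ 0) *\<^sub>R c q *\<^sub>R g q = (c q * g q $ 0 / y $ 0) *\<^sub>R klein (g q)"
      by (simp add: klein_def)
  qed simp
  also have "\<dots> \<in> K"
  proof (rule convex_sum[OF assms(1,4)])
    show "(\<Sum>q\<in>T. c q * g q $ 0 / y $ 0) = 1"
      using pos y0 by (simp flip: sum_divide_distrib)
    show "0 \<le> c q * g q $ 0 / y $ 0" if "q \<in> T" for q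
      using assms(2,3)[OF that] pos by simp
    show "klein (g q) \<in> K" if "q \<in> T" for q
      using assms(3)[OF that] by simp
  qed
  finally show "klein (\<Sum>q\<in>T. c q *\<^sub>R g q) \<in> K"
    by (simp add: y_def)
qed

section \<open>The model polyhedron and its corners\<close>

text \<open>The points of \<open>closed_model I\<close> on no lateral face. The set is convex, it
  avoids all missing points, and the gluings do not touch it.\<close>

definition open_model :: "4 set \<Rightarrow> (real^4) set" where
  "open_model I = {x \<in> closed_model I. \<forall>k. 0 < x $ k}"

text \<open>The end near the vertex \<open>k\<close> of the truncated edge from \<open>k\<close>
  to \<open>j\<close>.\<close>

definition corner :: "4 \<Rightarrow> 4 \<Rightarrow> real^4" where
  "corner k j = axis k (3/4) + axis j (1/4)"

lemma corner_nth:
  assumes "j \<noteq> k"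
  shows "corner k j $ m = (if m = k then 3/4 else if m = j then 1/4 else 0)"
  using assms by (auto simp: corner_def axis_def)

lemma other_index: "\<exists>m. m \<noteq> a \<and> m \<noteq> b \<and> m \<noteq> (c :: 4)"
proof -
  have "card {a, b, c} < CARD(4)"
    using card_insert_le_m1[of 3 "{b, c}" a] card_insert_le_m1[of 2 "{c}" b] by simp
  then have "{a, b, c} \<noteq> UNIV"
    by auto
  then show ?thesis
    by blast
qed

lemma other_indices:
  assumes "k \<noteq> (l :: 4)"
  obtains a b where "distinct [k, l, a, b]"
proof -
  obtain a where "a \<noteq> k" "a \<noteq> l"
    using other_index[of k l l] by blast
  moreover obtain b where "b \<noteq> k" "b \<noteq> l" "b \<noteq> a"
    using other_index[of k l a] by blast
  ultimately show ?thesis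
    using that[of a b] assms by auto
qed

lemma convex_open_model: "convex (open_model I)"
proof -
  have "{x :: real^4. c \<le> x $ k} = {x. axis k 1 \<bullet> x \<ge> c}" "{x :: real^4. x $ k \<le> c} = {x. axis k 1 \<bullet> x \<le> c}"
    "{x :: real^4. c < x $ k} = {x. axis k 1 \<bullet> x > c}" for k c
    by (simp_all add: inner_axis')
  then have c: "convex {x :: real^4. c \<le> x $ k}" "convex {x :: real^4. x $ k \<le> c}"
      "convex {x :: real^4. c < x $ k}" for k c
    by (simp_all add: convex_halfspace_ge convex_halfspace_le convex_halfspace_gt)
  have "{x :: real^4. sum (($) x) UNIV = 1} = {x. (\<chi> i. 1) \<bullet> x = 1}"
    by (simp add: inner_vec_def)
  then have s: "convex {x :: real^4. sum (($) x) UNIV = 1}"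
    by (simp add: convex_hyperplane)
  have "open_model I = {x. sum (($) x) UNIV = 1} \<inter> (\<Inter>k. {x. 0 \<le> x $ k}) \<inter> (\<Inter>k\<in>-I. {x. x $ k \<le> 3/4})
      \<inter> (\<Inter>k. {x. 0 < x $ k})"
    by (auto simp: open_model_def closed_model_def std_simplex_def)
  then show ?thesis
    by (simp only:) (intro convex_Int convex_INT c s)
qed

lemma centre_in_open_model: "(\<chi> i. 1/4) \<in> open_model I"
  by (simp add: open_model_def closed_model_def std_simplex_def)

text \<open>The coordinates other than \<open>k\<close> share the remaining weight
  \<open>1/4\<close> equally.\<close>

lemma truncation_point_in_open_model: "(\<chi> i. if i = k then 3/4 else 1/12) \<in> open_model I"
proof -
  have "(\<Sum>i\<in>UNIV. if i = k then 3/4 else 1/12 :: real) = (\<Sum>i\<in>UNIV. 1/12 + (if i = k then 2/3 else 0))"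
    by (rule sum.cong) auto
  also have "\<dots> = 1"
    by (simp add: sum.distrib)
  finally show ?thesis
    by (simp add: open_model_def closed_model_def std_simplex_def)
qed

text \<open>Adding the origin raises the affine dimension by one.\<close>

lemma dim_eq_aff_dim_plus_1:
  fixes T :: "(real^4) set"
  assumes "T \<subseteq> {x. a \<bullet> x = b}" "b \<noteq> 0"
  shows "int (dim T) = aff_dim T + 1"
proof -
  have "affine hull T \<subseteq> {x. a \<bullet> x = b}"
    using assms(1) affine_hyperplane[of a b] by (rule hull_minimal)
  then have "0 \<notin> affine hull T"
    using assms(2) by auto
  then have "aff_dim (insert 0 T) = aff_dim T + 1"
    by (simp add: aff_dim_insert)
  moreover have "aff_dim (insert 0 T) = int (dim (insert 0 T))"
    by (rule aff_dim_zero) (simp add: hull_inc)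
  moreover have "dim (insert 0 T) = dim T"
    by (simp add: dim_insert span_zero)
  ultimately show ?thesis
    by simp
qed

lemma span_open_model: "span (open_model I) = UNIV"
proof -
  let ?c = "(\<chi> i. 1/4) :: real^4"
  have "axis k 1 \<in> span (open_model I)" for k
  proof -
    let ?t = "(\<chi> i. if i = k then 3/4 else 1/12) :: real^4"
    have "axis k 1 = (3/2) *\<^sub>R (?t - (1/3) *\<^sub>R ?c)"
      by (auto simp: vec_eq_iff axis_def)
    also have "\<dots> \<in> span (open_model I)"
      by (intro span_mul span_diff span_base centre_in_open_model truncation_point_in_open_model)
    finally show ?thesis .
  qed
  then have "Basis \<subseteq> span (open_model I)"
    by (auto simp: Basis_vec_def)
  from span_mono[OF this] show ?thesis
    unfolding span_span span_Basis by (simp add: top.extremum_unique)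
qed

lemma aff_dim_open_model: "aff_dim (open_model I) = 3"
proof -
  have "(\<chi> i. 1) \<bullet> x = sum (($) x) UNIV" for x :: "real^4"
    by (simp add: inner_vec_def)
  moreover have "sum (($) x) UNIV = 1" if "x \<in> open_model I" for x
    using that unfolding open_model_def closed_model_def std_simplex_def by blast
  ultimately have "open_model I \<subseteq> {x. (\<chi> i. 1) \<bullet> x = 1}"
    by auto
  then have "int (dim (open_model I)) = aff_dim (open_model I) + 1"
    by (rule dim_eq_aff_dim_plus_1) simp
  moreover have "dim (open_model I) = dim (span (open_model I))"
    by simp
  ultimately show ?thesis
    unfolding span_open_model by simp
qed

text \<open>For the vertices \<open>V\<close> of a lifted tetrahedron, or of one of its faces,
  these are vectors on the rays over the corners of the truncated polyhedron: ideal vertices, and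
  for a non-ideal vertex \<open>x\<close> the projections of the other vertices \<open>y\<close>
  to the truncation plane of \<open>x\<close>. The definition refers to the set \<open>V\<close>
  only, so that two tetrahedra with a common face have common corner rays there.\<close>

definition corner_rays :: "(real^4) set \<Rightarrow> (real^4) set" where
  "corner_rays V = {x \<in> V. mink x x = 0} \<union>
     {y - mink x y *\<^sub>R x | x y. x \<in> V \<and> y \<in> V \<and> x \<noteq> y \<and> mink x x \<noteq> 0}"

lemma finite_corner_rays:
  assumes "finite V"
  shows "finite (corner_rays V)"
proof -
  have "corner_rays V \<subseteq> V \<union> (\<lambda>(x, y). y - mink x y *\<^sub>R x) ` (V \<times> V)"
    by (auto simp: corner_rays_def)
  then show ?thesis
    by (rule finite_subset) (use assms in auto)
qed

text \<open>The sign of \<open>t\<close> is seen from an interior point, which has nonpositive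
  products with all vertices.\<close>

lemma corner_rays_mono: "V \<subseteq> W \<Longrightarrow> corner_rays V \<subseteq> corner_rays W"
  unfolding corner_rays_def by blast

section \<open>Geometric realizations of a truncated tetrahedron\<close>

text \<open>A geometric realization together with its vertices: the outer unit normals of the
  truncation planes and lightlike vectors over the ideal vertices. The family \<open>u\<close> is
  what a lift provides, transported back to the realization.\<close>

locale marked_realization =
  fixes I :: "4 set" and Z :: "4 set set" and e :: "real^4 \<Rightarrow> real^4" and u :: "4 \<Rightarrow> real^4"
  assumes data: "ptt_data I Z"
    and geom: "geometric_realization I Z e"
    and unit: "k \<notin> I \<Longrightarrow> mink (u k) (u k) = 1"
    and trunc: "k \<notin> I \<Longrightarrow> x \<in> ptt I Z \<Longrightarrow> x $ k = 3/4 \<Longrightarrow> mink (e x) (u k) = 0"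
    and side: "k \<notin> I \<Longrightarrow> x \<in> ptt I Z \<Longrightarrow> mink (e x) (u k) \<le> 0"
    and ideal: "k \<in> I \<Longrightarrow> \<exists>c>0. u k = c *\<^sub>R e (axis k 1)"
begin

lemma realization:
  shows "e ` ptt I Z \<subseteq> hyp3" "e ` missing I Z \<subseteq> light_cone" "inj_on e (ptt I Z)"
    "continuous_on (closed_model I) (klein \<circ> e)"
    "\<forall>E \<in> Z. (klein \<circ> e) constant_on model_edge I E"
    "geodesic_image e I UNIV"
    "\<forall>i. geodesic_image e I (lateral i) \<and> dim (e ` (closed_model I \<inter> lateral i)) = 3"
    "\<forall>k. k \<notin> I \<longrightarrow> geodesic_image e I (truncation k) \<and> dim (e ` (closed_model I \<inter> truncation k)) = 3"
    "\<forall>k i. k \<notin> I \<longrightarrow> i \<noteq> k \<longrightarrow>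
        (\<forall>w n. (\<forall>x \<in> closed_model I \<inter> truncation k. mink (e x) w = 0) \<longrightarrow>
               (\<forall>x \<in> closed_model I \<inter> lateral i. mink (e x) n = 0) \<longrightarrow> mink w n = 0)"
  using geom unfolding geometric_realization_def by - (elim conjE, assumption)+

lemma edge_card: "E \<in> Z \<Longrightarrow> card E = 2" "E \<in> Z \<Longrightarrow> E \<inter> I = {}"
  using data by (auto simp: ptt_data_def)

lemma open_subset_ptt: "open_model I \<subseteq> ptt I Z"
proof
  fix x assume x: "x \<in> open_model I"
  have "x \<notin> missing I Z"
  proof
    assume "x \<in> missing I Z"
    then consider k where "x = axis k 1" | E where "E \<in> Z" "x \<in> model_edge I E"
      unfolding missing_def by blast
    then have "\<exists>m. x $ m = 0"
    proof cases
      case (1 k)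
      then show ?thesis
        using other_index[of k k k] by (auto simp: axis_def)
    next
      case (2 E)
      have "E \<noteq> UNIV"
        using edge_card[OF 2(1)] by auto
      then show ?thesis
        using 2 unfolding model_edge_def by blast
    qed
    then show False
      using x by (auto simp: open_model_def less_le)
  qed
  then show "x \<in> ptt I Z"
    using x by (simp add: ptt_def open_model_def)
qed

lemma closed_cases:
  assumes "x \<in> closed_model I"
  obtains "x \<in> ptt I Z" "e x \<in> hyp3" | "x \<in> missing I Z" "x \<notin> ptt I Z" "e x \<in> light_cone"
  using assms realization(1,2) unfolding ptt_def by blast

lemma closed_future: "x \<in> closed_model I \<Longrightarrow> future (e x)"
  by (erule closed_cases) (auto intro: future_hyp3 future_light_cone)

lemma closed_time_positive: "x \<in> closed_model I \<Longrightarrow> e x $ 0 > 0"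
  using closed_future by (simp add: future_def)

lemma open_hyp3: "x \<in> open_model I \<Longrightarrow> e x \<in> hyp3"
  using open_subset_ptt realization(1) by blast

text \<open>On missing points the map \<open>e\<close> is only continuous up to scale, but the
  sign of a linear functional is invariant under scaling. So it may be computed along a segment
  that ends at an interior point of the model.\<close>

lemma limit_le:
  assumes z: "z \<in> open_model I" and x: "x \<in> closed_model I"
    and le: "\<And>t. 0 < t \<Longrightarrow> t \<le> 1 \<Longrightarrow> (1 - t) *\<^sub>R x + t *\<^sub>R z \<in> open_model I \<Longrightarrow>
      mink (e ((1 - t) *\<^sub>R x + t *\<^sub>R z)) w \<le> 0"
  shows "mink (e x) w \<le> 0"
proof -
  define p where "p t = (1 - t) *\<^sub>R x + t *\<^sub>R z" for t :: real
  have closed: "p t \<in> closed_model I" if "0 \<le> t" "t \<le> 1" for t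
  proof -
    have z': "z \<in> closed_model I"
      using z by (simp add: open_model_def)
    have "sum (($) (p t)) UNIV = (1 - t) * sum (($) x) UNIV + t * sum (($) z) UNIV"
      by (simp add: p_def sum.distrib sum_distrib_left)
    then have "sum (($) (p t)) UNIV = 1"
      using x z' by (simp add: closed_model_def std_simplex_def)
    moreover have "0 \<le> p t $ k" for k
      using x z' that by (simp add: p_def closed_model_def std_simplex_def)
    moreover have "p t $ k \<le> 3/4" if "k \<notin> I" for k
      using convex_bound_le[of "x $ k" "3/4" "z $ k" "1 - t" t] x z' that \<open>0 \<le> t\<close> \<open>t \<le> 1\<close>
      by (simp add: p_def closed_model_def)
    ultimately show ?thesis
      by (simp add: closed_model_def std_simplex_def)
  qed
  have "p t \<in> open_model I" if "0 < t" "t \<le> 1" for t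
  proof -
    have "0 < p t $ k" for k
    proof -
      have "0 \<le> (1 - t) * x $ k" "0 < t * z $ k"
        using that x z by (auto simp: open_model_def closed_model_def std_simplex_def)
      then show ?thesis
        by (simp add: p_def)
    qed
    then show ?thesis
      using closed[of t] that by (simp add: open_model_def)
  qed
  then have neg: "mink (e (p t)) w \<le> 0" if "0 < t" "t \<le> 1" for t
    using le that by (simp add: p_def)
  have k: "mink (klein (e (p t))) w = mink (e (p t)) w / e (p t) $ 0" for t
    by (simp add: klein_def mink_linear divide_inverse mult.commute)
  have "continuous_on {0..1} p"
    unfolding p_def by (intro continuous_intros)
  moreover have "p ` {0..1} \<subseteq> closed_model I"
    using closed by auto
  ultimately have "continuous_on {0..1} ((klein \<circ> e) \<circ> p)"
    using continuous_on_compose continuous_on_subset realization(4) by blast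
  then have "continuous_on {0..1} (\<lambda>t. mink (klein (e (p t))) w)"
    using continuous_on_mink[of "{0..1}" "(klein \<circ> e) \<circ> p" "\<lambda>_. w"] by (simp add: comp_def)
  then have cont: "continuous_on (closure {0<..1}) (\<lambda>t. mink (klein (e (p t))) w)"
    by simp
  have le': "mink (klein (e (p t))) w \<le> 0" if "t \<in> {0<..1}" for t
    unfolding k using that neg[of t] closed_time_positive[OF closed[of t]]
    by (auto intro!: divide_nonpos_pos)
  have "mink (klein (e (p 0))) w \<le> 0"
    by (rule continuous_le_on_closure[OF cont _ le']) auto
  then show ?thesis
    using closed_time_positive[OF x] unfolding k by (simp add: p_def field_simps divide_le_0_iff)
qed

lemma side_closed:
  assumes "k \<notin> I" "x \<in> closed_model I"
  shows "mink (e x) (u k) \<le> 0"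
  using limit_le[OF centre_in_open_model assms(2)] side[OF assms(1)] open_subset_ptt by blast

lemma trunc_closed:
  assumes "k \<notin> I" "x \<in> closed_model I" "x $ k = 3/4"
  shows "mink (e x) (u k) = 0"
proof (rule antisym)
  let ?t = "(\<chi> i. if i = k then 3/4 else 1/12) :: real^4"
  have t: "((1 - t) *\<^sub>R x + t *\<^sub>R ?t) $ k = 3/4" for t
    using assms(3) by (simp add: field_simps)
  have "mink (e ((1 - t) *\<^sub>R x + t *\<^sub>R ?t)) (u k) = 0"
    if "(1 - t) *\<^sub>R x + t *\<^sub>R ?t \<in> open_model I" for t
    using trunc[OF assms(1) _ t] that open_subset_ptt by blast
  then have "mink (e x) (c *\<^sub>R u k) \<le> 0" for c
    by (intro limit_le[OF truncation_point_in_open_model[of k] assms(2)]) (simp add: mink_linear)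
  from this[of 1] this[of "-1"] show "mink (e x) (u k) \<le> 0" "0 \<le> mink (e x) (u k)"
    by (simp_all add: mink_linear)
qed

text \<open>By invariance of dimension, since the projective image of an embedding of a
  3-dimensional convex set cannot lie in a plane. This excludes flat realizations.\<close>

lemma span_open_image: "span (e ` open_model I) = UNIV"
proof -
  let ?T = "klein ` e ` open_model I"
  have h: "e ` open_model I \<subseteq> hyp3"
    using open_hyp3 by blast
  have "inj_on (klein \<circ> e) (open_model I)"
    using realization(3) open_subset_ptt h klein_inj_hyp3 by (blast intro: comp_inj_on inj_on_subset)
  moreover have "continuous_on (open_model I) (klein \<circ> e)"
    using realization(4) by (rule continuous_on_subset) (auto simp: open_model_def)
  moreover have "(klein \<circ> e) \<in> open_model I \<rightarrow> affine hull ?T"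
    by (auto intro: hull_inc)
  ultimately have "aff_dim (open_model I) \<le> aff_dim ?T"
    using invariance_of_dimension_convex_domain[OF convex_open_model] by blast
  moreover have "?T \<subseteq> {x. axis 0 1 \<bullet> x = 1}"
    using h by (auto simp: klein_def inner_axis' hyp3_def)
  ultimately have "int (dim ?T) \<ge> 4"
    using dim_eq_aff_dim_plus_1[of ?T] aff_dim_open_model by simp
  then have "dim ?T = DIM(real^4)"
    using dim_subset_UNIV[of ?T] by simp
  then have "span ?T = UNIV"
    by (rule iffD1[OF dim_eq_full])
  moreover have "span ?T \<subseteq> span (e ` open_model I)"
    by (intro span_minimal) (auto simp: klein_def intro: span_mul span_base)
  ultimately show ?thesis
    by blast
qed

lemma corners_eq: "corners I = (\<lambda>k. axis k 1) ` I \<union> {corner k j | k j. k \<notin> I \<and> j \<noteq> k}"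
  by (simp add: corners_def corner_def)

lemma axis_closed: "k \<in> I \<Longrightarrow> axis k 1 \<in> closed_model I"
  by (auto simp: closed_model_def std_simplex_def axis_def)

lemma corner_closed: "k \<notin> I \<Longrightarrow> j \<noteq> k \<Longrightarrow> corner k j \<in> closed_model I"
proof -
  assume k: "k \<notin> I" "j \<noteq> k"
  have "sum (($) (corner k j)) UNIV = 1"
    by (simp add: corner_def sum.distrib axis_def)
  then show ?thesis
    using k by (auto simp: closed_model_def std_simplex_def corner_nth)
qed

lemma corners_subset_closed: "corners I \<subseteq> closed_model I"
  using axis_closed corner_closed by (auto simp: corners_eq)

lemma geodesic_span:
  assumes "geodesic_image e I S"
  shows "span (e ` (closed_model I \<inter> S)) = span (e ` (corners I \<inter> S))"
proof (rule span_eq[THEN iffD2], intro conjI)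
  have k: "klein y \<in> span (e ` (corners I \<inter> S))" if "y \<in> e ` (corners I \<inter> S)" for y
    using that by (simp add: klein_def span_mul span_base)
  have "e x \<in> span (e ` (corners I \<inter> S))" if x: "x \<in> closed_model I \<inter> S" for x
  proof -
    have "klein (e x) \<in> convex hull (klein ` e ` (corners I \<inter> S))"
      using assms x unfolding geodesic_image_def by blast
    also have "\<dots> \<subseteq> span (e ` (corners I \<inter> S))"
      by (rule hull_minimal) (use k in \<open>auto simp: subspace_imp_convex\<close>)
    finally have "(e x $ 0) *\<^sub>R klein (e x) \<in> span (e ` (corners I \<inter> S))"
      by (rule span_mul)
    then show ?thesis
      using closed_time_positive[of x] x by (simp add: klein_def)
  qed
  then show "e ` (closed_model I \<inter> S) \<subseteq> span (e ` (corners I \<inter> S))"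
    by blast
  show "e ` (corners I \<inter> S) \<subseteq> span (e ` (closed_model I \<inter> S))"
    using corners_subset_closed by (auto intro: span_base)
qed

definition face_span :: "4 \<Rightarrow> (real^4) set" where
  "face_span i = span (e ` (closed_model I \<inter> lateral i))"

lemma subspace_face_span: "subspace (face_span i)"
  by (simp add: face_span_def)

lemma dim_face_span: "dim (face_span i) = 3"
  using realization(7) by (simp add: face_span_def)

lemma closed_lateral_in_face_span: "x \<in> closed_model I \<Longrightarrow> x $ i = 0 \<Longrightarrow> e x \<in> face_span i"
  unfolding face_span_def by (intro span_base) (auto simp: lateral_def)

text \<open>For a non-ideal vertex this is the orthogonality of truncation triangles and lateral
  hexagons.\<close>

lemma vertex_in_face_span:
  assumes "j \<noteq> i"
  shows "u j \<in> face_span i"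
proof (cases "j \<in> I")
  case True
  then obtain c where c: "u j = c *\<^sub>R e (axis j 1)"
    using ideal by blast
  have "e (axis j 1) \<in> face_span i"
    using axis_closed[OF True] assms by (intro closed_lateral_in_face_span) (auto simp: axis_def)
  then show ?thesis
    unfolding c face_span_def by (rule span_mul)
next
  case False
  have "dim (face_span i) < DIM(real^4)"
    by (simp add: dim_face_span)
  then obtain a where a: "a \<noteq> 0" "\<And>y. y \<in> span (face_span i) \<Longrightarrow> orthogonal a y"
    using orthogonal_to_subspace_exists by blast
  have fs: "face_span i \<subseteq> {y. a \<bullet> y = 0}"
    using a(2) by (auto simp: orthogonal_def intro: span_base)
  have "face_span i = {y. a \<bullet> y = 0}"
    by (rule subspace_dim_equal[OF subspace_face_span subspace_hyperplane fs])
      (use a(1) in \<open>simp add: dim_face_span dim_hyperplane\<close>)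
  moreover have "mink (u j) (time_flip a) = 0"
  proof (rule realization(9)[rule_format, OF False assms[symmetric]])
    show "mink (e x) (u j) = 0" if "x \<in> closed_model I \<inter> truncation j" for x
      using that trunc_closed[OF False] by (auto simp: truncation_def)
    show "mink (e x) (time_flip a) = 0" if "x \<in> closed_model I \<inter> lateral i" for x
    proof -
      have "e x \<in> face_span i"
        unfolding face_span_def using that by (auto intro: span_base)
      then show ?thesis
        using fs by (auto simp: mink_commute[of _ "time_flip a"] mink_time_flip)
    qed
  qed
  ultimately show ?thesis
    by (simp add: mink_commute[of _ "time_flip a"] mink_time_flip)
qed

text \<open>The three corners near \<open>k\<close> span the truncation plane, and \<open>u
  k\<close> is its normal.\<close>

lemma truncation_corner_basis:
  assumes "k \<notin> I"
  shows "span (range (\<lambda>j. if j = k then u k else e (corner k j))) = UNIV"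
proof -
  let ?T = "(\<lambda>j. e (corner k j)) ` (- {k})"
  have "corners I \<inter> truncation k = corner k ` (- {k})"
    using assms by (auto simp: corners_eq truncation_def corner_nth axis_def split: if_splits)
  then have "span (e ` (closed_model I \<inter> truncation k)) = span ?T"
    using geodesic_span[OF conjunct1[OF realization(8)[rule_format, OF assms]]] by (simp add: image_image)
  then have "dim ?T = dim (e ` (closed_model I \<inter> truncation k))"
    by (rule span_eq_dim[OF sym])
  then have "dim ?T = 3"
    using conjunct2[OF realization(8)[rule_format, OF assms]] by simp
  moreover have "u k \<notin> span ?T"
  proof
    assume "u k \<in> span ?T"
    then have "mink (u k) (u k) = 0"
      by (rule mink_zero_on_span[rotated])
        (use trunc_closed[OF assms corner_closed[OF assms]] in \<open>auto simp: mink_commute[of "u k"] corner_nth\<close>)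
    then show False
      using unit[OF assms] by simp
  qed
  ultimately have "dim (insert (u k) ?T) = 4"
    by (simp add: dim_insert)
  moreover have "range (\<lambda>j. if j = k then u k else e (corner k j)) = insert (u k) ?T"
    by auto
  ultimately show ?thesis
    using dim_eq_full[of "insert (u k) ?T"] by simp
qed

text \<open>The linear spans of the faces \<open>a\<close> and \<open>b\<close> meet in the plane
  over the edge from \<open>k\<close> to \<open>l\<close>. Indeed, in the basis given by \<open>u
  k\<close> and the corners near \<open>k\<close>, each of the two spans contains all basis
  vectors but one.\<close>

lemma face_line:
  assumes k: "k \<notin> I" and d: "distinct [k, l, a, b]" and x: "x \<in> face_span a" "x \<in> face_span b"
  obtains s t where "x = s *\<^sub>R u k + t *\<^sub>R e (corner k l)"
proof -
  define w where "w j = (if j = k then u k else e (corner k j))" for j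
  have full: "span (range w) = UNIV"
    using truncation_corner_basis[OF k] by (simp add: w_def)
  obtain \<nu> where "\<And>a b. mink (\<nu> a) (w b) = (if a = b then 1 else 0)"
    and \<nu>: "\<And>y. y = (\<Sum>j\<in>UNIV. mink (\<nu> j) y *\<^sub>R w j)"
    by (rule mink_dual_basis[OF full]) (rule that; assumption)
  have w: "w j \<in> face_span i" if "j \<noteq> i" "i \<noteq> k" for i j
    using that vertex_in_face_span[of k i] corner_closed[OF k] closed_lateral_in_face_span[of "corner k j" i]
    by (auto simp: w_def corner_nth)
  have zero: "mink (\<nu> i) x = 0" if i: "i \<noteq> k" "x \<in> face_span i" for i
  proof (rule ccontr)
    assume n: "mink (\<nu> i) x \<noteq> 0"
    have "mink (\<nu> i) x *\<^sub>R w i = x - (\<Sum>j\<in>UNIV - {i}. mink (\<nu> j) x *\<^sub>R w j)"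
    proof -
      have "x = mink (\<nu> i) x *\<^sub>R w i + (\<Sum>j\<in>UNIV - {i}. mink (\<nu> j) x *\<^sub>R w j)"
        by (rule trans[OF \<nu>[of x] sum.remove]) auto
      then show ?thesis
        by (simp only: eq_diff_eq)
    qed
    also have "\<dots> \<in> face_span i"
      using i w subspace_face_span by (intro subspace_diff subspace_sum subspace_scale) auto
    finally have wi: "mink (\<nu> i) x *\<^sub>R w i \<in> face_span i" .
    have "w i \<in> face_span i"
      using subspace_scale[OF subspace_face_span wi, of "inverse (mink (\<nu> i) x)"] n by simp
    then have "w j \<in> face_span i" for j
      using w[OF _ i(1), of j] by (cases "j = i") auto
    then have "range w \<subseteq> face_span i"
      by blast
    then have "span (range w) \<subseteq> face_span i"
      using subspace_face_span by (simp add: span_minimal)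
    then have "dim (face_span i) = 4"
      using full by (simp add: top.extremum_unique)
    then show False
      by (simp add: dim_face_span)
  qed
  have "x = mink (\<nu> k) x *\<^sub>R w k + mink (\<nu> l) x *\<^sub>R w l + mink (\<nu> a) x *\<^sub>R w a + mink (\<nu> b) x *\<^sub>R w b"
    using \<nu>[of x] unfolding sum_four_indices[OF d] .
  moreover have "mink (\<nu> a) x = 0" "mink (\<nu> b) x = 0"
    using zero x d by auto
  ultimately have "x = mink (\<nu> k) x *\<^sub>R u k + mink (\<nu> l) x *\<^sub>R e (corner k l)"
    using d by (auto simp: w_def)
  then show ?thesis
    by (rule that)
qed

text \<open>Two points of the model can have the same projective image only if both are
  missing.\<close>

lemma proportional_imp_eq:
  assumes "x \<in> closed_model I" "y \<in> closed_model I" "e x = c *\<^sub>R e y" "x \<in> ptt I Z"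
  shows "x = y"
proof -
  have x: "e x \<in> hyp3"
    using assms(4) realization(1) by blast
  then have c: "c \<noteq> 0" "c\<^sup>2 * mink (e y) (e y) = -1"
    unfolding assms(3) by (auto simp: hyp3_def mink_linear power2_eq_square)
  then have "e y \<notin> light_cone"
    by (auto simp: light_cone_def)
  then have y: "y \<in> ptt I Z" "e y \<in> hyp3"
    using assms(2) by (auto elim: closed_cases)
  have "klein (e x) = klein (e y)"
    unfolding assms(3) by (rule klein_scale[OF c(1)])
  then have "e x = e y"
    using klein_inj_hyp3 x y(2) by (auto dest: inj_onD)
  then show ?thesis
    using realization(3) assms(4) y(1) by (auto dest: inj_onD)
qed

lemma corner_not_axis: "j \<noteq> k \<Longrightarrow> corner k j \<noteq> axis m 1"
proof
  assume a: "j \<noteq> k" "corner k j = axis m 1"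
  have "corner k j $ k = 3/4"
    using a(1) by (simp add: corner_nth)
  then show False
    unfolding a(2) by (simp add: axis_def split: if_splits)
qed

lemma corner_in_ptt_iff:
  assumes "k \<notin> I" "j \<noteq> k"
  shows "corner k j \<in> ptt I Z \<longleftrightarrow> {k, j} \<notin> Z"
proof -
  have "corner k j \<in> missing I Z \<longleftrightarrow> {k, j} \<in> Z"
  proof
    assume "corner k j \<in> missing I Z"
    then obtain E where E: "E \<in> Z" "corner k j \<in> model_edge I E"
      unfolding missing_def using corner_not_axis[OF assms(2)] by blast
    then have "{k, j} \<subseteq> E"
      using assms(2) by (auto simp: model_edge_def corner_nth)
    then have "{k, j} = E"
      using edge_card(1)[OF E(1)] assms(2) by (intro card_subset_eq) (auto intro: card_ge_0_finite)
    then show "{k, j} \<in> Z"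
      using E(1) by simp
  next
    assume "{k, j} \<in> Z"
    moreover have "corner k j \<in> model_edge I {k, j}"
      using corner_closed[OF assms] assms(2) by (auto simp: model_edge_def corner_nth)
    ultimately show "corner k j \<in> missing I Z"
      unfolding missing_def by blast
  qed
  then show ?thesis
    using corner_closed[OF assms] by (auto simp: ptt_def)
qed

lemma zero_edge_corners:
  assumes "{k, j} \<in> Z" "j \<noteq> k"
  shows "k \<notin> I" "j \<notin> I" "klein (e (corner k j)) = klein (e (corner j k))"
proof -
  show I: "k \<notin> I" "j \<notin> I"
    using edge_card(2)[OF assms(1)] by auto
  have "corner k j \<in> model_edge I {k, j}" "corner j k \<in> model_edge I {k, j}"
    using corner_closed[OF I(1)] corner_closed[OF I(2)] assms(2) by (auto simp: model_edge_def corner_nth)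
  then show "klein (e (corner k j)) = klein (e (corner j k))"
    using bspec[OF realization(5) assms(1)] unfolding constant_on_def comp_def by force
qed

lemma corner_orthogonal: "k \<notin> I \<Longrightarrow> j \<noteq> k \<Longrightarrow> mink (e (corner k j)) (u k) = 0"
  by (rule trunc_closed) (auto simp: corner_closed corner_nth)

lemma corner_nonzero: "k \<notin> I \<Longrightarrow> j \<noteq> k \<Longrightarrow> e (corner k j) \<noteq> 0"
  using closed_time_positive[OF corner_closed, of k j] by auto

text \<open>The corners near a non-ideal vertex are independent, although some may be at
  infinity.\<close>

lemma corners_not_parallel:
  assumes "a \<notin> I" "distinct [a, k, l]"
  shows "klein (e (corner a k)) \<noteq> klein (e (corner a l))"
proof
  assume "klein (e (corner a k)) = klein (e (corner a l))"
  then obtain c where c: "e (corner a k) = c *\<^sub>R e (corner a l)"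
    using klein_eq_iff_positive_multiple closed_time_positive corner_closed assms by fastforce
  define w where "w j = (if j = a then u a else e (corner a j))" for j
  have full: "span (range w) = UNIV"
    using truncation_corner_basis[OF assms(1)] by (simp add: w_def)
  obtain \<nu> where \<nu>: "\<And>a b. mink (\<nu> a) (w b) = (if a = b then 1 else 0)"
    and "\<And>y. y = (\<Sum>j\<in>UNIV. mink (\<nu> j) y *\<^sub>R w j)"
    by (rule mink_dual_basis[OF full]) (rule that; assumption)
  have "k \<noteq> a" "l \<noteq> a"
    using assms(2) by auto
  then have "w k = c *\<^sub>R w l"
    using c by (simp add: w_def)
  then have "mink (\<nu> k) (w k) = c * mink (\<nu> k) (w l)"
    by (simp add: mink_linear)
  then show False
    using assms(2) by (simp add: \<nu>)
qed

lemma corner_line: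
  assumes "k \<notin> I" "l \<noteq> k"
  obtains s t where "u l = s *\<^sub>R u k + t *\<^sub>R e (corner k l)" "s = mink (u k) (u l)"
proof -
  obtain a b where d: "distinct [k, l, a, b]"
    using other_indices[OF assms(2)[symmetric]] by blast
  then obtain s t where st: "u l = s *\<^sub>R u k + t *\<^sub>R e (corner k l)"
    using face_line[OF assms(1) d vertex_in_face_span vertex_in_face_span] by auto
  have "mink (u k) (u l) = s"
    unfolding st mink_commute[of "u k" "s *\<^sub>R u k + t *\<^sub>R e (corner k l)"] using corner_orthogonal[OF assms] unit[OF assms(1)]
    by (simp add: mink_linear)
  then show ?thesis
    using that[OF st] by simp
qed

text \<open>Assume that \<open>k\<close> and \<open>l\<close> have the same truncation plane. The
  plane over the edge from \<open>k\<close> to \<open>a\<close> and that over the edge from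
  \<open>l\<close> to \<open>a\<close> both contain \<open>u a\<close> and \<open>u k\<close>, so
  if these were independent, the corners of both edges would be at the same place on the
  truncation plane. By injectivity both edges would have length 0, and then two corners near
  \<open>a\<close> would coincide.\<close>

lemma coincident_vertices_spread:
  assumes kl: "k \<notin> I" "l \<notin> I" "k \<noteq> l" and eq: "u l = s *\<^sub>R u k" and a: "a \<noteq> k" "a \<noteq> l"
  shows "\<exists>s. u a = s *\<^sub>R u k"
proof (rule ccontr)
  assume n: "\<not> ?thesis"
  have s: "s \<noteq> 0"
    using unit[OF kl(2)] eq by (auto simp: mink_linear)
  obtain s1 t1 where 1: "u a = s1 *\<^sub>R u k + t1 *\<^sub>R e (corner k a)"
    by (rule corner_line[OF kl(1) a(1)])
  obtain s2 t2 where 2: "u a = s2 *\<^sub>R u l + t2 *\<^sub>R e (corner l a)"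
    by (rule corner_line[OF kl(2) a(2)])
  have o: "mink (e (corner k a)) (u k) = 0" "mink (e (corner l a)) (u k) = 0"
    using corner_orthogonal[OF kl(1) a(1)] corner_orthogonal[OF kl(2) a(2)] s unfolding eq
    by (simp_all add: mink_linear)
  have "mink (u a) (u k) = s1"
    unfolding 1 using o unit[OF kl(1)] by (simp add: mink_linear)
  moreover have "mink (u a) (u k) = s2 * s"
    unfolding 2 eq using o unit[OF kl(1)] by (simp add: mink_linear)
  ultimately have e1: "t1 *\<^sub>R e (corner k a) = t2 *\<^sub>R e (corner l a)"
    using 1 2 eq by simp
  have t1: "t1 \<noteq> 0"
    using 1 n by auto
  then have e2: "e (corner k a) = (t2 / t1) *\<^sub>R e (corner l a)"
    using arg_cong[OF e1, of "\<lambda>x. (1 / t1) *\<^sub>R x"] by simp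
  then have t2: "t2 / t1 \<noteq> 0"
    using corner_nonzero[OF kl(1) a(1)] by auto
  then have e3: "e (corner l a) = (1 / (t2 / t1)) *\<^sub>R e (corner k a)"
    unfolding e2 by simp
  have ne: "corner k a \<noteq> corner l a"
  proof
    assume "corner k a = corner l a"
    then have "corner k a $ k = corner l a $ k"
      by simp
    then show False
      using kl(3) a by (simp add: corner_nth)
  qed
  have cl: "corner k a \<in> closed_model I" "corner l a \<in> closed_model I"
    using corner_closed kl a by auto
  have "corner k a \<notin> ptt I Z"
    using proportional_imp_eq[OF cl e2] ne by blast
  then have ka: "{k, a} \<in> Z"
    using corner_in_ptt_iff[OF kl(1) a(1)] by blast
  have "corner l a \<notin> ptt I Z"
    using proportional_imp_eq[OF cl(2) cl(1) e3] ne by auto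
  then have la: "{l, a} \<in> Z"
    using corner_in_ptt_iff[OF kl(2) a(2)] by blast
  have "klein (e (corner k a)) = klein (e (corner l a))"
    unfolding e2 by (rule klein_scale[OF t2])
  then have "klein (e (corner a k)) = klein (e (corner a l))"
    using zero_edge_corners(3)[OF ka a(1)] zero_edge_corners(3)[OF la a(2)] by simp
  moreover have "a \<notin> I"
    using zero_edge_corners(2)[OF ka a(1)] .
  ultimately show False
    using corners_not_parallel[of a k l] kl(3) a by auto
qed

lemma span_corners: "span (e ` corners I) = UNIV"
proof -
  have "span (e ` open_model I) \<subseteq> span (e ` closed_model I)"
    by (intro span_mono image_mono) (auto simp: open_model_def)
  then show ?thesis
    using geodesic_span[OF realization(6)] span_open_image by (simp add: top.extremum_unique)
qed

text \<open>Otherwise all truncation planes coincide by the preceding lemma, and this plane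
  contains all corners. So the realization would be flat.\<close>

lemma truncation_planes_distinct:
  assumes kl: "k \<notin> I" "l \<notin> I" "k \<noteq> l"
  shows "u l \<noteq> s *\<^sub>R u k"
proof
  assume eq: "u l = s *\<^sub>R u k"
  have par: "\<exists>c. u a = c *\<^sub>R u k" for a
  proof -
    consider "a = k" | "a = l" | "a \<noteq> k" "a \<noteq> l"
      by blast
    then show ?thesis
    proof cases
      case 1
      then show ?thesis
        by (intro exI[of _ 1]) simp
    next
      case 2
      then show ?thesis
        using eq by blast
    next
      case 3
      then show ?thesis
        by (rule coincident_vertices_spread[OF kl eq])
    qed
  qed
  have noI: "a \<notin> I" for a
  proof
    assume a: "a \<in> I"
    then obtain c where c: "c > 0" "u a = c *\<^sub>R e (axis a 1)"
      using ideal by blast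
    obtain b where b: "u a = b *\<^sub>R u k"
      using par by blast
    have "e (axis a 1) \<in> light_cone"
      using realization(2) a unfolding missing_def by blast
    then have "mink (u a) (u a) = 0" "u a $ 0 > 0"
      unfolding c(2) using c(1) by (auto simp: mink_linear light_cone_def)
    then show False
      using b unit[OF kl(1)] by (auto simp: mink_linear)
  qed
  have "mink (u k) (e x) = 0" if x: "x \<in> corners I" for x
  proof -
    obtain i j where ij: "x = corner i j" "j \<noteq> i"
      using x noI by (auto simp: corners_eq)
    obtain c where c: "u i = c *\<^sub>R u k"
      using par by blast
    have "c \<noteq> 0"
      using c unit[OF noI, of i] by (auto simp: mink_linear)
    then show ?thesis
      using corner_orthogonal[OF noI ij(2)] unfolding ij(1) c by (simp add: mink_linear mink_commute)
  qed
  then have "u k = 0"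
    by (intro mink_eq_zero_if_spanning[OF span_corners]) auto
  then show False
    using unit[OF kl(1)] by (simp add: mink_linear)
qed

lemma ideal_vertex: "a \<in> I \<Longrightarrow> u a \<in> light_cone"
proof -
  assume a: "a \<in> I"
  then obtain c where c: "c > 0" "u a = c *\<^sub>R e (axis a 1)"
    using ideal by blast
  have "e (axis a 1) \<in> light_cone"
    using realization(2) a unfolding missing_def by blast
  then show "u a \<in> light_cone"
    unfolding c(2) using c(1) by (auto simp: mink_linear light_cone_def)
qed

lemma corner_line_nonzero:
  assumes "k \<notin> I" "l \<noteq> k"
  obtains t where "t \<noteq> 0" "u l - mink (u k) (u l) *\<^sub>R u k = t *\<^sub>R e (corner k l)"
proof -
  obtain s t where st: "u l = s *\<^sub>R u k + t *\<^sub>R e (corner k l)" "s = mink (u k) (u l)"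
    by (rule corner_line[OF assms])
  have "t \<noteq> 0"
  proof
    assume "t = 0"
    then have eq: "u l = s *\<^sub>R u k"
      using st by simp
    show False
    proof (cases "l \<in> I")
      case True
      then have "mink (u l) (u l) = 0" "u l $ 0 > 0"
        using ideal_vertex by (auto simp: light_cone_def)
      then show False
        using eq unit[OF assms(1)] by (auto simp: mink_linear)
    next
      case False
      then show False
        using truncation_planes_distinct[OF assms(1) False assms(2)[symmetric]] eq by blast
    qed
  qed
  moreover have "u l - s *\<^sub>R u k = t *\<^sub>R e (corner k l)"
    using st(1) by simp
  ultimately show ?thesis
    using that st(2) by blast
qed

text \<open>Each corner lies in the span of two vertices, and the corners span the whole space. So
  the four vertices are linearly independent.\<close>

lemma span_vertices: "span (range u) = UNIV"
proof -
  have "e x \<in> span (range u)" if x: "x \<in> corners I" for x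
  proof -
    consider k where "k \<in> I" "x = axis k 1" | k j where "k \<notin> I" "j \<noteq> k" "x = corner k j"
      using x unfolding corners_eq by blast
    then show ?thesis
    proof cases
      case (1 k)
      then obtain c where "c > 0" "u k = c *\<^sub>R e x"
        using ideal by blast
      then have "e x = (1 / c) *\<^sub>R u k"
        by simp
      then show ?thesis
        by (simp add: span_mul span_base)
    next
      case (2 k j)
      obtain t where t: "t \<noteq> 0" "u j - mink (u k) (u j) *\<^sub>R u k = t *\<^sub>R e (corner k j)"
        by (rule corner_line_nonzero[OF 2(1,2)])
      then have "e x = (1 / t) *\<^sub>R (u j - mink (u k) (u j) *\<^sub>R u k)"
        using 2(3) by simp
      also have "\<dots> \<in> span (range u)"
        by (intro span_mul span_diff span_base) auto
      finally show ?thesis .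
    qed
  qed
  then have "span (e ` corners I) \<subseteq> span (range u)"
    by (intro span_minimal) auto
  then show ?thesis
    unfolding span_corners by (simp add: top.extremum_unique)
qed

end

section \<open>The Gram matrix of the vertices\<close>

context marked_realization
begin

lemma truncation_plane_point:
  assumes "k \<notin> I" "l \<notin> I"
  shows "\<exists>x \<in> hyp3. mink x (u k) = 0 \<and> mink x (u l) \<le> 0"
proof -
  let ?z = "(\<chi> i. if i = k then 3/4 else 1/12) :: real^4"
  have z: "?z \<in> open_model I"
    by (rule truncation_point_in_open_model)
  then have "?z \<in> ptt I Z"
    using open_subset_ptt by blast
  then show ?thesis
    using open_hyp3[OF z] trunc[OF assms(1), of ?z] side[OF assms(2), of ?z] by auto
qed

text \<open>The corner between \<open>k\<close> and \<open>l\<close> is a causal vector in the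
  span of \<open>u k\<close> and \<open>u l\<close>. This forces the absolute value of the product
  to be at least 1 when both are unit vectors. The product is not positive, since otherwise the
  two half-spaces would be nested, and one truncation plane would not be adjacent to the
  polyhedron.\<close>

lemma vertex_pairing_negative:
  assumes k: "k \<notin> I" and kl: "l \<noteq> k"
  shows "mink (u k) (u l) < 0"
    and "l \<notin> I \<Longrightarrow> mink (u k) (u l) \<le> -1"
proof -
  define m where "m = mink (u k) (u l)"
  obtain t where t: "t \<noteq> 0" "u l - m *\<^sub>R u k = t *\<^sub>R e (corner k l)"
    using corner_line_nonzero[OF assms] unfolding m_def by blast
  have nrm: "t\<^sup>2 * mink (e (corner k l)) (e (corner k l)) = mink (u l) (u l) - m\<^sup>2"
  proof -
    have "mink (u l - m *\<^sub>R u k) (u l - m *\<^sub>R u k) = mink (u l) (u l) - m\<^sup>2"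
      using unit[OF k] by (simp add: mink_linear mink_commute[of "u l" "u k"] power2_eq_square flip: m_def)
    then show ?thesis
      unfolding t(2) by (simp add: mink_linear power2_eq_square)
  qed
  have "m < 0 \<and> (l \<notin> I \<longrightarrow> m \<le> -1)"
  proof (cases "l \<in> I")
    case True
    obtain c where c: "c > 0" "u l = c *\<^sub>R e (axis l 1)"
      using ideal[OF True] by blast
    have "mink (e (axis l 1)) (u k) \<le> 0"
      by (rule side_closed[OF k axis_closed[OF True]])
    then have "m \<le> 0"
      using c(1) by (simp add: m_def c(2) mink_linear mink_commute[of "u k" "e (axis l 1)"] mult_nonneg_nonpos)
    moreover have "m \<noteq> 0"
    proof -
      have "{k, l} \<notin> Z"
        using edge_card(2) True by auto
      then have "corner k l \<in> ptt I Z"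
        using corner_in_ptt_iff[OF k kl] by blast
      then have "mink (e (corner k l)) (e (corner k l)) = -1"
        using realization(1) by (auto simp: hyp3_def)
      moreover have "mink (u l) (u l) = 0"
        using ideal_vertex[OF True] by (simp add: light_cone_def)
      ultimately have "t\<^sup>2 = m\<^sup>2"
        using nrm by simp
      then show ?thesis
        using t(1) by auto
    qed
    ultimately show ?thesis
      using True by simp
  next
    case False
    have fut: "future (e (corner k l))"
      by (rule closed_future[OF corner_closed[OF assms]])
    then have "t\<^sup>2 * mink (e (corner k l)) (e (corner k l)) \<le> 0"
      by (simp add: future_def mult_nonneg_nonpos)
    then have m2: "1 - m\<^sup>2 \<le> 0"
      using nrm unit[OF False] by simp
    have "\<not> m \<ge> 1"
    proof
      assume m1: "m \<ge> 1"
      \<comment> \<open>Both vectors would be future directed, while points on a truncation plane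
        show that their sum is not.\<close>
      define p q where "p = u l - m *\<^sub>R u k" and "q = u k - m *\<^sub>R u l"
      have mm: "mink (u l) (u k) = m" "mink (u k) (u l) = m"
        by (simp_all add: m_def mink_commute)
      have n: "mink p p \<le> 0" "mink q q \<le> 0"
        using m2 unit[OF k] unit[OF False]
        by (simp_all add: p_def q_def mink_linear mm power2_eq_square)
      have p0: "p \<noteq> 0"
        using t corner_nonzero[OF assms] by (simp add: p_def)
      have q0: "q \<noteq> 0"
        using truncation_planes_distinct[OF False k kl, of m] by (simp add: q_def)
      obtain x where x: "x \<in> hyp3" "mink x (u k) = 0" "mink x (u l) \<le> 0"
        using truncation_plane_point[OF k False] by blast
      obtain y where y: "y \<in> hyp3" "mink y (u l) = 0" "mink y (u k) \<le> 0"
        using truncation_plane_point[OF False k] by blast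
      have "future p"
        by (rule causal_imp_future(1)[OF x(1) _ n(1) p0]) (use x in \<open>simp add: p_def mink_linear\<close>)
      moreover have "future q"
        by (rule causal_imp_future(1)[OF y(1) _ n(2) q0]) (use y in \<open>simp add: q_def mink_linear\<close>)
      ultimately have "future (p + q)"
        by (rule future_add)
      then have "mink x (p + q) < 0"
        by (rule mink_future_le(2)[OF future_hyp3[OF x(1)]]) (use x(1) in \<open>simp add: hyp3_def\<close>)
      moreover have "mink x (p + q) = (1 - m) * mink x (u l)"
        using x(2) by (simp add: p_def q_def mink_linear algebra_simps)
      ultimately show False
        using m1 x(3) by (simp add: mult_less_0_iff)
    qed
    then have "m \<le> -1"
      using m2 abs_le_square_iff[of 1 m] by auto
    then show ?thesis
      by simp
  qed
  then show "mink (u k) (u l) < 0" "l \<notin> I \<Longrightarrow> mink (u k) (u l) \<le> -1"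
    by (simp_all add: m_def)
qed

lemma vertex_family_vertices: "vertex_family u"
proof -
  note ind = spanning_four_independent[OF span_vertices]
  have norm: "mink (u a) (u a) = (if a \<in> I then 0 else 1)" for a
    using unit ideal_vertex by (auto simp: light_cone_def)
  have neg: "mink (u a) (u b) < 0" if "a \<noteq> b" for a b
  proof -
    consider "a \<notin> I" | "b \<notin> I" | "a \<in> I" "b \<in> I"
      by blast
    then show ?thesis
    proof cases
      case 1
      then show ?thesis
        using vertex_pairing_negative(1)[of a b] that by simp
    next
      case 2
      then show ?thesis
        using vertex_pairing_negative(1)[of b a] that by (simp add: mink_commute[of "u a" "u b"])
    next
      case 3
      have "mink (u a) (u b) \<le> 0"
        using 3 ideal_vertex future_light_cone by (intro mink_future_le(1)) auto
      moreover have "mink (u a) (u b) \<noteq> 0"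
      proof
        assume "mink (u a) (u b) = 0"
        then have "u b \<in> span {u a}"
          using lightlike_orthogonal_imp_parallel ideal_vertex 3 by blast
        also have "\<dots> \<subseteq> span (range u - {u b})"
          using that inj_eq[OF ind(1), of a b] by (intro span_mono) auto
        finally show False
          using ind(2) by (auto simp: dependent_def)
      qed
      ultimately show ?thesis
        by simp
    qed
  qed
  have le: "mink (u a) (u b) \<le> -1" if "a \<noteq> b" "mink (u a) (u a) = 1" "mink (u b) (u b) = 1" for a b
  proof -
    have "a \<notin> I" "b \<notin> I"
      using that norm[of a] norm[of b] by (auto split: if_splits)
    then show ?thesis
      using vertex_pairing_negative(2)[of a b] that(1) by simp
  qed
  show ?thesis
    unfolding vertex_family_def using span_vertices norm neg le by simp
qed

lemma vertex_norm: "mink (u a) (u a) = 0 \<longleftrightarrow> a \<in> I"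
  using unit[of a] ideal_vertex[of a] by (cases "a \<in> I") (auto simp: light_cone_def)

lemma corner_ray:
  assumes k: "k \<notin> I" and kl: "l \<noteq> k"
  obtains t where "t > 0" "u l - mink (u k) (u l) *\<^sub>R u k = t *\<^sub>R e (corner k l)"
proof -
  obtain t where t: "t \<noteq> 0" "u l - mink (u k) (u l) *\<^sub>R u k = t *\<^sub>R e (corner k l)"
    by (rule corner_line_nonzero[OF assms])
  define x where "x = e (\<chi> i. 1/4)"
  have x: "x \<in> hyp3" "(\<chi> i. 1/4) \<in> ptt I Z"
    using open_hyp3 centre_in_open_model open_subset_ptt by (auto simp: x_def)
  have xk: "mink x (u k) \<le> 0"
    unfolding x_def by (rule side[OF k x(2)])
  have xl: "mink x (u l) \<le> 0"
  proof (cases "l \<in> I")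
    case True
    show ?thesis
      by (rule mink_future_le(1)[OF future_hyp3[OF x(1)] future_light_cone[OF ideal_vertex[OF True]]])
  next
    case False
    then show ?thesis
      unfolding x_def by (rule side[OF _ x(2)])
  qed
  have "mink (u k) (u l) * mink x (u k) \<ge> 0"
    using vertex_pairing_negative(1)[OF assms] xk by (simp add: mult_nonpos_nonpos)
  then have "t * mink x (e (corner k l)) \<le> 0"
    using xl arg_cong[OF t(2), of "mink x"] by (simp add: mink_linear)
  moreover have "mink x (e (corner k l)) < 0"
    by (rule mink_future_le(2)[OF future_hyp3[OF x(1)] closed_future[OF corner_closed[OF assms]]])
      (use x(1) in \<open>simp add: hyp3_def\<close>)
  ultimately have "t > 0"
    using t(1) by (simp add: mult_le_0_iff)
  then show ?thesis
    using that t(2) by blast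
qed

lemma corner_rays_vertices:
  assumes "q \<in> corner_rays (range u)"
  obtains r x where "r > 0" "x \<in> corners I" "q = r *\<^sub>R e x"
proof -
  consider k where "q = u k" "mink (u k) (u k) = 0"
    | k l where "q = u l - mink (u k) (u l) *\<^sub>R u k" "u k \<noteq> u l" "mink (u k) (u k) \<noteq> 0"
    using assms unfolding corner_rays_def by blast
  then show ?thesis
  proof cases
    case (1 k)
    then have "k \<in> I"
      by (simp add: vertex_norm)
    then show ?thesis
      using ideal[of k] that 1(1) unfolding corners_eq by blast
  next
    case (2 k l)
    then have k: "k \<notin> I" "l \<noteq> k"
      using vertex_norm by auto
    obtain t where "t > 0" "u l - mink (u k) (u l) *\<^sub>R u k = t *\<^sub>R e (corner k l)"
      by (rule corner_ray[OF k])
    then show ?thesis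
      using that 2(1) k unfolding corners_eq by blast
  qed
qed

lemma face_span_eq: "face_span i = span (u ` (- {i}))"
proof (rule sym, rule subspace_dim_equal[OF subspace_span subspace_face_span])
  show "span (u ` (- {i})) \<subseteq> face_span i"
    using vertex_in_face_span by (intro span_minimal subspace_face_span) auto
  note ind = spanning_four_independent[OF span_vertices]
  have "independent (u ` (- {i}))"
    by (rule independent_mono[OF ind(2)]) auto
  then have "dim (u ` (- {i})) = card (u ` (- {i}))"
    by (rule dim_eq_card_independent)
  also have "\<dots> = card (- {i})"
    by (rule card_image) (rule inj_on_subset[OF ind(1)], simp)
  also have "\<dots> = 3"
    by (simp add: Compl_eq_Diff_UNIV card_Diff_singleton)
  finally show "dim (face_span i) \<le> dim (span (u ` (- {i})))"
    by (simp add: dim_face_span)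
qed

text \<open>The span of a face is spanned by its corners, by definition of a realization.\<close>

lemma face_in_span_corner_rays: "u ` (- {i}) \<subseteq> span (corner_rays (u ` (- {i})))"
proof -
  have "e x \<in> span (corner_rays (u ` (- {i})))" if x: "x \<in> corners I \<inter> lateral i" for x
  proof -
    have "x \<in> corners I" "x $ i = 0"
      using x by (auto simp: lateral_def)
    then consider k where "k \<in> I" "x = axis k 1" | k j where "k \<notin> I" "j \<noteq> k" "x = corner k j"
      unfolding corners_eq by blast
    then show ?thesis
    proof cases
      case (1 k)
      have "k \<noteq> i"
        using 1 \<open>x $ i = 0\<close> by auto
      then have "u k \<in> corner_rays (u ` (- {i}))"
        using 1 vertex_norm[of k] by (auto simp: corner_rays_def)
      moreover obtain c where "c > 0" "u k = c *\<^sub>R e x"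
        using ideal 1 by blast
      then have "e x = (1 / c) *\<^sub>R u k"
        by simp
      ultimately show ?thesis
        by (simp add: span_mul span_base)
    next
      case (2 k j)
      have ki: "k \<noteq> i" "j \<noteq> i"
        using 2 \<open>x $ i = 0\<close> by (auto simp: corner_nth split: if_splits)
      have "u k \<noteq> u j"
        using spanning_four_independent(1)[OF span_vertices] 2(2) by (auto dest: injD)
      then have q: "u j - mink (u k) (u j) *\<^sub>R u k \<in> corner_rays (u ` (- {i}))"
        using ki 2(1) vertex_norm[of k] unfolding corner_rays_def by blast
      obtain t where t: "t > 0" "u j - mink (u k) (u j) *\<^sub>R u k = t *\<^sub>R e (corner k j)"
        by (rule corner_ray[OF 2(1,2)])
      then have "e x = (1 / t) *\<^sub>R (u j - mink (u k) (u j) *\<^sub>R u k)"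
        using 2(3) by simp
      then show ?thesis
        using q by (simp only:) (intro span_mul span_base)
    qed
  qed
  then have "span (e ` (corners I \<inter> lateral i)) \<subseteq> span (corner_rays (u ` (- {i})))"
    by (intro span_minimal) auto
  moreover have "face_span i = span (e ` (corners I \<inter> lateral i))"
    unfolding face_span_def by (rule geodesic_span) (use realization(7) in blast)
  ultimately have "face_span i \<subseteq> span (corner_rays (u ` (- {i})))"
    by simp
  then show ?thesis
    using vertex_in_face_span by blast
qed

text \<open>The realization is the convex hull of its corners, hence it fills the cone over the
  corner rays. Positivity of the dual coordinates excludes the lateral faces.\<close>

lemma conic_combination_in_cell:
  assumes \<nu>: "\<And>a b. mink (\<nu> a) (u b) = (if a = b then 1 else 0)"
    and c: "\<And>q. q \<in> corner_rays (range u) \<Longrightarrow> c q \<ge> 0"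
    and y: "y = (\<Sum>q\<in>corner_rays (range u). c q *\<^sub>R q)"
    and pos: "\<And>m. mink (\<nu> m) y > 0"
  obtains x r where "x \<in> open_model I" "r > 0" "y = r *\<^sub>R e x"
proof -
  let ?Q = "corner_rays (range u)"
  let ?K = "klein ` e ` closed_model I"
  have hull: "?K = convex hull (klein ` e ` corners I)"
    using realization(6) by (simp add: geodesic_image_def)
  have Q: "klein q \<in> ?K \<and> q $ 0 > 0" if q: "q \<in> ?Q" for q
  proof -
    obtain r x where r: "r > 0" "x \<in> corners I" "q = r *\<^sub>R e x"
      by (rule corner_rays_vertices[OF q])
    then have x: "x \<in> closed_model I"
      using corners_subset_closed by blast
    then show ?thesis
      using r closed_time_positive[OF x] by (auto simp: klein_scale)
  qed
  have "y \<noteq> 0"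
    using pos[of 0] by (auto simp: mink_linear)
  then have nz: "(\<Sum>q\<in>?Q. c q *\<^sub>R q) \<noteq> 0"
    using y by simp
  have fin: "finite ?Q"
    by (rule finite_corner_rays) simp
  have conv: "convex ?K"
    unfolding hull by (rule convex_convex_hull)
  have "klein y \<in> ?K" "y $ 0 > 0"
    unfolding y by (rule klein_conic_combination[OF fin c Q conv nz]; assumption)+
  then obtain x where x: "x \<in> closed_model I" "klein y = klein (e x)"
    by blast
  then obtain r where r: "r > 0" "y = r *\<^sub>R e x"
    using klein_eq_iff_positive_multiple[OF \<open>y $ 0 > 0\<close> closed_time_positive[OF x(1)]] by blast
  have "x $ m > 0" for m
  proof (rule ccontr)
    assume "\<not> x $ m > 0"
    moreover have "0 \<le> x $ m"
      using x(1) by (simp add: closed_model_def std_simplex_def)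
    ultimately have "x $ m = 0"
      by simp
    then have "e x \<in> span (u ` (- {m}))"
      using closed_lateral_in_face_span[OF x(1)] unfolding face_span_eq by blast
    then have "mink (\<nu> m) (e x) = 0"
      by (rule mink_zero_on_span[rotated]) (auto simp: \<nu> split: if_splits)
    then show False
      using pos[of m] r(2) by (simp add: mink_linear)
  qed
  then have "x \<in> open_model I"
    using x(1) by (simp add: open_model_def)
  then show ?thesis
    using that r by blast
qed

end

section \<open>Deck transformations\<close>

text \<open>The difference of two points is orthogonal to their sum, which is timelike.\<close>

lemma hyp3_distinct_spacelike:
  assumes "x \<in> hyp3" "y \<in> hyp3" "x \<noteq> y"
  shows "mink x y < -1"
proof -
  have n: "mink x x = -1" "mink y y = -1"
    using assms by (auto simp: hyp3_def)
  have m: "mink x y < 0"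
    by (rule mink_future_le(2)[OF future_hyp3[OF assms(1)] future_hyp3[OF assms(2)]]) (simp add: n)
  have "mink (x + y) (x + y) < 0"
    using m n by (simp add: mink_linear mink_commute[of y x])
  moreover have "mink (x + y) (x - y) = 0"
    using n by (simp add: mink_linear mink_commute[of y x])
  ultimately have "mink (x - y) (x - y) > 0"
    using assms(3) by (intro orthogonal_timelike_imp_spacelike[of "x + y"]) auto
  then show ?thesis
    using n by (simp add: mink_linear mink_commute[of y x])
qed

lemma hyp_convex_midpoint:
  assumes "hyp_convex S" "x \<in> S" "y \<in> S"
  shows "(1 / sqrt (- mink (x + y) (x + y))) *\<^sub>R (x + y) \<in> S"
proof -
  have S: "S \<subseteq> hyp3" "convex (klein ` S)"
    using assms(1) by (auto simp: hyp_convex_def)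
  have xy: "x \<in> hyp3" "y \<in> hyp3"
    using S assms by auto
  have pos: "x $ 0 > 0" "y $ 0 > 0"
    using xy by (auto simp: hyp3_def)
  have n: "mink x x = -1" "mink y y = -1"
    using xy by (auto simp: hyp3_def)
  have m: "mink x y \<le> 0"
    by (rule mink_future_le(1)[OF future_hyp3[OF xy(1)] future_hyp3[OF xy(2)]])
  have neg: "mink (x + y) (x + y) < 0"
    using n m by (simp add: mink_linear mink_commute[of y x])
  define z where "z = (1 / sqrt (- mink (x + y) (x + y))) *\<^sub>R (x + y)"
  have z: "z \<in> hyp3"
    unfolding z_def by (rule timelike_normalize[OF future_add[OF future_hyp3[OF xy(1)] future_hyp3[OF xy(2)]] neg])
  have "klein z = klein (x + y)"
    unfolding z_def by (rule klein_scale) (use neg in auto)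
  also have "\<dots> = (x $ 0 / (x $ 0 + y $ 0)) *\<^sub>R klein x + (y $ 0 / (x $ 0 + y $ 0)) *\<^sub>R klein y"
  proof -
    have "x $ 0 / (x $ 0 + y $ 0) * inverse (x $ 0) = inverse (x $ 0 + y $ 0)"
      "y $ 0 / (x $ 0 + y $ 0) * inverse (y $ 0) = inverse (x $ 0 + y $ 0)"
      using pos by (simp_all add: field_simps)
    then show ?thesis
      by (simp add: klein_def scaleR_add_right)
  qed
  also have "\<dots> \<in> klein ` S"
    by (rule convexD[OF S(2)]) (use assms pos in \<open>auto simp: add_divide_distrib[symmetric]\<close>)
  finally obtain w where "w \<in> S" "klein z = klein w"
    by blast
  then have "z = w"
    using klein_inj_hyp3 z S(1) by (auto dest: inj_onD)
  then show ?thesis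
    using \<open>w \<in> S\<close> by (simp add: z_def)
qed

lemma closed_hyp3: "closed hyp3"
proof -
  have nz: "x $ 0 \<noteq> 0" if "mink x x = -1" for x :: "real^4"
  proof
    assume "x $ 0 = 0"
    then have "mink x x = (x $ 1)\<^sup>2 + (x $ 2)\<^sup>2 + (x $ 3)\<^sup>2"
      by (simp add: mink_self)
    then show False
      using that zero_le_power2[of "x $ 1"] zero_le_power2[of "x $ 2"] zero_le_power2[of "x $ 3"]
      by linarith
  qed
  have eq: "hyp3 = {x :: real^4. mink x x = -1} \<inter> {x :: real^4. x $ 0 \<ge> 0}"
    using nz by (auto simp: hyp3_def less_le)
  show ?thesis
    unfolding eq by (intro closed_Int closed_Collect_eq closed_Collect_le continuous_intros)
qed

text \<open>These are metric balls with centre \<open>y\<close>.\<close>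

lemma bounded_hyp3_slice:
  assumes y: "y \<in> hyp3"
  shows "bounded {x \<in> hyp3. mink y x \<ge> c}"
proof -
  define s where "s x = sqrt ((x $ 1)\<^sup>2 + (x $ 2)\<^sup>2 + (x $ 3)\<^sup>2)" for x :: "real^4"
  have s: "(s x)\<^sup>2 = (x $ 0)\<^sup>2 - 1" "0 \<le> s x" "s x < x $ 0" if "x \<in> hyp3" for x
  proof -
    show 1: "(s x)\<^sup>2 = (x $ 0)\<^sup>2 - 1" "0 \<le> s x"
      using that by (simp_all add: s_def hyp3_def mink_self)
    have "(s x)\<^sup>2 < (x $ 0)\<^sup>2"
      using 1 by simp
    then show "s x < x $ 0"
      by (rule power2_less_imp_less) (use that in \<open>simp add: hyp3_def\<close>)
  qed
  define d where "d = y $ 0 - s y"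
  have "d > 0"
    using s(3)[OF y] by (simp add: d_def)
  have bound: "x $ 0 \<le> - c / d" if x: "x \<in> hyp3" "mink y x \<ge> c" for x
  proof -
    have "(y $ 1 * x $ 1 + y $ 2 * x $ 2 + y $ 3 * x $ 3)\<^sup>2 \<le> (s y * s x)\<^sup>2"
      using spatial_cauchy[of "y $ 1" "x $ 1" "y $ 2" "x $ 2" "y $ 3" "x $ 3"]
      by (simp add: s_def power_mult_distrib)
    then have "y $ 1 * x $ 1 + y $ 2 * x $ 2 + y $ 3 * x $ 3 \<le> s y * s x"
      by (rule power2_le_imp_le) (use s(2)[OF y] s(2)[OF x(1)] in simp)
    also have "\<dots> \<le> s y * x $ 0"
      using s[OF x(1)] s(2)[OF y] by (intro mult_left_mono) auto
    finally have "c \<le> - d * x $ 0"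
      using x(2) by (simp add: mink_def d_def algebra_simps)
    then show ?thesis
      using \<open>d > 0\<close> by (simp add: field_simps)
  qed
  have "norm x \<le> 2 * (- c / d)" if x: "x \<in> hyp3" "mink y x \<ge> c" for x
  proof -
    have pos: "- 1 \<le> 2 * (x $ 0)\<^sup>2"
      using zero_le_power2[of "x $ 0"] by linarith
    have "(norm x)\<^sup>2 = (x $ 0)\<^sup>2 + (s x)\<^sup>2"
      by (simp add: norm_vec_def L2_set_def sum_four s_def)
    also have "\<dots> \<le> (2 * x $ 0)\<^sup>2"
      using s(1)[OF x(1)] pos by (simp add: power_mult_distrib)
    finally have "norm x \<le> 2 * x $ 0"
      by (rule power2_le_imp_le) (use x(1) in \<open>simp add: hyp3_def\<close>)
    then show ?thesis
      using bound[OF x] by simp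
  qed
  then show ?thesis
    unfolding bounded_iff by blast
qed

text \<open>A larger product with \<open>y\<close> means a smaller distance from \<open>y\<close>.
  Uniqueness holds because the midpoint of two nearest points would be nearer.\<close>

lemma nearest_point_unique:
  assumes "hyp_convex S" "closed S" "S \<noteq> {}" "y \<in> hyp3"
  obtains x where "x \<in> S" "\<And>z. z \<in> S \<Longrightarrow> mink y z \<ge> mink y x \<Longrightarrow> z = x"
proof -
  have S: "S \<subseteq> hyp3"
    using assms(1) by (simp add: hyp_convex_def)
  obtain x1 where x1: "x1 \<in> S"
    using assms(3) by blast
  define K where "K = S \<inter> {x \<in> hyp3. mink y x \<ge> mink y x1}"
  have K: "K = S \<inter> {x. mink y x1 \<le> mink y x}"
    using S by (auto simp: K_def)
  have "closed {x. mink y x1 \<le> mink y x}"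
    by (intro closed_Collect_le continuous_intros)
  then have "closed K"
    unfolding K using assms(2) by (rule closed_Int[rotated])
  moreover have "bounded K"
    by (rule bounded_subset[OF bounded_hyp3_slice[OF assms(4)]]) (auto simp: K_def)
  ultimately have "compact K"
    by (simp add: compact_eq_bounded_closed)
  moreover have "x1 \<in> K"
    using x1 by (simp add: K)
  moreover have "continuous_on K (mink y)"
    by (intro continuous_intros)
  ultimately obtain x where x: "x \<in> K" "\<And>z. z \<in> K \<Longrightarrow> mink y z \<le> mink y x"
    using continuous_attains_sup[of K "mink y"] by auto
  have max: "mink y z \<le> mink y x" if "z \<in> S" for z
    using x that by (cases "z \<in> K") (auto simp: K)
  have "z = x" if z: "z \<in> S" "mink y z \<ge> mink y x" for z
  proof (rule ccontr)
    assume "z \<noteq> x"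
    have eq: "mink y z = mink y x"
      using z max by (simp add: antisym)
    have h: "z \<in> hyp3" "x \<in> hyp3"
      using z x S by (auto simp: K)
    have M: "mink y x < 0"
      by (rule mink_future_le(2)[OF future_hyp3[OF assms(4)] future_hyp3[OF h(2)]])
        (use assms(4) in \<open>simp add: hyp3_def\<close>)
    define r where "r = sqrt (- mink (z + x) (z + x))"
    have "- mink (z + x) (z + x) > 4"
      using hyp3_distinct_spacelike[OF h \<open>z \<noteq> x\<close>] h
      by (simp add: mink_linear mink_commute[of x z] hyp3_def)
    then have "sqrt (- mink (z + x) (z + x)) > sqrt 4"
      by (rule real_sqrt_less_mono)
    then have r: "r > 2"
      by (simp add: r_def)
    have "(1 / r) *\<^sub>R (z + x) \<in> S"
      unfolding r_def using x z by (intro hyp_convex_midpoint[OF assms(1)]) (auto simp: K)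
    then have "mink y ((1 / r) *\<^sub>R (z + x)) \<le> mink y x"
      by (rule max)
    then have "2 * mink y x / r \<le> mink y x"
      by (simp add: mink_linear eq)
    then have "2 * mink y x \<le> mink y x * r"
      using r by (simp add: divide_le_eq)
    then show False
      using M r by simp
  qed
  then show ?thesis
    using that x by (auto simp: K)
qed

lemma convex_region_closed: "convex_region Nt \<Longrightarrow> closed Nt"
  unfolding convex_region_def using closed_hyp3 closedin_closed_trans by blast

lemma hyp_convex_connected:
  assumes "hyp_convex S"
  shows "connected S"
proof -
  have S: "S \<subseteq> hyp3" "convex (klein ` S)"
    using assms by (auto simp: hyp_convex_def)
  have "continuous_on (klein ` S) (\<lambda>y. (1 / sqrt (- mink y y)) *\<^sub>R y)"
    by (intro continuous_intros) (use S(1) mink_klein_neg in force)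
  then have "connected ((\<lambda>y. (1 / sqrt (- mink y y)) *\<^sub>R y) ` klein ` S)"
    using connected_continuous_image convex_connected[OF S(2)] by blast
  moreover have "(\<lambda>y. (1 / sqrt (- mink y y)) *\<^sub>R y) ` klein ` S = S"
    unfolding image_image using S(1) klein_hyp3_inverse by force
  ultimately show ?thesis
    by simp
qed

lemma matrix_eq_on_spanning:
  fixes A B :: "real^4^4"
  assumes "span S = UNIV" "\<And>x. x \<in> S \<Longrightarrow> A *v x = B *v x"
  shows "A = B"
proof -
  have "A *v x = B *v x" for x
    by (rule linear_eq_on_span[of "(*v) A" "(*v) B" S])
      (use assms in \<open>auto simp: matrix_vector_mul_linear\<close>)
  then show ?thesis
    by (simp add: matrix_eq)
qed

text \<open>Two lifts through the covering that agree at one point agree on a connected set. If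
  its image spans the space, the two matrices are equal.\<close>

lemma lifts_agree:
  fixes A B :: "real^4^4"
  assumes cov: "covering_space Nt p N"
    and S: "connected S" "continuous_on S e" "span (e ` S) = UNIV"
    and A: "\<And>x. x \<in> S \<Longrightarrow> A *v e x \<in> Nt" and B: "\<And>x. x \<in> S \<Longrightarrow> B *v e x \<in> Nt"
    and eq: "\<And>x. x \<in> S \<Longrightarrow> p (A *v e x) = p (B *v e x)"
    and a: "a \<in> S" "A *v e a = B *v e a"
  shows "A = B"
proof (rule matrix_eq_on_spanning[OF S(3)])
  have cont: "continuous_on S (\<lambda>x. M *v e x)" for M :: "real^4^4"
    by (rule bounded_linear.continuous_on[OF _ S(2)]) (simp add: matrix_vector_mul_bounded_linear)
  have p: "continuous_on Nt p" "p ` Nt = N"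
    using cov by (auto simp: covering_space_def)
  have "A *v e x = B *v e x" if x: "x \<in> S" for x
  proof (rule covering_space_lift_unique[where f = "\<lambda>x. p (A *v e x)" and T = S and a = a and
        ?g1.0 = "\<lambda>x. A *v e x" and ?g2.0 = "\<lambda>x. B *v e x" and x = x, OF cov])
    show "continuous_on S (\<lambda>x. p (A *v e x))"
      by (rule continuous_on_compose2[OF p(1) cont]) (use A in auto)
    show "(\<lambda>x. p (A *v e x)) \<in> S \<rightarrow> N"
      using p(2) A by blast
    show "continuous_on S (\<lambda>x. A *v e x)" "continuous_on S (\<lambda>x. B *v e x)"
      by (rule cont)+
    show "(\<lambda>x. A *v e x) \<in> S \<rightarrow> Nt" "(\<lambda>x. B *v e x) \<in> S \<rightarrow> Nt"
      using A B by blast+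
    show "A *v e a = B *v e a" "connected S" "a \<in> S" "x \<in> S"
      by (rule a S x)+
    show "p (A *v e z) = p (B *v e z)" if "z \<in> S" for z
      by (rule eq[OF that])
  qed simp
  then show "A *v y = B *v y" if "y \<in> e ` S" for y
    using that by auto
qed

lemma deck_isometry: "A \<in> deck Nt p \<Longrightarrow> hyp_isometry A"
  by (simp add: deck_def)

text \<open>The fixed point need not lie in the region, but the point of the region nearest to it
  is fixed as well. There the transformation agrees with the identity as a lift of the
  covering.\<close>

lemma deck_fixing_point_trivial:
  assumes cov: "universal_cover N Nt p" and sp: "span Nt = UNIV"
    and A: "A \<in> deck Nt p" and y: "y \<in> hyp3" "A *v y = y"
  shows "A = mat 1"
proof -
  have reg: "convex_region Nt" "covering_space Nt p N"
    using cov by (auto simp: universal_cover_def)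
  have conv: "hyp_convex Nt"
    using reg(1) by (simp add: convex_region_def)
  have A': "(*v) A ` Nt = Nt" "\<And>x. x \<in> Nt \<Longrightarrow> p (A *v x) = p x"
    using A by (auto simp: deck_def)
  have "Nt \<noteq> {}"
    using sp by auto
  obtain x where x: "x \<in> Nt" "\<And>z. z \<in> Nt \<Longrightarrow> mink y z \<ge> mink y x \<Longrightarrow> z = x"
    by (rule nearest_point_unique[OF conv convex_region_closed[OF reg(1)] \<open>Nt \<noteq> {}\<close> y(1)])
      (rule that; assumption)
  have "mink y (A *v x) = mink y x"
    using hyp_isometry_mink[OF deck_isometry[OF A], of y x] y(2) by simp
  moreover have "A *v x \<in> Nt"
    using x(1) A'(1) by blast
  ultimately have "A *v x = x"
    using x(2) by simp
  moreover have "A *v z \<in> Nt" if "z \<in> Nt" for z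
    using A'(1) that by blast
  ultimately show ?thesis
    using A'(2) x(1) sp
    by (intro lifts_agree[OF reg(2) hyp_convex_connected[OF conv], where e = "\<lambda>x. x" and a = x])
      simp_all
qed

section \<open>Lifted tetrahedra\<close>

lemma corner_rays_image:
  fixes A :: "real^4^4"
  assumes A: "\<And>x y. mink (A *v x) (A *v y) = mink x y"
  shows "corner_rays ((*v) A ` V) = (*v) A ` corner_rays V"
proof -
  have inj: "A *v x = A *v y \<longleftrightarrow> x = y" for x y
  proof
    assume e: "A *v x = A *v y"
    have "x - y = 0"
    proof (rule mink_nondegenerate)
      show "mink (x - y) z = 0" for z
        using A[of x z] A[of y z] e by (simp add: mink_linear)
    qed
    then show "x = y"
      by simp
  qed simp
  have d: "A *v (y - mink x y *\<^sub>R x) = A *v y - mink (A *v x) (A *v y) *\<^sub>R (A *v x)" for x y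
    by (simp add: A matrix_vector_mult_diff_distrib matrix_vector_mult_scaleR)
  show ?thesis
  proof (intro subset_antisym subsetI)
    fix q assume "q \<in> corner_rays ((*v) A ` V)"
    then consider x' where "x' \<in> (*v) A ` V" "q = x'" "mink x' x' = 0"
      | x' y' where "x' \<in> (*v) A ` V" "y' \<in> (*v) A ` V" "x' \<noteq> y'" "mink x' x' \<noteq> 0"
          "q = y' - mink x' y' *\<^sub>R x'"
      unfolding corner_rays_def by blast
    then show "q \<in> (*v) A ` corner_rays V"
    proof cases
      case (1 x')
      then obtain x where "x \<in> V" "x' = A *v x"
        by blast
      with 1 have "x \<in> corner_rays V" "q = A *v x"
        by (simp_all add: corner_rays_def A)
      then show ?thesis
        by blast
    next
      case (2 x' y')
      then obtain x y where xy: "x \<in> V" "x' = A *v x" "y \<in> V" "y' = A *v y"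
        by blast
      have "x \<noteq> y" "mink x x \<noteq> 0"
        using 2 xy A[of x x] by auto
      then have "y - mink x y *\<^sub>R x \<in> corner_rays V"
        unfolding corner_rays_def using xy by blast
      then show ?thesis
        unfolding 2(5) xy(2,4) d[symmetric] by blast
    qed
  next
    fix q assume "q \<in> (*v) A ` corner_rays V"
    then consider x where "x \<in> V" "q = A *v x" "mink x x = 0"
      | x y where "x \<in> V" "y \<in> V" "x \<noteq> y" "mink x x \<noteq> 0" "q = A *v (y - mink x y *\<^sub>R x)"
      unfolding corner_rays_def by blast
    then show "q \<in> corner_rays ((*v) A ` V)"
    proof cases
      case (1 x)
      then show ?thesis
        by (simp add: corner_rays_def A)
    next
      case (2 x y)
      then have "A *v x \<in> (*v) A ` V" "A *v y \<in> (*v) A ` V" "A *v x \<noteq> A *v y" "mink (A *v x) (A *v x) \<noteq> 0"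
        by (auto simp: inj A)
      then show ?thesis
        unfolding 2(5) d corner_rays_def by blast
    qed
  qed
qed

text \<open>In the vertex basis the corner rays have nonnegative coordinates, because the product
  of two vertices is negative.\<close>

lemma corner_rays_dual_nonneg:
  assumes v: "vertex_family v" and \<nu>: "\<And>a b. mink (\<nu> a) (v b) = (if a = b then 1 else 0)"
    and q: "q \<in> corner_rays (range v)"
  shows "mink (\<nu> m) q \<ge> 0"
proof -
  consider k where "q = v k" | k l where "q = v l - mink (v k) (v l) *\<^sub>R v k" "v k \<noteq> v l"
    using q unfolding corner_rays_def by blast
  then show ?thesis
  proof cases
    case (2 k l)
    then have "k \<noteq> l"
      by auto
    then have "mink (v k) (v l) < 0" "k \<noteq> l"
      using v by (simp_all add: vertex_family_def)
    then show ?thesis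
      unfolding 2(1) by (simp add: mink_linear \<nu>)
  qed (simp add: \<nu>)
qed

lemma corner_rays_dual_pos:
  assumes v: "vertex_family v" and \<nu>: "\<And>a b. mink (\<nu> a) (v b) = (if a = b then 1 else 0)"
  shows "mink (\<nu> m) (\<Sum>q\<in>corner_rays (range v). q) > 0"
proof -
  obtain q where q: "q \<in> corner_rays (range v)" "mink (\<nu> m) q > 0"
  proof (cases "mink (v m) (v m) = 0")
    case True
    then show ?thesis
      by (intro that[of "v m"]) (auto simp: corner_rays_def \<nu>)
  next
    case False
    obtain l where l: "l \<noteq> m"
      using other_index by blast
    then have neg: "mink (v m) (v l) < 0"
      using v unfolding vertex_family_def by auto
    have "v m \<noteq> v l"
      using \<nu>[of m m] \<nu>[of m l] l by auto
    then have "v l - mink (v m) (v l) *\<^sub>R v m \<in> corner_rays (range v)"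
      unfolding corner_rays_def using False by blast
    moreover have "mink (\<nu> m) (v l - mink (v m) (v l) *\<^sub>R v m) > 0"
      using l neg by (simp add: mink_linear \<nu>)
    ultimately show ?thesis
      by (rule that)
  qed
  have "finite (corner_rays (range v))"
    by (rule finite_corner_rays) simp
  then show ?thesis
    unfolding mink_sum_right using q corner_rays_dual_nonneg[OF v \<nu>] by (intro sum_pos2[of _ q]) auto
qed

locale lifted_triangulation =
  fixes N :: "'n::metric_space set" and Nt :: "(real^4) set" and p :: "real^4 \<Rightarrow> 'n"
    and T :: "'t triangulation" and e :: "'t \<Rightarrow> real^4 \<Rightarrow> real^4" and f :: "'t \<Rightarrow> real^4 \<Rightarrow> 'n"
    and \<O> :: "'n set set"
  assumes tri: "geometric_triangulation N T e f"
    and cover: "universal_cover N Nt p"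
    and cusps: "horospherical_cross_section Nt p \<O>"
begin

text \<open>The lifts of \<open>\<sigma>\<close> are given by matrices. Keeping track of the
  matrix \<open>A\<close>, and not only of the resulting tetrahedron, allows uniqueness of lifts
  to be used.\<close>

definition lift :: "'t \<Rightarrow> real^4^4 \<Rightarrow> (4 \<Rightarrow> real^4) \<Rightarrow> bool" where
  "lift \<sigma> A v \<longleftrightarrow> \<sigma> \<in> tetrahedra T \<and> lifted_vertices T e f Nt p \<O> \<sigma> A v"

lemmas abstract = tri[unfolded geometric_triangulation_def, THEN conjunct1]
lemmas realized = tri[unfolded geometric_triangulation_def, THEN conjunct2, THEN conjunct1, rule_format]
lemmas gluing = tri[unfolded geometric_triangulation_def, THEN conjunct2, THEN conjunct2, THEN conjunct2,
  THEN conjunct2, THEN conjunct1, rule_format]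
lemmas labelled = abstract[unfolded abstract_triangulation_def, THEN conjunct2, THEN conjunct1, rule_format]
lemmas unique_cusp = cusps[unfolded horospherical_cross_section_def, THEN conjunct2, THEN conjunct2,
  THEN conjunct2, THEN conjunct1, rule_format]
lemmas cusp_in_region = cusps[unfolded horospherical_cross_section_def, THEN conjunct2, THEN conjunct2,
  THEN conjunct2, THEN conjunct2, THEN conjunct1, rule_format]

lemma region: "convex_region Nt" "covering_space Nt p N" "Nt \<subseteq> hyp3"
  using cover by (auto simp: universal_cover_def convex_region_def hyp_convex_def)

lemma lift_isometry: "lift \<sigma> A v \<Longrightarrow> hyp_isometry A"
  and lift_mink: "lift \<sigma> A v \<Longrightarrow> mink (A *v x) (A *v y) = mink x y"
  by (simp_all add: lift_def lifted_vertices_def hyp_isometry_mink)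

lemma lift_cell:
  assumes "lift \<sigma> A v" "x \<in> ptt (ideals T \<sigma>) (zero_edges T \<sigma>)"
  shows "A *v e \<sigma> x \<in> Nt" "p (A *v e \<sigma> x) = f \<sigma> (e \<sigma> x)"
proof -
  have "e \<sigma> x \<in> cell T e \<sigma> UNIV"
    using assms(2) by (auto simp: cell_def)
  then show "A *v e \<sigma> x \<in> Nt" "p (A *v e \<sigma> x) = f \<sigma> (e \<sigma> x)"
    using assms(1) by (auto simp: lift_def lifted_vertices_def)
qed

lemma lifted_cusp_light_cone: "u \<in> lifted_cusps Nt p \<O> \<Longrightarrow> u \<in> light_cone"
  by (simp add: lifted_cusps_def toric_rays_def)

lemma lift_truncation:
  assumes "lift \<sigma> A v" "k \<notin> ideals T \<sigma>" "x \<in> ptt (ideals T \<sigma>) (zero_edges T \<sigma>)" "x $ k = 3/4"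
  shows "mink (A *v e \<sigma> x) (v k) = 0"
proof -
  have "e \<sigma> x \<in> cell T e \<sigma> (truncation k)"
    using assms(3,4) by (auto simp: cell_def truncation_def)
  moreover have "(*v) A ` cell T e \<sigma> (truncation k) \<subseteq> plane (v k)"
    using assms(1,2) by (simp add: lift_def lifted_vertices_def)
  ultimately have "A *v e \<sigma> x \<in> plane (v k)"
    by blast
  then show ?thesis
    by (simp add: plane_def)
qed

lemma lift_realization:
  assumes l: "lift \<sigma> A v"
  obtains u where "marked_realization (ideals T \<sigma>) (zero_edges T \<sigma>) (e \<sigma>) u" "\<forall>k. v k = A *v u k"
proof -
  let ?I = "ideals T \<sigma>" and ?Z = "zero_edges T \<sigma>"
  obtain B where B: "hyp_isometry B" "A ** B = mat 1" "B ** A = mat 1"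
    by (rule hyp_isometry_inverse[OF lift_isometry[OF l]])
  have AB: "A *v (B *v x) = x" "B *v (A *v x) = x" for x
    using B by (simp_all add: matrix_vector_mul_assoc)
  define u where "u k = B *v v k" for k
  have v: "v k = A *v u k" for k
    by (simp add: u_def AB)
  have dual: "v k \<in> dual_vectors Nt" if "k \<notin> ?I" for k
    using l that by (simp add: lift_def lifted_vertices_def)
  have uA: "mink x (u k) = mink (A *v x) (v k)" for x k
    by (simp add: v lift_mink[OF l])
  have \<sigma>: "\<sigma> \<in> tetrahedra T"
    using l by (simp add: lift_def)
  have "marked_realization ?I ?Z (e \<sigma>) u"
  proof
    show "ptt_data ?I ?Z"
      by (rule labelled[OF \<sigma>])
    show geom: "geometric_realization ?I ?Z (e \<sigma>)"
      by (rule realized[OF \<sigma>])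
    show "mink (u k) (u k) = 1" if "k \<notin> ?I" for k
      using dual[OF that] unfolding uA v[symmetric] by (simp add: dual_vectors_def de_sitter_def)
    show "mink (e \<sigma> x) (u k) = 0" if "k \<notin> ?I" "x \<in> ptt ?I ?Z" "x $ k = 3/4" for k x
      unfolding uA by (rule lift_truncation[OF l that])
    show "mink (e \<sigma> x) (u k) \<le> 0" if "k \<notin> ?I" "x \<in> ptt ?I ?Z" for k x
      using dual[OF that(1)] lift_cell(1)[OF l that(2)]
      unfolding uA by (auto simp: dual_vectors_def half_space_def)
    show "\<exists>c>0. u k = c *\<^sub>R e \<sigma> (axis k 1)" if k: "k \<in> ?I" for k
    proof -
      have vk: "v k \<in> light_cone" "klein (v k) = klein (A *v e \<sigma> (axis k 1))"
        using l k lifted_cusp_light_cone by (auto simp: lift_def lifted_vertices_def)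
      have "axis k 1 \<in> missing ?I ?Z"
        using k by (simp add: missing_def)
      then have "e \<sigma> (axis k 1) \<in> light_cone"
        using geom by (auto simp: geometric_realization_def)
      then have "A *v e \<sigma> (axis k 1) \<in> light_cone"
        by (rule hyp_isometry_light_cone[OF lift_isometry[OF l]])
      then obtain c where c: "c > 0" "v k = c *\<^sub>R (A *v e \<sigma> (axis k 1))"
        using vk klein_eq_iff_positive_multiple[of "v k" "A *v e \<sigma> (axis k 1)"]
        by (auto simp: light_cone_def)
      then have "u k = c *\<^sub>R e \<sigma> (axis k 1)"
        by (simp add: u_def AB matrix_vector_mult_scaleR)
      then show ?thesis
        using c(1) by blast
    qed
  qed
  then show ?thesis
    using that v by blast
qed

lemma isometry_span_image:
  assumes "hyp_isometry A" "span S = UNIV"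
  shows "span ((*v) A ` S) = UNIV"
proof -
  obtain B where B: "hyp_isometry B" "A ** B = mat 1" "B ** A = mat 1"
    by (rule hyp_isometry_inverse[OF assms(1)])
  have "surj ((*v) A)"
    by (rule surjI[of _ "(*v) B"]) (simp add: matrix_vector_mul_assoc B)
  then show ?thesis
    using linear_span_image[OF matrix_vector_mul_linear, of A S] assms(2) by simp
qed

lemma lift_vertex_family:
  assumes "lift \<sigma> A v"
  shows "vertex_family v"
proof -
  obtain u where u: "marked_realization (ideals T \<sigma>) (zero_edges T \<sigma>) (e \<sigma>) u" "\<forall>k. v k = A *v u k"
    by (rule lift_realization[OF assms])
  have fam: "vertex_family u"
    by (rule marked_realization.vertex_family_vertices[OF u(1)])
  have "range v = (*v) A ` range u"
    using u(2) by auto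
  then have "span (range v) = UNIV"
    using isometry_span_image[OF lift_isometry[OF assms]] fam by (simp add: vertex_family_def)
  moreover have "mink (v a) (v b) = mink (u a) (u b)" for a b
    by (simp add: u(2) lift_mink[OF assms])
  ultimately show ?thesis
    using fam by (simp add: vertex_family_def)
qed

lemma realization_of:
  assumes "lift \<sigma> A v"
  shows "span (e \<sigma> ` open_model (ideals T \<sigma>)) = UNIV"
    and "continuous_on (open_model (ideals T \<sigma>)) (e \<sigma>)"
    and "open_model (ideals T \<sigma>) \<subseteq> ptt (ideals T \<sigma>) (zero_edges T \<sigma>)"
    and "inj_on (e \<sigma>) (ptt (ideals T \<sigma>) (zero_edges T \<sigma>))"
    and "e \<sigma> ` ptt (ideals T \<sigma>) (zero_edges T \<sigma>) \<subseteq> hyp3"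
proof -
  obtain u where "marked_realization (ideals T \<sigma>) (zero_edges T \<sigma>) (e \<sigma>) u" "\<forall>k. v k = A *v u k"
    by (rule lift_realization[OF assms])
  then interpret marked_realization "ideals T \<sigma>" "zero_edges T \<sigma>" "e \<sigma>" u
    by simp
  show "span (e \<sigma> ` open_model (ideals T \<sigma>)) = UNIV"
    by (rule span_open_image)
  show "continuous_on (open_model (ideals T \<sigma>)) (e \<sigma>)"
    by (rule continuous_on_hyp3_of_klein[OF continuous_on_subset[OF realization(4)]])
      (use open_hyp3 in \<open>auto simp: open_model_def\<close>)
  show "open_model (ideals T \<sigma>) \<subseteq> ptt (ideals T \<sigma>) (zero_edges T \<sigma>)"
    by (rule open_subset_ptt)
  show "inj_on (e \<sigma>) (ptt (ideals T \<sigma>) (zero_edges T \<sigma>))" "e \<sigma> ` ptt (ideals T \<sigma>) (zero_edges T \<sigma>) \<subseteq> hyp3"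
    by (rule realization)+
qed

lemma span_region:
  assumes "lift \<sigma> A v"
  shows "span Nt = UNIV"
proof -
  have "span ((*v) A ` e \<sigma> ` open_model (ideals T \<sigma>)) = UNIV"
    by (rule isometry_span_image[OF lift_isometry[OF assms] realization_of(1)[OF assms]])
  moreover have "(*v) A ` e \<sigma> ` open_model (ideals T \<sigma>) \<subseteq> Nt"
    using lift_cell(1)[OF assms] realization_of(3)[OF assms] by blast
  ultimately show ?thesis
    using span_mono[of "(*v) A ` e \<sigma> ` open_model (ideals T \<sigma>)" Nt] by (simp add: top.extremum_unique)
qed

lemma lifts_agree_at_point:
  assumes A: "lift \<sigma> A v" and B: "\<And>x. x \<in> open_model (ideals T \<sigma>) \<Longrightarrow> B *v e \<sigma> x \<in> Nt"
    "\<And>x. x \<in> open_model (ideals T \<sigma>) \<Longrightarrow> p (B *v e \<sigma> x) = f \<sigma> (e \<sigma> x)"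
    and x: "x \<in> open_model (ideals T \<sigma>)" "A *v e \<sigma> x = B *v e \<sigma> x"
  shows "A = B"
proof (rule lifts_agree[OF region(2), of "open_model (ideals T \<sigma>)" "e \<sigma>"])
  show "connected (open_model (ideals T \<sigma>))"
    by (rule convex_connected[OF convex_open_model])
  have s: "x \<in> ptt (ideals T \<sigma>) (zero_edges T \<sigma>)" if "x \<in> open_model (ideals T \<sigma>)" for x
    using that realization_of(3)[OF A] by blast
  show "A *v e \<sigma> x \<in> Nt" if "x \<in> open_model (ideals T \<sigma>)" for x
    by (rule lift_cell(1)[OF A s[OF that]])
  show "p (A *v e \<sigma> x) = p (B *v e \<sigma> x)" if "x \<in> open_model (ideals T \<sigma>)" for x
    unfolding lift_cell(2)[OF A s[OF that]] B(2)[OF that] ..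
qed (fact realization_of[OF A] B x)+

text \<open>The two lifts of the centre of \<open>\<sigma>\<close> are related by a deck
  transformation, and uniqueness of lifts does the rest.\<close>

lemma lifts_differ_by_deck:
  assumes l: "lift \<sigma> A v" "lift \<sigma> A' v'"
  obtains G where "G \<in> deck Nt p" "A' = G ** A"
proof -
  define x :: "real^4" where "x = (\<chi> i. 1/4)"
  have x: "x \<in> open_model (ideals T \<sigma>)"
    unfolding x_def by (rule centre_in_open_model)
  have s: "x \<in> ptt (ideals T \<sigma>) (zero_edges T \<sigma>)" if "x \<in> open_model (ideals T \<sigma>)" for x
    using that realization_of(3)[OF l(1)] by blast
  have "p (A *v e \<sigma> x) = p (A' *v e \<sigma> x)"
    using lift_cell(2)[OF l(1) s[OF x]] lift_cell(2)[OF l(2) s[OF x]] by simp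
  then obtain G where G: "G \<in> deck Nt p" "A' *v e \<sigma> x = G *v (A *v e \<sigma> x)"
    using cover lift_cell(1)[OF l(1) s[OF x]] lift_cell(1)[OF l(2) s[OF x]]
    unfolding universal_cover_def by blast
  have inv: "G *v y \<in> Nt" "p (G *v y) = p y" if "y \<in> Nt" for y
    using G(1) that by (auto simp: deck_def)
  have "A' = G ** A"
  proof (rule lifts_agree_at_point[OF l(2) _ _ x])
    fix y assume y: "y \<in> open_model (ideals T \<sigma>)"
    show "(G ** A) *v e \<sigma> y \<in> Nt"
      using inv(1) lift_cell(1)[OF l(1) s[OF y]] by (simp flip: matrix_vector_mul_assoc)
    show "p ((G ** A) *v e \<sigma> y) = f \<sigma> (e \<sigma> y)"
      using inv(2) lift_cell[OF l(1) s[OF y]] by (simp flip: matrix_vector_mul_assoc)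
  qed (simp add: G(2) matrix_vector_mul_assoc)
  then show ?thesis
    using that G(1) by blast
qed

lemma mat_1_deck: "mat 1 \<in> deck Nt p"
  by (simp add: deck_def hyp_isometry_def)

text \<open>For an ideal vertex the two vectors are proportional, and the horospheres dual to them
  project to the same torus; the normalization by the cross-section makes them equal. For a non-
  ideal vertex both are unit normals of the same plane, and the sign is determined because the
  cell lies on one side.\<close>

lemma deck_moves_vertices:
  assumes l: "lift \<sigma> A v" "lift \<sigma> (G ** A) v'" and G: "G \<in> deck Nt p"
  shows "v' k = G *v v k"
proof -
  let ?I = "ideals T \<sigma>" and ?Z = "zero_edges T \<sigma>"
  have iso: "hyp_isometry G" and Nt: "(*v) G ` Nt = Nt" and pG: "\<And>x. x \<in> Nt \<Longrightarrow> p (G *v x) = p x"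
    using G by (auto simp: deck_def)
  obtain u where u: "marked_realization ?I ?Z (e \<sigma>) u" "\<forall>k. v k = A *v u k"
    by (rule lift_realization[OF l(1)])
  obtain u' where u': "marked_realization ?I ?Z (e \<sigma>) u'" "\<forall>k. v' k = (G ** A) *v u' k"
    by (rule lift_realization[OF l(2)])
  interpret U: marked_realization ?I ?Z "e \<sigma>" u
    by (rule u(1))
  interpret U': marked_realization ?I ?Z "e \<sigma>" u'
    by (rule u'(1))
  have "u' k = u k"
  proof (cases "k \<in> ?I")
    case True
    obtain c where c: "c > 0" "u k = c *\<^sub>R e \<sigma> (axis k 1)"
      using U.ideal[OF True] by blast
    obtain c' where c': "c' > 0" "u' k = c' *\<^sub>R e \<sigma> (axis k 1)"
      using U'.ideal[OF True] by blast
    define d where "d = c / c'"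
    have d: "d > 0" "u k = d *\<^sub>R u' k"
      using c c' by (simp_all add: d_def)
    have cusp: "v k \<in> lifted_cusps Nt p \<O>" "v' k \<in> lifted_cusps Nt p \<O>"
      using l True by (auto simp: lift_def lifted_vertices_def)
    have Gv: "G *v v k = d *\<^sub>R v' k"
      by (simp add: u(2) u'(2) d(2) matrix_vector_mult_scaleR matrix_vector_mul_assoc)
    have ray: "v' k \<in> toric_rays Nt p"
      using cusp(2) by (simp add: lifted_cusps_def)
    have "d *\<^sub>R v' k \<in> lifted_cusps Nt p \<O>"
    proof -
      have lc: "d *\<^sub>R v' k \<in> light_cone"
        using lifted_cusp_light_cone[OF cusp(2)] d(1) by (simp add: light_cone_def mink_linear)
      have fr: "fixes_ray B (d *\<^sub>R v' k)" if ray: "fixes_ray B (v' k)" for B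
      proof -
        obtain b where "B *v v' k = b *\<^sub>R v' k"
          using ray by (auto simp: fixes_ray_def)
        then have "B *v (d *\<^sub>R v' k) = b *\<^sub>R (d *\<^sub>R v' k)"
          by (simp add: matrix_vector_mult_scaleR mult.commute)
        then show ?thesis
          by (auto simp: fixes_ray_def)
      qed
      have kl: "klein (d *\<^sub>R v' k) = klein (v' k)"
        using d(1) by (intro klein_scale) simp
      have "d *\<^sub>R v' k \<in> toric_rays Nt p"
        using ray lc fr unfolding toric_rays_def mem_Collect_eq kl by blast
      moreover have "p ` horosphere (d *\<^sub>R v' k) \<in> \<O>"
      proof -
        have "horoball (v k) \<subseteq> Nt"
          by (rule cusp_in_region[OF cusp(1)])
        then have sub: "horosphere (v k) \<subseteq> Nt"
          by (auto simp: horosphere_def horoball_def)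
        have "horosphere (G *v v k) = (*v) G ` horosphere (v k)"
        proof -
          have surj: "(*v) G ` hyp3 = hyp3"
            using iso by (simp add: hyp_isometry_def)
          show ?thesis
          proof (intro subset_antisym subsetI)
            fix y assume y: "y \<in> horosphere (G *v v k)"
            then have "y \<in> (*v) G ` hyp3"
              unfolding surj by (simp add: horosphere_def)
            then obtain x where x: "x \<in> hyp3" "y = G *v x"
              by blast
            then have "x \<in> horosphere (v k)"
              using y by (simp add: horosphere_def hyp_isometry_mink[OF iso])
            then show "y \<in> (*v) G ` horosphere (v k)"
              using x(2) by blast
          next
            fix y assume "y \<in> (*v) G ` horosphere (v k)"
            then obtain x where "x \<in> horosphere (v k)" "y = G *v x"
              by blast
            then show "y \<in> horosphere (G *v v k)"
              by (simp add: horosphere_def hyp_isometry_mink[OF iso] hyp_isometry_hyp3[OF iso])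
          qed
        qed
        then have "p ` horosphere (G *v v k) = (\<lambda>x. p (G *v x)) ` horosphere (v k)"
          by (simp add: image_image)
        also have "\<dots> = p ` horosphere (v k)"
          by (rule image_cong[OF refl pG]) (use sub in blast)
        finally have "p ` horosphere (G *v v k) = p ` horosphere (v k)" .
        then show ?thesis
          using cusp(1) by (simp add: Gv lifted_cusps_def)
      qed
      ultimately show ?thesis
        by (simp add: lifted_cusps_def)
    qed
    moreover have "\<exists>!c. c > 0 \<and> c *\<^sub>R v' k \<in> lifted_cusps Nt p \<O>"
      by (rule unique_cusp[OF ray])
    moreover have "1 *\<^sub>R v' k \<in> lifted_cusps Nt p \<O>"
      using cusp(2) by simp
    ultimately have "d = 1"
      using d(1) zero_less_one[where 'a = real] by blast
    then show ?thesis
      using d(2) by simp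
  next
    case False
    define w where "w j = (if j = k then u k else e \<sigma> (corner k j))" for j
    have full: "span (range w) = UNIV"
      using U.truncation_corner_basis[OF False] by (simp add: w_def)
    define s where "s = mink (u' k) (u k)"
    have "mink (u' k - s *\<^sub>R u k) y = 0" if y: "y \<in> range w" for y
    proof -
      obtain j where j: "y = w j"
        using y by blast
      show ?thesis
      proof (cases "j = k")
        case True
        then show ?thesis
          using U.unit[OF False] by (simp add: j w_def mink_linear s_def)
      next
        case j': False
        show ?thesis
          using U.corner_orthogonal[OF False j'] U'.corner_orthogonal[OF False j'] j'
          by (simp add: j w_def mink_linear mink_commute[of _ "e \<sigma> (corner k j)"])
      qed
    qed
    then have "u' k - s *\<^sub>R u k = 0"
      by (rule mink_eq_zero_if_spanning[OF full])
    then have eq: "u' k = s *\<^sub>R u k"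
      by simp
    then have "s\<^sup>2 = 1"
      using U.unit[OF False] U'.unit[OF False] by (simp add: mink_linear power2_eq_square)
    then consider "s = 1" | "s = -1"
      using power2_eq_1_iff by blast
    then show ?thesis
    proof cases
      case 1
      then show ?thesis
        using eq by simp
    next
      case 2
      have "mink (e \<sigma> x) (u k) = 0" if x: "x \<in> open_model ?I" for x
      proof -
        have "x \<in> ptt ?I ?Z"
          using x U.open_subset_ptt by blast
        then show ?thesis
          using U.side[OF False, of x] U'.side[OF False, of x] eq 2 by (simp add: mink_linear)
      qed
      then have "u k = 0"
        by (intro mink_eq_zero_if_spanning[OF U.span_open_image]) (auto simp: mink_commute[of "u k"])
      then show ?thesis
        using U.unit[OF False] by (simp add: mink_linear)
    qed
  qed
  then show ?thesis
    by (simp add: u(2) u'(2) matrix_vector_mul_assoc)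
qed

lemma lift_determines_vertices:
  assumes "lift \<sigma> A v" "lift \<sigma> A v'"
  shows "v' = v"
  using deck_moves_vertices[OF assms(1) _ mat_1_deck, of v'] assms(2) by auto

lemma lift_corner_span:
  assumes l: "lift \<sigma> A v"
  shows "v ` (- {i}) \<subseteq> span (corner_rays (v ` (- {i})))"
proof -
  obtain u where u: "marked_realization (ideals T \<sigma>) (zero_edges T \<sigma>) (e \<sigma>) u" "\<forall>k. v k = A *v u k"
    by (rule lift_realization[OF l])
  have V: "v ` (- {i}) = (*v) A ` u ` (- {i})"
    using u(2) by auto
  have "corner_rays (v ` (- {i})) = (*v) A ` corner_rays (u ` (- {i}))"
    unfolding V by (rule corner_rays_image) (rule lift_mink[OF l])
  then have "span (corner_rays (v ` (- {i}))) = (*v) A ` span (corner_rays (u ` (- {i})))"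
    using linear_span_image[OF matrix_vector_mul_linear, of A] by simp
  then show ?thesis
    using marked_realization.face_in_span_corner_rays[OF u(1), of i] unfolding V by blast
qed

text \<open>The first sum may be supported by the corner rays of a single face; the second one
  pushes its value into the interior of the cell.\<close>

lemma lift_conic_combination:
  assumes l: "lift \<sigma> A v"
    and \<nu>: "\<And>a b. mink (\<nu> a) (v b) = (if a = b then 1 else 0)"
    and Q: "Q \<subseteq> corner_rays (range v)" and c: "\<And>q. q \<in> Q \<Longrightarrow> c q \<ge> 0" and d: "d > 0"
    and y: "y = (\<Sum>q\<in>Q. c q *\<^sub>R q) + d *\<^sub>R (\<Sum>q\<in>corner_rays (range v). q)"
  obtains x r where "x \<in> open_model (ideals T \<sigma>)" "r > 0" "y = r *\<^sub>R (A *v e \<sigma> x)"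
proof -
  obtain u where u: "marked_realization (ideals T \<sigma>) (zero_edges T \<sigma>) (e \<sigma>) u" "\<forall>k. v k = A *v u k"
    by (rule lift_realization[OF l])
  obtain B where B: "hyp_isometry B" "A ** B = mat 1" "B ** A = mat 1"
    by (rule hyp_isometry_inverse[OF lift_isometry[OF l]])
  have AB: "A *v (B *v x) = x" "B *v (A *v x) = x" for x
    using B by (simp_all add: matrix_vector_mul_assoc)
  have BA: "mink (B *v x) y = mink x (A *v y)" for x y
    using lift_mink[OF l, of "B *v x" y] by (simp add: AB)
  let ?R = "corner_rays (range v)"
  have fin: "finite ?R"
    by (rule finite_corner_rays) simp
  define b where "b q = (if q \<in> Q then c q else 0) + d" for q
  have "(\<Sum>q\<in>Q. c q *\<^sub>R q) = (\<Sum>q\<in>?R. (if q \<in> Q then c q else 0) *\<^sub>R q)"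
    by (rule sum.mono_neutral_cong_left[OF fin Q]) auto
  then have y': "y = (\<Sum>q\<in>?R. b q *\<^sub>R q)"
    by (simp add: y b_def scaleR_sum_right sum.distrib scaleR_add_left)
  have V: "range v = (*v) A ` range u"
    using u(2) by auto
  have R: "?R = (*v) A ` corner_rays (range u)"
    unfolding V by (rule corner_rays_image) (rule lift_mink[OF l])
  have inj: "inj_on ((*v) A) S" for S
    by (rule inj_on_inverseI[of _ "(*v) B"]) (simp add: AB)
  have "y = (\<Sum>q\<in>corner_rays (range u). b (A *v q) *\<^sub>R (A *v q))"
    unfolding y' R by (simp add: sum.reindex[OF inj])
  then have By: "B *v y = (\<Sum>q\<in>corner_rays (range u). b (A *v q) *\<^sub>R q)"
    by (simp add: linear_sum[OF matrix_vector_mul_linear] matrix_vector_mult_scaleR AB)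
  have pos: "mink (B *v \<nu> m) (B *v y) > 0" for m
  proof -
    have "mink (\<nu> m) (\<Sum>q\<in>Q. c q *\<^sub>R q) \<ge> 0"
      unfolding mink_sum_right mink_linear
      using Q c corner_rays_dual_nonneg[OF lift_vertex_family[OF l] \<nu>]
      by (intro sum_nonneg mult_nonneg_nonneg) auto
    moreover have "mink (\<nu> m) (\<Sum>q\<in>?R. q) > 0"
      by (rule corner_rays_dual_pos[OF lift_vertex_family[OF l] \<nu>])
    then have "mink (\<nu> m) (d *\<^sub>R (\<Sum>q\<in>?R. q)) > 0"
      using d by (simp add: mink_linear)
    ultimately have "mink (\<nu> m) y > 0"
      by (simp add: y mink_add_right)
    then show ?thesis
      by (simp add: BA AB)
  qed
  have bnn: "b (A *v q) \<ge> 0" for q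
    using c d by (auto simp: b_def add_nonneg_nonneg less_imp_le)
  have dual: "mink (B *v \<nu> a) (u b) = (if a = b then 1 else 0)" for a b
    using \<nu> by (simp add: BA u(2)[rule_format, symmetric])
  obtain x r where x: "x \<in> open_model (ideals T \<sigma>)" "r > 0" "B *v y = r *\<^sub>R e \<sigma> x"
    by (rule marked_realization.conic_combination_in_cell[OF u(1) dual bnn By pos])
  have "y = A *v (B *v y)"
    by (simp add: AB)
  also have "\<dots> = r *\<^sub>R (A *v e \<sigma> x)"
    by (simp add: x(3) matrix_vector_mult_scaleR)
  finally show ?thesis
    using that x by blast
qed

end

section \<open>Adjacent lifts\<close>

text \<open>The analogue of \<open>edge_vector\<close> for the three vertices of a face.\<close>

definition face_vector :: "real^4 \<Rightarrow> real^4 \<Rightarrow> real^4 \<Rightarrow> real^4" where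
  "face_vector x y z = edge_vector x y + edge_vector y z + edge_vector z x"

lemma face_vector_permute:
  assumes "{x', y', z'} = {x, y, z}" "distinct [x, y, z]" "distinct [x', y', z']"
  shows "face_vector x' y' z' = face_vector x y z"
proof -
  have "x' \<in> {x, y, z}" "y' \<in> {x, y, z}" "z' \<in> {x, y, z}"
    using assms(1) by blast+
  then show ?thesis
    using assms(2,3) edge_vector_commute[of x y] edge_vector_commute[of y z] edge_vector_commute[of z x]
    by (elim insertE emptyE) (simp_all add: face_vector_def add_ac)
qed

text \<open>Edge vectors are positive combinations of their end points. Hence it is enough to pair
  one of them with a vertex that it contains and with one that it does not contain.\<close>

lemma vertex_family_edges_negative:
  assumes v: "vertex_family v" and d: "distinct [a, b, c]"
  shows "mink (edge_vector (v a) (v b)) (edge_vector (v b) (v c)) < 0"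
proof -
  define g where "g x = mink (v x) (v x)" for x
  define m where "m x y = mink (v x) (v y)" for x y
  have g: "g x = 0 \<or> g x = 1" for x
    using v by (simp add: vertex_family_def g_def)
  have neg: "m x y < 0" if "x \<noteq> y" for x y
    using v that by (simp add: vertex_family_def m_def)
  have le: "g x = 1 \<Longrightarrow> g y = 1 \<Longrightarrow> m x y \<le> -1" if "x \<noteq> y" for x y
    using v that by (simp add: vertex_family_def g_def m_def)
  let ?e = "edge_vector (v a) (v b)"
  have ab: "a \<noteq> b" "b \<noteq> c" "a \<noteq> c"
    using d by auto
  have 1: "mink ?e (v b) \<le> 0"
  proof -
    have "mink ?e (v b) = (g b - m a b) * m a b + (g a - m a b) * g b"
      by (simp add: edge_vector_def mink_linear g_def m_def)
    also have "\<dots> \<le> 0"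
    proof (cases "g b = 0")
      case True
      then show ?thesis
        using neg[OF ab(1)] by (simp add: mult_nonneg_nonpos)
    next
      case False
      then have b: "g b = 1"
        using g by blast
      show ?thesis
      proof (cases "g a = 0")
        case True
        then show ?thesis
          using b by (simp add: algebra_simps)
      next
        case False
        then have "g a = 1" "m a b \<le> -1"
          using g le[OF ab(1)] b by blast+
        then have "(1 - m a b) * (1 + m a b) \<le> 0"
          by (intro mult_nonneg_nonpos) auto
        then show ?thesis
          using b \<open>g a = 1\<close> by (simp add: algebra_simps)
      qed
    qed
    finally show ?thesis .
  qed
  have pos: "g x - m x' y' > 0" if "x' \<noteq> y'" for x x' y'
    using g[of x] neg[OF that] by auto
  have 2: "mink ?e (v c) < 0"
  proof -
    have "mink ?e (v c) = (g b - m a b) * m a c + (g a - m a b) * m b c"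
      by (simp add: edge_vector_def mink_linear g_def m_def)
    also have "\<dots> < 0"
      using pos[OF ab(1)] neg ab by (intro add_neg_neg mult_pos_neg) auto
    finally show ?thesis .
  qed
  have "mink ?e (edge_vector (v b) (v c)) = (g c - m b c) * mink ?e (v b) + (g b - m b c) * mink ?e (v c)"
    by (simp only: edge_vector_def[of "v b" "v c"] mink_linear g_def m_def)
  also have "\<dots> < 0"
    using 1 2 pos[OF ab(2)] by (intro add_nonpos_neg mult_pos_neg mult_nonneg_nonpos) (auto intro: less_imp_le)
  finally show ?thesis .
qed

lemma face_vector_timelike:
  assumes v: "vertex_family v" and d: "distinct [a, b, c]"
  shows "mink (face_vector (v a) (v b) (v c)) (face_vector (v a) (v b) (v c)) < 0"
proof -
  let ?x = "edge_vector (v a) (v b)" and ?y = "edge_vector (v b) (v c)" and ?z = "edge_vector (v c) (v a)"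
  have "mink ?x ?x \<le> 0" "mink ?y ?y \<le> 0" "mink ?z ?z \<le> 0"
    using vertex_family_edge(1)[OF v] d by auto
  moreover have "mink ?x ?y < 0" "mink ?y ?z < 0" "mink ?z ?x < 0"
    using vertex_family_edges_negative[OF v, of a b c] vertex_family_edges_negative[OF v, of b c a]
      vertex_family_edges_negative[OF v, of c a b] d by auto
  ultimately show ?thesis
    by (simp add: face_vector_def mink_linear mink_commute[of ?y ?x] mink_commute[of ?z ?y] mink_commute[of ?x ?z])
qed

lemma face_vector_isometry:
  assumes "\<And>x y. mink (G *v x) (G *v y) = mink x y"
  shows "G *v face_vector x y z = face_vector (G *v x) (G *v y) (G *v z)"
  by (simp add: face_vector_def edge_vector_isometry[of G, OF assms] matrix_vector_right_distrib)

context lifted_triangulation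
begin

text \<open>A point on no lateral face is glued to nothing. So the point of the manifold
  determines the tetrahedron and the point in it, and then the lift is determined by its value
  there.\<close>

lemma interior_points_determine_lift:
  assumes l: "lift \<sigma> A v" "lift \<tau> A' v'"
    and x: "x \<in> open_model (ideals T \<sigma>)" "x' \<in> open_model (ideals T \<tau>)"
    and eq: "A *v e \<sigma> x = A' *v e \<tau> x'"
  shows "\<sigma> = \<tau> \<and> A = A'"
proof -
  have xp: "x \<in> ptt (ideals T \<sigma>) (zero_edges T \<sigma>)" "x' \<in> ptt (ideals T \<tau>) (zero_edges T \<tau>)"
    using x realization_of(3)[OF l(1)] realization_of(3)[OF l(2)] by blast+
  have \<sigma>\<tau>: "\<sigma> \<in> tetrahedra T" "\<tau> \<in> tetrahedra T"
    using l by (auto simp: lift_def)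
  have cells: "e \<sigma> x \<in> cell T e \<sigma> UNIV" "e \<tau> x' \<in> cell T e \<tau> UNIV"
    using xp by (auto simp: cell_def)
  have "f \<sigma> (e \<sigma> x) = f \<tau> (e \<tau> x')"
    using lift_cell(2)[OF l(1) xp(1)] lift_cell(2)[OF l(2) xp(2)] eq by simp
  then have "((\<sigma>, e \<sigma> x), (\<tau>, e \<tau> x')) \<in> (glued T e)\<^sup>*"
    using gluing[OF \<sigma>\<tau> cells] by blast
  moreover have "((\<sigma>, e \<sigma> x), q) \<notin> glued T e" for q
  proof
    assume "((\<sigma>, e \<sigma> x), q) \<in> glued T e"
    then obtain i where "e \<sigma> x \<in> cell T e \<sigma> (lateral i)"
      unfolding glued_def by blast
    then obtain z where z: "z \<in> ptt (ideals T \<sigma>) (zero_edges T \<sigma>)" "z $ i = 0" "e \<sigma> x = e \<sigma> z"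
      by (auto simp: cell_def lateral_def)
    then have "x = z"
      using realization_of(4)[OF l(1)] xp(1) by (auto dest: inj_onD)
    then show False
      using z(2) x(1) by (auto simp: open_model_def less_le)
  qed
  ultimately have same: "\<sigma> = \<tau>" "e \<sigma> x = e \<tau> x'"
    by (auto elim: converse_rtranclE)
  have "x = x'"
    using realization_of(4)[OF l(1)] xp same by (auto dest: inj_onD)
  have "A = A'"
  proof (rule lifts_agree_at_point[OF l(1) _ _ x(1)])
    show "A *v e \<sigma> x = A' *v e \<sigma> x"
      using eq same \<open>x = x'\<close> by simp
    fix y assume "y \<in> open_model (ideals T \<sigma>)"
    then have y: "y \<in> ptt (ideals T \<tau>) (zero_edges T \<tau>)"
      using realization_of(3)[OF l(1)] same(1) by blast
    show "A' *v e \<sigma> y \<in> Nt" "p (A' *v e \<sigma> y) = f \<sigma> (e \<sigma> y)"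
      using lift_cell[OF l(2) y] same(1) by simp_all
  qed
  then show ?thesis
    using same(1) by simp
qed

text \<open>Let \<open>x0\<close> be the sum of the corner rays of the common face, which is in
  the relative interior of the cone over it. Move \<open>x0\<close> a little in the direction of
  the sum \<open>z'\<close> of all corner rays of the second tetrahedron. The result
  \<open>y\<close> is in the interior of the cone over the second cell. As \<open>z'\<close> is a
  positive multiple of the corresponding sum \<open>z\<close> for the first tetrahedron up to a
  vector \<open>s\<close> in the span of the face, \<open>y\<close> is in the interior of the cone
  over the first cell, too.\<close>

lemma overlapping_lifts_equal:
  assumes l: "lift \<sigma> A v" "lift \<tau> A' v'"
    and V: "v ` (- {i}) = v' ` (- {j})"
    and \<nu>: "\<And>a b. mink (\<nu> a) (v b) = (if a = b then 1 else 0)"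
      "\<And>y. y = (\<Sum>a\<in>UNIV. mink (\<nu> a) y *\<^sub>R v a)"
    and pos: "mink (\<nu> i) (v' j) > 0"
  shows "\<sigma> = \<tau> \<and> A = A'"
proof -
  have "span (range v') = UNIV"
    using lift_vertex_family[OF l(2)] by (simp add: vertex_family_def)
  then obtain \<nu>' where \<nu>': "\<And>a b. mink (\<nu>' a) (v' b) = (if a = b then 1 else 0)"
      "\<And>y. y = (\<Sum>a\<in>UNIV. mink (\<nu>' a) y *\<^sub>R v' a)"
    by (rule mink_dual_basis) (rule that; assumption)
  define Q where "Q = corner_rays (v ` (- {i}))"
  have Q: "Q \<subseteq> corner_rays (range v)" "Q \<subseteq> corner_rays (range v')"
    unfolding Q_def by (rule corner_rays_mono, blast) (unfold V, rule corner_rays_mono, blast)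
  have finQ: "finite Q"
    unfolding Q_def by (rule finite_corner_rays) simp
  define z where "z = (\<Sum>q\<in>corner_rays (range v). q)"
  define z' where "z' = (\<Sum>q\<in>corner_rays (range v'). q)"
  have zpos: "mink (\<nu> i) z > 0"
    unfolding z_def by (rule corner_rays_dual_pos[OF lift_vertex_family[OF l(1)] \<nu>(1)])
  have z'pos: "mink (\<nu>' j) z' > 0"
    unfolding z'_def by (rule corner_rays_dual_pos[OF lift_vertex_family[OF l(2)] \<nu>'(1)])
  have zero: "mink (\<nu> i) (v' b) = 0" if "b \<noteq> j" for b
  proof -
    have "v' b \<in> v ` (- {i})"
      unfolding V using that by blast
    then show ?thesis
      using \<nu>(1) by (auto split: if_splits)
  qed
  have "mink (\<nu> i) z' = (\<Sum>b\<in>UNIV. mink (\<nu>' b) z' * mink (\<nu> i) (v' b))"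
    using arg_cong[OF \<nu>'(2)[of z'], of "mink (\<nu> i)"] by (simp only: mink_sum_right mink_linear)
  also have "\<dots> = (\<Sum>b\<in>{j}. mink (\<nu>' b) z' * mink (\<nu> i) (v' b))"
    by (rule sum.mono_neutral_right) (use zero in auto)
  finally have z'i: "mink (\<nu> i) z' > 0"
    using z'pos pos by simp
  define c where "c = mink (\<nu> i) z' / mink (\<nu> i) z"
  have c: "c > 0"
    using zpos z'i by (simp add: c_def)
  define s where "s = z' - c *\<^sub>R z"
  have si: "mink (\<nu> i) s = 0"
    using zpos by (simp add: s_def c_def mink_linear)
  have "s = (\<Sum>a\<in>- {i}. mink (\<nu> a) s *\<^sub>R v a)"
  proof -
    have "(\<Sum>a\<in>UNIV. mink (\<nu> a) s *\<^sub>R v a) = (\<Sum>a\<in>- {i}. mink (\<nu> a) s *\<^sub>R v a)"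
      by (rule sum.mono_neutral_right) (use si in auto)
    then show ?thesis
      using \<nu>(2)[of s] by (rule trans[rotated])
  qed
  also have "\<dots> \<in> span (v ` (- {i}))"
    by (intro span_sum span_mul span_base) auto
  also have "span (v ` (- {i})) \<subseteq> span Q"
    unfolding Q_def by (rule span_minimal[OF lift_corner_span[OF l(1)] subspace_span])
  finally have "s \<in> span Q" .
  then obtain b where b: "s = (\<Sum>q\<in>Q. b q *\<^sub>R q)"
    unfolding span_finite[OF finQ] by blast
  \<comment> \<open>Small enough for all coefficients \<open>1 + \<epsilon> * b q\<close> to be
    nonnegative.\<close>
  define \<epsilon> where "\<epsilon> = 1 / (1 + (\<Sum>q\<in>Q. \<bar>b q\<bar>))"
  have S: "(\<Sum>q\<in>Q. \<bar>b q\<bar>) \<ge> 0"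
    by (simp add: sum_nonneg)
  then have \<epsilon>: "\<epsilon> > 0"
    by (simp add: \<epsilon>_def add_pos_nonneg)
  have nonneg: "1 + \<epsilon> * b q \<ge> 0" if "q \<in> Q" for q
  proof -
    have "\<bar>b q\<bar> \<le> (\<Sum>q\<in>Q. \<bar>b q\<bar>)"
      using that finQ by (intro member_le_sum) auto
    then have "\<epsilon> * \<bar>b q\<bar> \<le> 1"
      using S by (simp add: \<epsilon>_def field_simps)
    moreover have "\<epsilon> * b q \<ge> - (\<epsilon> * \<bar>b q\<bar>)"
      using \<epsilon> by (simp add: abs_if)
    ultimately show ?thesis
      by linarith
  qed
  define y where "y = (\<Sum>q\<in>Q. 1 *\<^sub>R q) + \<epsilon> *\<^sub>R z'"
  have "z' = s + c *\<^sub>R z"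
    by (simp add: s_def)
  then have y: "y = (\<Sum>q\<in>Q. (1 + \<epsilon> * b q) *\<^sub>R q) + (\<epsilon> * c) *\<^sub>R z"
    by (simp add: y_def b scaleR_add_right scaleR_add_left scaleR_sum_right sum.distrib)
  obtain x r where x: "x \<in> open_model (ideals T \<sigma>)" "r > 0" "y = r *\<^sub>R (A *v e \<sigma> x)"
    by (rule lift_conic_combination[OF l(1) \<nu>(1) Q(1) nonneg _ y[unfolded z_def]]) (use \<epsilon> c in auto)
  obtain x' r' where x': "x' \<in> open_model (ideals T \<tau>)" "r' > 0" "y = r' *\<^sub>R (A' *v e \<tau> x')"
    by (rule lift_conic_combination[OF l(2) \<nu>'(1) Q(2) _ \<epsilon> y_def[unfolded z'_def]]) auto
  have h: "A *v e \<sigma> x \<in> hyp3" "A' *v e \<tau> x' \<in> hyp3"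
    using lift_cell(1)[OF l(1)] lift_cell(1)[OF l(2)] realization_of(3)[OF l(1)] realization_of(3)[OF l(2)]
      x(1) x'(1) region(3) by blast+
  have "klein (A *v e \<sigma> x) = klein y"
    unfolding x(3) using x(2) by (simp add: klein_scale)
  moreover have "klein (A' *v e \<tau> x') = klein y"
    unfolding x'(3) using x'(2) by (simp add: klein_scale)
  ultimately have "A *v e \<sigma> x = A' *v e \<tau> x'"
    by (intro inj_onD[OF klein_inj_hyp3 _ h]) simp
  then show ?thesis
    by (rule interior_points_determine_lift[OF l x(1) x'(1)])
qed

lemma deck_no_timelike_fixed:
  assumes sp: "span Nt = UNIV" and G: "G \<in> deck Nt p" "G \<noteq> mat 1" and y: "mink y y < 0"
  shows "G *v y \<noteq> y"
proof
  assume fixed: "G *v y = y"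
  obtain x where x: "future x" "mink x x < 0" "G *v x = x"
  proof (cases "y $ 0 > 0")
    case True
    then show ?thesis
      using that[of y] y fixed by (simp add: future_def)
  next
    case False
    have "y $ 0 \<noteq> 0"
    proof
      assume "y $ 0 = 0"
      then have "mink y y = (y $ 1)\<^sup>2 + (y $ 2)\<^sup>2 + (y $ 3)\<^sup>2"
        by (simp add: mink_self)
      then show False
        using y zero_le_power2[of "y $ 1"] zero_le_power2[of "y $ 2"] zero_le_power2[of "y $ 3"]
        by linarith
    qed
    moreover have "G *v (- y) = - y"
      using fixed matrix_vector_mult_scaleR[of G "-1" y] by simp
    ultimately show ?thesis
      using that[of "- y"] y False by (simp add: future_def mink_linear)
  qed
  have "G = mat 1"
    by (rule deck_fixing_point_trivial[OF cover sp G(1) timelike_normalize[OF x(1,2)]])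
      (simp add: matrix_vector_mult_scaleR x(3))
  then show False
    using G(2) by simp
qed

text \<open>The coordinate of \<open>v' j\<close> opposite to the common face cannot vanish by
  independence, and cannot be positive because distinct lifts do not overlap. If both tetrahedra
  lift \<open>\<sigma>\<close>, the deck transformation between them fixes no timelike vector. So
  it does not map the common face to itself as a face of the same index, and the tilt inequality
  applies.\<close>

lemma adjacent_lifts:
  assumes l: "lift \<sigma> A v" "lift \<tau> A' v'"
    and ne: "(\<sigma>, range v) \<noteq> (\<tau>, range v')"
    and V: "v ` (- {i}) = v' ` (- {j})"
    and \<nu>: "\<And>a b. mink (\<nu> a) (v b) = (if a = b then 1 else 0)"
      "\<And>y. y = (\<Sum>a\<in>UNIV. mink (\<nu> a) y *\<^sub>R v a)"
  shows "mink (\<nu> i) (v' j) < 0" and "\<sigma> = \<tau> \<Longrightarrow> (\<Sum>a\<in>UNIV. mink (\<nu> a) (v' j)) > 1"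
proof -
  have fam: "vertex_family v" "vertex_family v'"
    using l lift_vertex_family by auto
  have ind: "inj v" "independent (range v)" "inj v'" "independent (range v')"
    using fam spanning_four_independent by (auto simp: vertex_family_def)
  have distinct_lifts: "\<not> (\<sigma> = \<tau> \<and> A = A')"
  proof
    assume *: "\<sigma> = \<tau> \<and> A = A'"
    then have "v' = v"
      using lift_determines_vertices l by blast
    then show False
      using * ne by simp
  qed
  have "mink (\<nu> i) (v' j) \<noteq> 0"
  proof
    assume z: "mink (\<nu> i) (v' j) = 0"
    have "(\<Sum>a\<in>UNIV. mink (\<nu> a) (v' j) *\<^sub>R v a) = (\<Sum>a\<in>- {i}. mink (\<nu> a) (v' j) *\<^sub>R v a)"
      by (rule sum.mono_neutral_right) (use z in auto)
    then have "v' j = (\<Sum>a\<in>- {i}. mink (\<nu> a) (v' j) *\<^sub>R v a)"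
      using \<nu>(2)[of "v' j"] by (rule trans[rotated])
    also have "\<dots> \<in> span (v ` (- {i}))"
      by (intro span_sum span_mul span_base) auto
    also have "\<dots> = span (range v' - {v' j})"
    proof -
      have "v' ` (- {j}) = range v' - {v' j}"
        using ind(3) by (auto dest: injD)
      then show ?thesis
        by (simp add: V)
    qed
    finally show False
      using ind(4) unfolding dependent_def by blast
  qed
  moreover have "\<not> mink (\<nu> i) (v' j) > 0"
    using overlapping_lifts_equal[OF l V \<nu>] distinct_lifts by blast
  ultimately show opp: "mink (\<nu> i) (v' j) < 0"
    by simp
  assume same: "\<sigma> = \<tau>"
  obtain G where G: "G \<in> deck Nt p" "A' = G ** A"
    using lifts_differ_by_deck[OF l(1)] l(2) same by metis
  have v': "v' a = G *v v a" for a
    using deck_moves_vertices[OF l(1) _ G(1)] l(2) same G(2) by simp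
  have "G \<noteq> mat 1"
  proof
    assume "G = mat 1"
    then show False
      using G(2) distinct_lifts same by simp
  qed
  then have nofix: "G *v y \<noteq> y" if "mink y y < 0" for y
    using deck_no_timelike_fixed[OF span_region[OF l(1)] G(1)] that by blast
  have iso: "mink (G *v x) (G *v y) = mink x y" for x y
    by (rule hyp_isometry_mink[OF deck_isometry[OF G(1)]])
  have "i \<noteq> j"
  proof
    assume ij: "i = j"
    obtain a where "a \<noteq> i"
      using other_index by blast
    then obtain b c where d: "distinct [i, a, b, c]"
      using other_indices[of i a] by blast
    then have mi: "- {i} = {a, b, c}"
      using four_indices[OF d] by auto
    have "{G *v v a, G *v v b, G *v v c} = {v a, v b, v c}"
      using V unfolding ij[symmetric] mi v' by simp
    moreover have "distinct [v a, v b, v c]"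
      using d inj_eq[OF ind(1)] by auto
    moreover have "distinct [G *v v a, G *v v b, G *v v c]"
      using d inj_eq[OF ind(3)] unfolding v' by auto
    ultimately have "G *v face_vector (v a) (v b) (v c) = face_vector (v a) (v b) (v c)"
      unfolding face_vector_isometry[of G, OF iso] by (rule face_vector_permute)
    then show False
      using nofix face_vector_timelike[OF fam(1), of a b c] d by simp
  qed
  then obtain k l where d: "distinct [i, j, k, l]"
    using other_indices by blast
  have "- {i} = {j, k, l}" "- {j} = {i, k, l}"
    using d four_indices[OF d] by auto
  then have "(*v) G ` {v i, v k, v l} = {v j, v k, v l}"
    using V unfolding v' by simp
  then show "(\<Sum>a\<in>UNIV. mink (\<nu> a) (v' j)) > 1"
    unfolding v' by (rule tilt_inequality[OF fam(1) d \<nu>(1) iso _ opp[unfolded v'] nofix])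
qed

section \<open>Faces and angles of the lifted triangulation\<close>

text \<open>Reading off the vertices from the convex set makes them independent of the matrix and
  of the order in which a lift presents them.\<close>

definition verts :: "(real^4) set \<Rightarrow> (real^4) set" where
  "verts P = {x. x extreme_point_of P}"

abbreviation TM :: "('t \<times> (real^4) set) set" where
  "TM \<equiv> mink_triangulation T e f Nt p \<O>"

lemma verts_hull: "\<not> affine_dependent c \<Longrightarrow> verts (convex hull c) = c"
  unfolding verts_def by (simp add: extreme_point_of_convex_hull_affine_independent)

lemma tetrahedron_lift:
  assumes "D \<in> TM"
  obtains A v where "lift (fst D) A v" "snd D = convex hull (range v)" "verts (snd D) = range v"
proof -
  obtain \<sigma> A v where D: "D = (\<sigma>, convex hull (range v))" "\<sigma> \<in> tetrahedra T" "lifted_vertices T e f Nt p \<O> \<sigma> A v"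
    using assms unfolding mink_triangulation_def by blast
  then have l: "lift (fst D) A v"
    by (simp add: lift_def)
  have "independent (range v)"
    using lift_vertex_family[OF l] spanning_four_independent(2) by (auto simp: vertex_family_def)
  then have "verts (snd D) = range v"
    using D(1) verts_hull[of "range v"] affine_dependent_imp_dependent by auto
  then show ?thesis
    using that[OF l] D(1) by simp
qed

lemma verts_tetrahedron:
  assumes "D \<in> TM"
  shows "independent (verts (snd D))" "card (verts (snd D)) = 4" "finite (verts (snd D))"
    "snd D = convex hull (verts (snd D))"
proof -
  obtain A v where l: "lift (fst D) A v" "snd D = convex hull (range v)" "verts (snd D) = range v"
    by (rule tetrahedron_lift[OF assms])
  have "span (range v) = UNIV"
    using lift_vertex_family[OF l(1)] by (simp add: vertex_family_def)
  note ind = spanning_four_independent[OF this]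
  show "independent (verts (snd D))" "card (verts (snd D)) = 4" "finite (verts (snd D))"
    "snd D = convex hull (verts (snd D))"
    using ind l by (simp_all add: card_image)
qed

lemma subset_verts_independent:
  assumes "D \<in> TM" "c \<subseteq> verts (snd D)"
  shows "\<not> affine_dependent c" "independent c" "finite c" "verts (convex hull c) = c"
    "aff_dim (convex hull c) = int (card c) - 1"
proof -
  show ind: "independent c"
    using independent_mono[OF verts_tetrahedron(1)[OF assms(1)] assms(2)] .
  then show aff: "\<not> affine_dependent c"
    using affine_dependent_imp_dependent by blast
  show "finite c"
    using finite_subset[OF assms(2) verts_tetrahedron(3)[OF assms(1)]] .
  show "verts (convex hull c) = c"
    by (rule verts_hull[OF aff])
  show "aff_dim (convex hull c) = int (card c) - 1"
    using aff_dim_affine_independent[OF aff] by (simp add: aff_dim_convex_hull)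
qed

lemma face_of_tetrahedron_iff:
  assumes "D \<in> TM"
  shows "F face_of snd D \<longleftrightarrow> (\<exists>c \<subseteq> verts (snd D). F = convex hull c)"
  using face_of_convex_hull_affine_independent[OF subset_verts_independent(1)[OF assms subset_refl], of F]
    verts_tetrahedron(4)[OF assms] by simp

lemma face_of_dim:
  assumes "D \<in> TM" "F face_of snd D" "aff_dim F = int n - 1"
  shows "verts F \<subseteq> verts (snd D)" "card (verts F) = n" "F = convex hull (verts F)"
proof -
  obtain c where c: "c \<subseteq> verts (snd D)" "F = convex hull c"
    using assms face_of_tetrahedron_iff by blast
  note i = subset_verts_independent[OF assms(1) c(1)]
  show "verts F \<subseteq> verts (snd D)" "card (verts F) = n" "F = convex hull (verts F)"
    using i(4,5) c assms(3) by simp_all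
qed

lemma hull_face_of_iff:
  assumes "D \<in> TM" "c \<subseteq> verts (snd D)" "D' \<in> TM"
  shows "(convex hull c) face_of snd D' \<longleftrightarrow> c \<subseteq> verts (snd D')"
proof
  assume "(convex hull c) face_of snd D'"
  then obtain c' where c': "c' \<subseteq> verts (snd D')" "convex hull c = convex hull c'"
    using face_of_tetrahedron_iff[OF assms(3)] by blast
  have "c = c'"
    using arg_cong[OF c'(2), of verts] subset_verts_independent(4)[OF assms(1,2)]
      subset_verts_independent(4)[OF assms(3) c'(1)] by simp
  then show "c \<subseteq> verts (snd D')"
    using c'(1) by simp
next
  assume "c \<subseteq> verts (snd D')"
  then show "(convex hull c) face_of snd D'"
    using face_of_tetrahedron_iff[OF assms(3)] by blast
qed

text \<open>Adjacency in coordinates: the apex \<open>z\<close> of the second tetrahedron expanded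
  in the vertices of the first.\<close>

lemma adjacent_relation:
  assumes D: "D \<in> TM" "D' \<in> TM" "D \<noteq> D'"
    and vD: "verts (snd D) = {k, l, x, y}" and vD': "verts (snd D') = {k, l, x, z}"
    and d: "distinct [k, l, x, y]" "distinct [k, l, x, z]"
  obtains r b1 b2 b3 where "z + r *\<^sub>R y = b1 *\<^sub>R k + b2 *\<^sub>R l + b3 *\<^sub>R x" "r > 0"
    "fst D = fst D' \<Longrightarrow> b1 + b2 + b3 > 1 + r"
proof -
  obtain A v where l: "lift (fst D) A v" "snd D = convex hull (range v)" "verts (snd D) = range v"
    by (rule tetrahedron_lift[OF D(1)])
  obtain A' v' where l': "lift (fst D') A' v'" "snd D' = convex hull (range v')" "verts (snd D') = range v'"
    by (rule tetrahedron_lift[OF D(2)])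
  have sp: "span (range v) = UNIV" "span (range v') = UNIV"
    using lift_vertex_family[OF l(1)] lift_vertex_family[OF l'(1)] by (simp_all add: vertex_family_def)
  have inj: "inj v" "inj v'"
    using spanning_four_independent(1) sp by auto
  have "y \<in> range v" "k \<in> range v" "l \<in> range v" "x \<in> range v" "z \<in> range v'"
    using l(3) vD l'(3) vD' by auto
  then obtain i a b c j where ix: "y = v i" "k = v a" "l = v b" "x = v c" "z = v' j"
    by blast
  have di: "distinct [i, a, b, c]"
    using d(1) ix by auto
  have "v ` (- {i}) = range v - {y}"
    using inj(1) ix by (auto dest: injD)
  moreover have "v' ` (- {j}) = range v' - {z}"
    using inj(2) ix by (auto dest: injD)
  moreover have "range v - {y} = range v' - {z}"
    unfolding l(3)[symmetric] l'(3)[symmetric] vD vD' using d by auto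
  ultimately have V: "v ` (- {i}) = v' ` (- {j})"
    by simp
  have ne: "(fst D, range v) \<noteq> (fst D', range v')"
    using D(3) l(2) l'(2) by (auto simp: prod_eq_iff)
  obtain \<nu> where \<nu>: "\<And>a b. mink (\<nu> a) (v b) = (if a = b then 1 else 0)"
      "\<And>y. y = (\<Sum>a\<in>UNIV. mink (\<nu> a) y *\<^sub>R v a)"
    by (rule mink_dual_basis[OF sp(1)]) (rule that; assumption)
  note adj = adjacent_lifts[OF l(1) l'(1) ne V \<nu>]
  have z: "z = mink (\<nu> i) z *\<^sub>R y + mink (\<nu> a) z *\<^sub>R k + mink (\<nu> b) z *\<^sub>R l + mink (\<nu> c) z *\<^sub>R x"
    using \<nu>(2)[of z] unfolding sum_four_indices[OF di] ix(1-4) .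
  show ?thesis
  proof (rule that[of "- mink (\<nu> i) z" "mink (\<nu> a) z" "mink (\<nu> b) z" "mink (\<nu> c) z"])
    have "z + (- mink (\<nu> i) z) *\<^sub>R y = (mink (\<nu> i) z *\<^sub>R y + mink (\<nu> a) z *\<^sub>R k + mink (\<nu> b) z *\<^sub>R l
        + mink (\<nu> c) z *\<^sub>R x) + (- mink (\<nu> i) z) *\<^sub>R y"
      by (rule arg_cong[OF z])
    then show "z + (- mink (\<nu> i) z) *\<^sub>R y = mink (\<nu> a) z *\<^sub>R k + mink (\<nu> b) z *\<^sub>R l + mink (\<nu> c) z *\<^sub>R x"
      by simp
    show "- mink (\<nu> i) z > 0"
      using adj(1) ix(5) by simp
    show "mink (\<nu> a) z + mink (\<nu> b) z + mink (\<nu> c) z > 1 + (- mink (\<nu> i) z)" if "fst D = fst D'"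
      using adj(2)[OF that] unfolding sum_four_indices[OF di] ix(5) by simp
  qed
qed

text \<open>Otherwise the two tetrahedra would be adjacent along a face with their apices on
  different sides, although the apices coincide.\<close>

lemma tetrahedron_determined_by_verts:
  assumes "D \<in> TM" "D' \<in> TM" "verts (snd D) = verts (snd D')"
  shows "D = D'"
proof (rule ccontr)
  assume ne: "D \<noteq> D'"
  obtain k l x y where v: "verts (snd D) = {k, l, x, y}" "distinct [k, l, x, y]"
  proof -
    obtain vs where "distinct vs" "set vs = verts (snd D)"
      using finite_distinct_list[OF verts_tetrahedron(3)[OF assms(1)]] by blast
    moreover from this have "length vs = 4"
      using distinct_card verts_tetrahedron(2)[OF assms(1)] by metis
    then obtain k l x y where "vs = [k, l, x, y]"
      by (auto simp: numeral_eq_Suc length_Suc_conv)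
    ultimately show ?thesis
      using that[of k l x y] by auto
  qed
  obtain r b1 b2 b3 where r: "y + r *\<^sub>R y = b1 *\<^sub>R k + b2 *\<^sub>R l + b3 *\<^sub>R x" "r > 0"
    by (rule adjacent_relation[OF assms(1,2) ne v(1) v(1)[unfolded assms(3)] v(2) v(2)])
  have "y = (1 / (1 + r)) *\<^sub>R (y + r *\<^sub>R y)"
  proof -
    have "y + r *\<^sub>R y = (1 + r) *\<^sub>R y"
      by (simp add: scaleR_add_left)
    then show ?thesis
      using r(2) by simp
  qed
  also have "\<dots> \<in> span {k, l, x}"
    unfolding r(1) by (intro span_mul span_add span_base) auto
  also have "span {k, l, x} \<subseteq> span ({k, l, x, y} - {y})"
    using v(2) by (intro span_mono) auto
  finally show False
    using verts_tetrahedron(1)[OF assms(1)] unfolding v(1) dependent_def by blast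
qed

lemma angle_of_relation:
  assumes "D \<in> TM" "D' \<in> TM"
    and "verts (snd D) = {k, l, x, y}" "verts (snd D') = {k, l, x, z}" "distinct [k, l, x, y]"
    and "z + r *\<^sub>R y = b1 *\<^sub>R k + b2 *\<^sub>R l + b3 *\<^sub>R x" "r > 0" "b1 + b2 + b3 > 1 + r"
  shows "strictly_convex_angle (snd D) (snd D') (convex hull {k, l, x})"
proof -
  have "independent {k, l, x, y}"
    using verts_tetrahedron(1)[OF assms(1)] assms(3) by simp
  then show ?thesis
    using strictly_convex_angle_of_relation[of k l x y z r b1 b2 b3] assms verts_tetrahedron(4)[OF assms(1)]
      verts_tetrahedron(4)[OF assms(2)] by simp
qed

lemma card_3_obtain:
  assumes "card c = 3"
  obtains k l x where "c = {k, l, x}" "distinct [k, l, x]"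
  using assms by (auto simp: card_3_iff)

lemma strictly_convex_atI:
  assumes "incident_tetrahedra S F = {D1, D2}" "D1 \<noteq> D2" "strictly_convex_angle (snd D1) (snd D2) F"
  shows "strictly_convex_at S F"
  unfolding strictly_convex_at_def using assms by blast

lemma self_adjacent_face_strictly_convex:
  assumes F: "F \<in> faces_of_dim 2 TM" and inc: "incident_tetrahedra TM F = {D1, D2}"
    and ne: "D1 \<noteq> D2" and same: "fst D1 = fst D2"
  shows "strictly_convex_at TM F"
proof -
  have D: "D1 \<in> TM" "D2 \<in> TM" "F face_of snd D1" "F face_of snd D2"
    using inc by (auto simp: incident_tetrahedra_def)
  have dim: "aff_dim F = int 3 - 1"
    using F by (simp add: faces_of_dim_def)
  note f1 = face_of_dim[OF D(1,3) dim] and f2 = face_of_dim[OF D(2,4) dim]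
  obtain k l x where c: "verts F = {k, l, x}" "distinct [k, l, x]"
    by (rule card_3_obtain[OF f1(2)])
  have apex: "\<exists>y. verts (snd D) = {k, l, x, y} \<and> y \<notin> {k, l, x}" if "D \<in> TM" "{k, l, x} \<subseteq> verts (snd D)" for D
  proof -
    have "card (verts (snd D) - {k, l, x}) = 1"
      using verts_tetrahedron(2)[OF that(1)] c f1(2) that(2) by (simp add: card_Diff_subset)
    then obtain y where "verts (snd D) - {k, l, x} = {y}"
      using card_1_singletonE by blast
    then show ?thesis
      using that(2) by blast
  qed
  obtain y where y: "verts (snd D1) = {k, l, x, y}" "y \<notin> {k, l, x}"
    using apex[OF D(1)] f1(1) c(1) by auto
  obtain z where z: "verts (snd D2) = {k, l, x, z}" "z \<notin> {k, l, x}"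
    using apex[OF D(2)] f2(1) c(1) by auto
  have d: "distinct [k, l, x, y]" "distinct [k, l, x, z]"
    using c(2) y(2) z(2) by auto
  obtain r b1 b2 b3 where r: "z + r *\<^sub>R y = b1 *\<^sub>R k + b2 *\<^sub>R l + b3 *\<^sub>R x" "r > 0"
    "fst D1 = fst D2 \<Longrightarrow> b1 + b2 + b3 > 1 + r"
    by (rule adjacent_relation[OF D(1,2) ne y(1) z(1) d]) (rule that; assumption)
  have "strictly_convex_angle (snd D1) (snd D2) (convex hull {k, l, x})"
    by (rule angle_of_relation[OF D(1,2) y(1) z(1) d(1) r(1,2) r(3)[OF same]])
  moreover have "convex hull {k, l, x} = F"
    using f1(3)[symmetric] unfolding c(1) .
  ultimately show ?thesis
    using strictly_convex_atI[OF inc ne] by simp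
qed

text \<open>The link of an edge with three incident tetrahedra is a triangle.\<close>

lemma link_triangle:
  fixes Xa Xb Xc :: "'a set"
  assumes "card Xa = 2" "card Xb = 2" "card Xc = 2" "Xa \<noteq> Xb" "Xa \<noteq> Xc" "Xb \<noteq> Xc"
    and "card (Xa \<union> Xb \<union> Xc) = 3"
  obtains x y z where "distinct [x, y, z]" "Xa = {x, y}" "Xb = {x, z}" "Xc = {y, z}"
proof -
  define U where "U = Xa \<union> Xb \<union> Xc"
  have U: "card U = 3" "finite U"
    using assms(7) card_ge_0_finite[of U] by (simp_all add: U_def)
  have comp: "\<exists>w. U - X = {w}" if "card X = 2" "X \<subseteq> U" for X
  proof -
    have "card (U - X) = 1"
      using U that by (simp add: card_Diff_subset finite_subset)
    then show ?thesis
      using card_1_singletonE by blast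
  qed
  have sub: "Xa \<subseteq> U" "Xb \<subseteq> U" "Xc \<subseteq> U"
    by (auto simp: U_def)
  obtain x y z where xyz: "U - Xc = {x}" "U - Xb = {y}" "U - Xa = {z}"
    using comp[OF assms(1) sub(1)] comp[OF assms(2) sub(2)] comp[OF assms(3) sub(3)] by blast
  have X: "Xa = U - {z}" "Xb = U - {y}" "Xc = U - {x}"
    using sub xyz by blast+
  have d: "distinct [x, y, z]"
    using X assms(4-6) by auto
  have "U = {x, y, z}"
    by (rule sym, rule card_subset_eq[OF U(2)]) (use xyz d U(1) in auto)
  then show ?thesis
    using that[of x y z] d X by auto
qed

text \<open>The relation at the face between \<open>Da\<close> and \<open>Db\<close>, compared
  with the one at the face between \<open>Da\<close> and \<open>Dc\<close>, takes the form
  \<open>z + r y + r' x = b1 k + b2 l\<close> with positive \<open>r\<close> and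
  \<open>r'\<close>. Equality of the images of \<open>Da\<close> and \<open>Db\<close> gives
  \<open>b1 + b2 > 1 + r + r'\<close>. Solved for the apices of each of the three faces, this is
  the criterion for strict convexity there.\<close>

lemma three_tetrahedra_strictly_convex:
  assumes E: "E \<in> faces_of_dim 1 TM" and inc: "incident_tetrahedra TM E = {Da, Db, Dc}"
    and ne: "distinct [Da, Db, Dc]" and same: "fst Da = fst Db"
    and faces: "card {F \<in> faces_of_dim 2 TM. E face_of F} = 3"
    and F: "F \<in> faces_of_dim 2 TM" "E face_of F"
  shows "strictly_convex_at TM F"
proof -
  have D: "Da \<in> TM" "Db \<in> TM" "Dc \<in> TM" "E face_of snd Da" "E face_of snd Db" "E face_of snd Dc"
    using inc by (auto simp: incident_tetrahedra_def)
  have dim: "aff_dim E = int 2 - 1"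
    using E by (simp add: faces_of_dim_def)
  note ea = face_of_dim[OF D(1,4) dim] and eb = face_of_dim[OF D(2,5) dim] and ec = face_of_dim[OF D(3,6) dim]
  define \<epsilon> where "\<epsilon> = verts E"
  have \<epsilon>: "E = convex hull \<epsilon>" "card \<epsilon> = 2" "\<epsilon> \<subseteq> verts (snd Da)" "\<epsilon> \<subseteq> verts (snd Db)" "\<epsilon> \<subseteq> verts (snd Dc)"
    using ea eb ec by (simp_all add: \<epsilon>_def)
  have fin: "finite \<epsilon>"
    using \<epsilon>(2) card.infinite by fastforce
  define X where "X D = verts (snd D) - \<epsilon>" for D :: "'t \<times> (real^4) set"
  have X: "card (X D) = 2" "verts (snd D) = \<epsilon> \<union> X D" if "D \<in> TM" "\<epsilon> \<subseteq> verts (snd D)" for D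
    using that verts_tetrahedron(2)[OF that(1)] \<epsilon>(2) fin by (auto simp: X_def card_Diff_subset)
  have Xne: "X D \<noteq> X D'" if "D \<in> TM" "\<epsilon> \<subseteq> verts (snd D)" "D' \<in> TM" "\<epsilon> \<subseteq> verts (snd D')" "D \<noteq> D'" for D D'
    using X(2)[OF that(1,2)] X(2)[OF that(3,4)] tetrahedron_determined_by_verts[OF that(1,3)] that(5) by auto
  have incE: "D \<in> {Da, Db, Dc}" if "D \<in> TM" "\<epsilon> \<subseteq> verts (snd D)" for D
  proof -
    have "E face_of snd D"
      using hull_face_of_iff[OF D(1) \<epsilon>(3) that(1)] that(2) \<epsilon>(1) by simp
    then show ?thesis
      using inc that(1) by (auto simp: incident_tetrahedra_def)
  qed
  let ?U = "X Da \<union> X Db \<union> X Dc"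
  have face_form: "\<exists>x \<in> ?U. G = convex hull (insert x \<epsilon>)" if G: "G \<in> faces_of_dim 2 TM" "E face_of G" for G
  proof -
    obtain D0 where D0: "D0 \<in> TM" "G face_of snd D0" "aff_dim G = int 3 - 1"
      using G(1) by (auto simp: faces_of_dim_def)
    note g = face_of_dim[OF D0]
    have "E face_of snd D0"
      using face_of_trans[OF G(2) D0(2)] .
    then have sub: "\<epsilon> \<subseteq> verts (snd D0)"
      using hull_face_of_iff[OF D(1) \<epsilon>(3) D0(1)] \<epsilon>(1) by simp
    obtain c where c: "c \<subseteq> verts G" "E = convex hull c"
      using G(2) face_of_convex_hull_affine_independent[OF subset_verts_independent(1)[OF D0(1) g(1)], of E] g(3)
      by auto
    have "verts (convex hull c) = c"
      using c(1) g(1) by (intro subset_verts_independent(4)[OF D0(1)]) auto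
    then have "\<epsilon> = c"
      using c(2) by (simp add: \<epsilon>_def)
    then have "card (verts G - \<epsilon>) = 1" "\<epsilon> \<subseteq> verts G"
      using c(1) g(2) \<epsilon>(2) fin by (simp_all add: card_Diff_subset)
    then obtain x where x: "verts G - \<epsilon> = {x}"
      using card_1_singletonE by blast
    then have "verts G = insert x \<epsilon>" "x \<in> X D0"
      using \<open>\<epsilon> \<subseteq> verts G\<close> g(1) by (auto simp: X_def)
    moreover have "X D0 \<subseteq> ?U"
      using incE[OF D0(1) sub] by auto
    ultimately show ?thesis
      using g(3) by auto
  qed
  have is_face: "convex hull (insert x \<epsilon>) \<in> faces_of_dim 2 TM \<and> E face_of convex hull (insert x \<epsilon>)"
    and verts_face: "verts (convex hull (insert x \<epsilon>)) = insert x \<epsilon>"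
    if x: "x \<in> X D" and D': "D \<in> TM" "\<epsilon> \<subseteq> verts (snd D)" for x D
  proof -
    have sub: "insert x \<epsilon> \<subseteq> verts (snd D)" "x \<notin> \<epsilon>"
      using x D' by (auto simp: X_def)
    note i = subset_verts_independent[OF D'(1) sub(1)]
    show "verts (convex hull (insert x \<epsilon>)) = insert x \<epsilon>"
      by (rule i(4))
    have "aff_dim (convex hull (insert x \<epsilon>)) = 2"
      using i(5) sub(2) fin \<epsilon>(2) by simp
    moreover have "convex hull (insert x \<epsilon>) face_of snd D"
      using face_of_tetrahedron_iff[OF D'(1)] sub(1) by blast
    moreover have "E face_of convex hull (insert x \<epsilon>)"
      using face_of_convex_hull_affine_independent[OF i(1)] \<epsilon>(1) by blast
    ultimately show "convex hull (insert x \<epsilon>) \<in> faces_of_dim 2 TM \<and> E face_of convex hull (insert x \<epsilon>)"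
      using D'(1) by (auto simp: faces_of_dim_def)
  qed
  have "{F \<in> faces_of_dim 2 TM. E face_of F} = (\<lambda>x. convex hull (insert x \<epsilon>)) ` ?U"
  proof (intro subset_antisym subsetI)
    fix G assume "G \<in> {F \<in> faces_of_dim 2 TM. E face_of F}"
    then show "G \<in> (\<lambda>x. convex hull (insert x \<epsilon>)) ` ?U"
      using face_form by blast
  next
    fix G assume "G \<in> (\<lambda>x. convex hull (insert x \<epsilon>)) ` ?U"
    then obtain x where "x \<in> ?U" "G = convex hull (insert x \<epsilon>)"
      by blast
    then show "G \<in> {F \<in> faces_of_dim 2 TM. E face_of F}"
      using is_face[of x Da] is_face[of x Db] is_face[of x Dc] D(1-3) \<epsilon>(3-5) by auto
  qed
  moreover have "inj_on (\<lambda>x. convex hull (insert x \<epsilon>)) ?U"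
  proof (rule inj_onI)
    fix x y assume xy: "x \<in> ?U" "y \<in> ?U" "convex hull (insert x \<epsilon>) = convex hull (insert y \<epsilon>)"
    have v: "verts (convex hull (insert w \<epsilon>)) = insert w \<epsilon>" if "w \<in> ?U" for w
      using that verts_face[of w Da] verts_face[of w Db] verts_face[of w Dc] D(1-3) \<epsilon>(3-5) by auto
    have "insert x \<epsilon> = insert y \<epsilon>"
      using arg_cong[OF xy(3), of verts] v xy(1,2) by simp
    moreover have "x \<notin> \<epsilon>" "y \<notin> \<epsilon>"
      using xy(1,2) by (auto simp: X_def)
    ultimately show "x = y"
      by blast
  qed
  ultimately have "card ?U = 3"
    using faces by (simp add: card_image)
  moreover have "X Da \<noteq> X Db" "X Da \<noteq> X Dc" "X Db \<noteq> X Dc"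
    using Xne D(1-3) \<epsilon>(3-5) ne by auto
  ultimately have tri: "card ?U = 3" "X Da \<noteq> X Db" "X Da \<noteq> X Dc" "X Db \<noteq> X Dc"
    by simp_all
  obtain x y z where xyz: "distinct [x, y, z]" "X Da = {x, y}" "X Db = {x, z}" "X Dc = {y, z}"
    by (rule link_triangle[OF X(1)[OF D(1) \<epsilon>(3)] X(1)[OF D(2) \<epsilon>(4)] X(1)[OF D(3) \<epsilon>(5)] tri(2-4) tri(1)])
  obtain k l where kl: "\<epsilon> = {k, l}" "k \<noteq> l"
    using \<epsilon>(2) by (auto simp: card_2_iff)
  have out: "x \<notin> {k, l}" "y \<notin> {k, l}" "z \<notin> {k, l}"
    using xyz(2,3) unfolding X_def kl(1) by auto
  have va: "verts (snd Da) = {k, l, x, y}" "verts (snd Da) = {k, l, y, x}"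
    and vb: "verts (snd Db) = {k, l, x, z}" "verts (snd Db) = {k, l, z, x}"
    and vc: "verts (snd Dc) = {k, l, y, z}" "verts (snd Dc) = {k, l, z, y}"
    using X(2)[OF D(1) \<epsilon>(3)] X(2)[OF D(2) \<epsilon>(4)] X(2)[OF D(3) \<epsilon>(5)] xyz(2-4) kl(1) by auto
  have d: "distinct [k, l, x, y]" "distinct [k, l, x, z]" "distinct [k, l, y, x]" "distinct [k, l, y, z]"
      "distinct [k, l, z, x]" "distinct [k, l, z, y]"
    using kl(2) out xyz(1) by auto
  have ne': "Da \<noteq> Db" "Da \<noteq> Dc" "Db \<noteq> Dc"
    using ne by auto
  obtain r b1 b2 b3 where r: "z + r *\<^sub>R y = b1 *\<^sub>R k + b2 *\<^sub>R l + b3 *\<^sub>R x" "r > 0"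
    "fst Da = fst Db \<Longrightarrow> b1 + b2 + b3 > 1 + r"
    by (rule adjacent_relation[OF D(1,2) ne'(1) va(1) vb(1) d(1,2)]) (rule that; assumption)
  obtain r' c1 c2 c3 where r': "z + r' *\<^sub>R x = c1 *\<^sub>R k + c2 *\<^sub>R l + c3 *\<^sub>R y" "r' > 0"
    by (rule adjacent_relation[OF D(1,3) ne'(2) va(2) vc(1) d(3,4)])
  have b3: "b3 = - r'"
  proof -
    have "(b3 + r') *\<^sub>R x = (c1 - b1) *\<^sub>R k + (c2 - b2) *\<^sub>R l + (c3 + r) *\<^sub>R y"
    proof -
      have "b3 *\<^sub>R x = z + r *\<^sub>R y - b1 *\<^sub>R k - b2 *\<^sub>R l" "r' *\<^sub>R x = c1 *\<^sub>R k + c2 *\<^sub>R l + c3 *\<^sub>R y - z"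
        using r(1) r'(1) by (simp_all add: algebra_simps)
      then have "b3 *\<^sub>R x + r' *\<^sub>R x = (z + r *\<^sub>R y - b1 *\<^sub>R k - b2 *\<^sub>R l) + (c1 *\<^sub>R k + c2 *\<^sub>R l + c3 *\<^sub>R y - z)"
        by (simp only:)
      then show ?thesis
        by (simp add: algebra_simps)
    qed
    also have "\<dots> \<in> span {k, l, y}"
      by (intro span_add span_mul span_base) auto
    finally have in_span: "(b3 + r') *\<^sub>R x \<in> span {k, l, y}" .
    have "x \<notin> span ({k, l, x, y} - {x})"
      using verts_tetrahedron(1)[OF D(1)] unfolding va(1) dependent_def by blast
    moreover have "{k, l, x, y} - {x} = {k, l, y}"
      using d(1) by auto
    ultimately have "x \<notin> span {k, l, y}"
      by simp
    then have "b3 + r' = 0"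
      using span_mul[OF in_span, of "1 / (b3 + r')"] by (cases "b3 + r' = 0") auto
    then show ?thesis
      by simp
  qed
  have gt: "b1 + b2 > 1 + r + r'"
    using r(3)[OF same] b3 by simp
  have rel: "z + r *\<^sub>R y + r' *\<^sub>R x = b1 *\<^sub>R k + b2 *\<^sub>R l"
    using r(1) unfolding b3 by simp
  have inc_face: "incident_tetrahedra TM (convex hull (insert w \<epsilon>)) = {D \<in> {Da, Db, Dc}. w \<in> verts (snd D)}"
    if w: "w \<in> X D0" and D0: "D0 \<in> TM" "\<epsilon> \<subseteq> verts (snd D0)" for w D0
  proof -
    have sub: "insert w \<epsilon> \<subseteq> verts (snd D0)"
      using w D0 by (auto simp: X_def)
    have "D1 \<in> incident_tetrahedra TM (convex hull (insert w \<epsilon>)) \<longleftrightarrow> D1 \<in> TM \<and> insert w \<epsilon> \<subseteq> verts (snd D1)" for D1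
      using hull_face_of_iff[OF D0(1) sub, of D1] by (auto simp: incident_tetrahedra_def)
    then show ?thesis
      using incE D(1-3) \<epsilon>(3-5) by blast
  qed
  have Fx: "strictly_convex_at TM (convex hull (insert x \<epsilon>))"
  proof -
    have "strictly_convex_angle (snd Da) (snd Db) (convex hull {k, l, x})"
      using angle_of_relation[OF D(1,2) va(1) vb(1) d(1) r(1,2)] r(3)[OF same] by blast
    moreover have "incident_tetrahedra TM (convex hull (insert x \<epsilon>)) = {Da, Db}"
      using inc_face[of x Da] xyz(2) D(1) \<epsilon>(3) va(1) vb(1) vc(1) d by auto
    moreover have "insert x \<epsilon> = {k, l, x}"
      unfolding kl(1) by blast
    ultimately show ?thesis
      using ne'(1) by (simp add: strictly_convex_atI)
  qed
  have Fy: "strictly_convex_at TM (convex hull (insert y \<epsilon>))"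
  proof -
    have "z + r' *\<^sub>R x = b1 *\<^sub>R k + b2 *\<^sub>R l + (- r) *\<^sub>R y"
      using rel by (simp add: algebra_simps)
    then have "strictly_convex_angle (snd Da) (snd Dc) (convex hull {k, l, y})"
      by (rule angle_of_relation[OF D(1,3) va(2) vc(1) d(3) _ r'(2)]) (use gt in simp)
    moreover have "incident_tetrahedra TM (convex hull (insert y \<epsilon>)) = {Da, Dc}"
      using inc_face[of y Da] xyz(2) D(1) \<epsilon>(3) va(1) vb(1) vc(1) d by auto
    moreover have "insert y \<epsilon> = {k, l, y}"
      unfolding kl(1) by blast
    ultimately show ?thesis
      using ne'(2) by (simp add: strictly_convex_atI)
  qed
  have Fz: "strictly_convex_at TM (convex hull (insert z \<epsilon>))"
  proof -
    have "r *\<^sub>R y + r' *\<^sub>R x = b1 *\<^sub>R k + b2 *\<^sub>R l - z"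
      using rel by (simp add: algebra_simps)
    then have "(1 / r) *\<^sub>R (r *\<^sub>R y + r' *\<^sub>R x) = (1 / r) *\<^sub>R (b1 *\<^sub>R k + b2 *\<^sub>R l - z)"
      by simp
    then have eq: "y + (r' / r) *\<^sub>R x = (b1 / r) *\<^sub>R k + (b2 / r) *\<^sub>R l + (- 1 / r) *\<^sub>R z"
      using r(2) by (simp add: scaleR_add_right scaleR_diff_right)
    have "(b1 + b2 - 1) / r > (r + r') / r"
      using gt r(2) by (intro divide_strict_right_mono) auto
    then have "b1 / r + b2 / r + (- 1 / r) > 1 + r' / r"
      using r(2) by (simp add: add_divide_distrib diff_divide_distrib)
    then have "strictly_convex_angle (snd Db) (snd Dc) (convex hull {k, l, z})"
      using r(2) r'(2) by (intro angle_of_relation[OF D(2,3) vb(2) vc(2) d(5) eq]) auto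
    moreover have "incident_tetrahedra TM (convex hull (insert z \<epsilon>)) = {Db, Dc}"
      using inc_face[of z Db] xyz(3) D(2) \<epsilon>(4) va(1) vb(1) vc(1) d by auto
    moreover have "insert z \<epsilon> = {k, l, z}"
      unfolding kl(1) by blast
    ultimately show ?thesis
      using ne'(3) by (simp add: strictly_convex_atI)
  qed
  obtain w where "w \<in> ?U" "F = convex hull (insert w \<epsilon>)"
    using face_form[OF F] by blast
  moreover have "?U = {x, y, z}"
    using xyz by auto
  ultimately show ?thesis
    using Fx Fy Fz by auto
qed

end

section \<open>Self-adjacent tetrahedra and three-valent edges\<close>

theorem theorem6p6:
  fixes N :: "'n::metric_space set"
    and Nt :: "(real^4) set"
    and p :: "real^4 \<Rightarrow> 'n"
    and T :: "'t triangulation"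
    and e :: "'t \<Rightarrow> real^4 \<Rightarrow> real^4"
    and f :: "'t \<Rightarrow> real^4 \<Rightarrow> 'n"
    and \<O> :: "'n set set"
    and TM :: "('t \<times> (real^4) set) set"
  assumes "hyperbolic_manifold N"
    and "geometric_triangulation N T e f"
    and "universal_cover N Nt p"
    and "horospherical_cross_section Nt p \<O>"
    and "TM = mink_triangulation T e f Nt p \<O>"
  shows "(\<forall>F \<in> faces_of_dim 2 TM. \<forall>D1 D2.
            incident_tetrahedra TM F = {D1, D2} \<and> D1 \<noteq> D2 \<and> fst D1 = fst D2 \<longrightarrow>
            strictly_convex_at TM F) \<and>
         (\<forall>E \<in> faces_of_dim 1 TM. \<forall>D1 D2 D3 F1 F2 F3.
            incident_tetrahedra TM E = {D1, D2, D3} \<and> distinct [D1, D2, D3] \<and>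
            {F \<in> faces_of_dim 2 TM. E face_of F} = {F1, F2, F3} \<and> distinct [F1, F2, F3] \<and>
            \<not> distinct [fst D1, fst D2, fst D3] \<longrightarrow>
            strictly_convex_at TM F1 \<and> strictly_convex_at TM F2 \<and> strictly_convex_at TM F3)"
proof (intro conjI ballI allI impI; elim conjE)
  interpret lifted_triangulation N Nt p T e f \<O>
    using assms by unfold_locales
  fix F D1 D2
  assume "F \<in> faces_of_dim 2 TM" "incident_tetrahedra TM F = {D1, D2}" "D1 \<noteq> D2" "fst D1 = fst D2"
  then show "strictly_convex_at TM F"
    unfolding assms(5) by (rule self_adjacent_face_strictly_convex)
next
  interpret lifted_triangulation N Nt p T e f \<O>
    using assms by unfold_locales
  fix E D1 D2 D3 F1 F2 F3
  assume E: "E \<in> faces_of_dim 1 TM" and inc: "incident_tetrahedra TM E = {D1, D2, D3}"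
    and dD: "distinct [D1, D2, D3]" and faces: "{F \<in> faces_of_dim 2 TM. E face_of F} = {F1, F2, F3}"
    and dF: "distinct [F1, F2, F3]" and nd: "\<not> distinct [fst D1, fst D2, fst D3]"
  have card: "card {F \<in> faces_of_dim 2 TM. E face_of F} = 3"
    unfolding faces using dF by simp
  consider "fst D1 = fst D2" | "fst D1 = fst D3" | "fst D2 = fst D3"
    using nd by auto
  then obtain Da Db Dc where D: "{D1, D2, D3} = {Da, Db, Dc}" "distinct [Da, Db, Dc]" "fst Da = fst Db"
  proof cases
    case 1
    then show ?thesis
      using that[of D1 D2 D3] dD by simp
  next
    case 2
    then show ?thesis
      using that[of D1 D3 D2] dD by (auto simp: insert_commute)
  next
    case 3
    then show ?thesis
      using that[of D2 D3 D1] dD by (auto simp: insert_commute)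
  qed
  have all: "strictly_convex_at TM F" if "F \<in> {F \<in> faces_of_dim 2 TM. E face_of F}" for F
    unfolding assms(5)
    by (rule three_tetrahedra_strictly_convex[OF E[unfolded assms(5)] inc[unfolded D(1) assms(5)] D(2,3)
        card[unfolded assms(5)]]) (use that in \<open>simp_all add: assms(5)\<close>)
  show "strictly_convex_at TM F1" "strictly_convex_at TM F2" "strictly_convex_at TM F3"
    using all unfolding faces by blast+
qed

end
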